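(* Let $K$ be a field, $n\geq 2$, $S=K[x_1,\ldots,x_n]$, and $\mathbf d:1=d_0\mid d_1\mid\cdots\mid d_s$ a $\mathbf d$-sequence. Let $2\leq i_1<i_2<\cdots<i_r=n$, let $\alpha_1,\ldots,\alpha_r$ be positive integers with $\mathbf d$-decompositions $\alpha_q=\sum_{j=0}^s\alpha_{qj}d_j$, let $u=\prod_{q=1}^r x_{i_q}^{\alpha_q}$ and $$I=\langle u\rangle_{\mathbf d}=\prod_{q=1}^r\prod_{j=0}^s(\mathbf m_q^{[d_j]})^{\alpha_{qj}}.$$ For $1\leq a\leq r$ let $P_a(I)$ be the set of pairs $(\lambda,t)\in\mathbb N^a\times\mathbb N^a$ such that $1\leq\lambda_1<\cdots<\lambda_a=r$, $0\le t_1<\cdots<t_a\le s$ and $\alpha_{\lambda_\nu t_\nu}\neq 0$ for $1\leq\nu\leq a$. For $(\lambda,t)\in P_a(I)$ let $J_{(\lambda,t)}$ be the ideal $$\prod_{e=1}^a(x_{i_{\lambda_e}}\cdots x_{i_{\lambda_{e-1}}+1})^{d_{t_e}-1}\ \prod_{\nu=1}^a\Big[\mathbf m_{\lambda_\nu}^{[d_{t_{\nu+1}}]}\prod_{j>t_\nu}(\mathbf m_{\lambda_\nu}^{[d_j]})^{\alpha_{\lambda_\nu j}}\,(\mathbf m_{\lambda_\nu}^{[d_{t_\nu}]})^{\alpha_{\lambda_\nu t_\nu}-1}\prod_{q=\lambda_{\nu-1}+1}^{\lambda_\nu-1}\ \prod_{j\geq t_\nu}(\mathbf m_q^{[d_j]})^{\alpha_{qj}}\Big],$$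 where $\lambda_0=0$, $i_0=0$, and where for $\nu=a$ the factor $\mathbf m_{\lambda_a}^{[d_{t_{a+1}}]}$ is read as $S$. Let $J=\sum_{a=1}^r\sum_{(\lambda,t)\in P_a(I)}J_{(\lambda,t)}$. Then $\operatorname{Soc}(S/I)=(J+I)/I$.
   Context: A $\mathbf d$-sequence is a strictly increasing sequence of positive integers $1=d_0\mid d_1\mid\cdots\mid d_s$, each dividing the next. Every $a\in\mathbb N$ has a unique $\mathbf d$-decomposition $a=\sum_{t=0}^s a_td_t$ with integers $a_t\geq 0$ and $a_t<d_{t+1}/d_t$ for $0\leq t<s$; write $a\leq_{\mathbf d}b$ if $a_t\leq b_t$ for all $t$ in the $\mathbf d$-decompositions. A monomial ideal $I\subset S$ is $\mathbf d$-fixed if for every monomial $v\in I$, all $1\leq j<i\leq n$ and every $t\leq_{\mathbf d}\nu_i(v)$ ($\nu_i(v)$ the exponent of $x_i$ in $v$), one has $v\,x_j^t/x_i^t\in I$. $\langle u\rangle_{\mathbf d}$ is the smallest $\mathbf d$-fixed ideal containing the monomial $u$. $\mathbf m_q=\{x_1,\ldots,x_{i_q}\}$ and $\mathbf m_q^{[d]}=\{x_1^d,\ldots,x_{i_q}^d\}$; in products and powers a set of monomials stands for the ideal of $S$ it generates. $\operatorname{Soc}(S/I)=(0:_{S/I}(x_1,\ldots,x_n))$. *)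

theory Defs
  imports "HOL-Algebra.Ideal_Product" "HOL-Algebra.QuotRing" "HOL-Library.Poly_Mapping"
begin

section \<open>The polynomial ring in the variables with indices 1 to n\<close>

text \<open>
  Polynomials over a field are finitely supported functions from exponent vectors to coefficients,
  and exponent vectors are finitely supported functions from variable indices to exponents. The
  carrier below selects the polynomials in which only the variables with index 1 to \<open>n\<close> occur; the
  operations are those of the type.
\<close>

type_synonym 'k mpol = "(nat \<Rightarrow>\<^sub>0 nat) \<Rightarrow>\<^sub>0 'k"

definition poly_ring :: "nat \<Rightarrow> ('k::field) mpol ring" where
  "poly_ring n = \<lparr>carrier = {p. \<forall>m\<in>Poly_Mapping.keys p. Poly_Mapping.keys m \<subseteq> {1..n}},
     mult = (*), one = 1, zero = 0, add = (+)\<rparr>"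

definition pmonom :: "(nat \<Rightarrow>\<^sub>0 nat) \<Rightarrow> ('k::field) mpol" where
  "pmonom m = Poly_Mapping.single m 1"

definition X :: "nat \<Rightarrow> ('k::field) mpol" where
  "X l = pmonom (Poly_Mapping.single l 1)"

lemma carrier_poly_ring_mult:
  assumes "p \<in> carrier (poly_ring n)" "q \<in> carrier (poly_ring n)"
  shows "p * q \<in> carrier (poly_ring n)"
proof -
  have "Poly_Mapping.keys m \<subseteq> {1..n}" if m: "m \<in> Poly_Mapping.keys (p * q)" for m
  proof -
    obtain a b where "m = a + b" "a \<in> Poly_Mapping.keys p" "b \<in> Poly_Mapping.keys q"
      using keys_mult[of p q] m by blast
    then show ?thesis
      using assms keys_add[of a b] unfolding poly_ring_def by fastforce
  qed
  then show ?thesis unfolding poly_ring_def by simp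
qed

lemma carrier_poly_ring_add:
  assumes "p \<in> carrier (poly_ring n)" "q \<in> carrier (poly_ring n)"
  shows "p + q \<in> carrier (poly_ring n)"
  using assms keys_add[of p q] unfolding poly_ring_def by fastforce

lemma cring_poly_ring: "cring (poly_ring n :: ('k::field) mpol ring)"
proof (rule cringI)
  show "abelian_group (poly_ring n :: 'k mpol ring)"
  proof (rule abelian_groupI)
    fix x :: "'k mpol" assume x: "x \<in> carrier (poly_ring n)"
    then have "- x \<in> carrier (poly_ring n)"
      by (simp add: poly_ring_def)
    then show "\<exists>y\<in>carrier (poly_ring n). y \<oplus>\<^bsub>poly_ring n\<^esub> x = \<zero>\<^bsub>poly_ring n\<^esub>"
      by (intro bexI[of _ "- x"]) (simp_all add: poly_ring_def)
  next
    fix x y :: "'k mpol"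
    assume "x \<in> carrier (poly_ring n)" "y \<in> carrier (poly_ring n)"
    then show "x \<oplus>\<^bsub>poly_ring n\<^esub> y \<in> carrier (poly_ring n)"
      using carrier_poly_ring_add by (simp add: poly_ring_def)
  qed (auto simp: poly_ring_def algebra_simps)
  show "Group.comm_monoid (poly_ring n :: 'k mpol ring)"
  proof (rule comm_monoidI)
    fix x y :: "'k mpol"
    assume "x \<in> carrier (poly_ring n)" "y \<in> carrier (poly_ring n)"
    then show "x \<otimes>\<^bsub>poly_ring n\<^esub> y \<in> carrier (poly_ring n)"
      using carrier_poly_ring_mult by (simp add: poly_ring_def)
  qed (auto simp: poly_ring_def algebra_simps)
qed (auto simp: poly_ring_def algebra_simps)

section \<open>Decompositions with respect to a divisor sequence\<close>

definition d_sequence :: "(nat \<Rightarrow> nat) \<Rightarrow> nat \<Rightarrow> bool" where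
  "d_sequence d s \<longleftrightarrow> d 0 = 1 \<and> (\<forall>t<s. d t < d (Suc t) \<and> d t dvd d (Suc t))"

definition is_decomp :: "(nat \<Rightarrow> nat) \<Rightarrow> nat \<Rightarrow> nat \<Rightarrow> (nat \<Rightarrow> nat) \<Rightarrow> bool" where
  "is_decomp d s a c \<longleftrightarrow>
     a = (\<Sum>t\<le>s. c t * d t) \<and> (\<forall>t<s. c t < d (Suc t) div d t) \<and> (\<forall>t>s. c t = 0)"

definition decomp :: "(nat \<Rightarrow> nat) \<Rightarrow> nat \<Rightarrow> nat \<Rightarrow> nat \<Rightarrow> nat" where
  "decomp d s a = (THE c. is_decomp d s a c)"

definition le_d :: "(nat \<Rightarrow> nat) \<Rightarrow> nat \<Rightarrow> nat \<Rightarrow> nat \<Rightarrow> bool" where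
  "le_d d s a b \<longleftrightarrow> (\<forall>t\<le>s. decomp d s a t \<le> decomp d s b t)"

lemma d_sequence_pos:
  assumes "d_sequence d s" "t \<le> s"
  shows "0 < d t"
proof (cases t)
  case 0
  then show ?thesis using assms by (simp add: d_sequence_def)
next
  case (Suc t')
  then have "d t' < d t" using assms by (auto simp: d_sequence_def)
  then show ?thesis by simp
qed

lemma d_sequence_dvd:
  assumes "d_sequence d s" "k \<le> t" "t \<le> s"
  shows "d k dvd d t"
  using assms(2,3)
proof (induction t rule: dec_induct)
  case (step m)
  then have "d m dvd d (Suc m)" using assms(1) by (auto simp: d_sequence_def)
  then show ?case using step by (auto intro: dvd_trans)
qed simp

lemma is_decomp_partial_sum:
  assumes d: "d_sequence d s" and c: "is_decomp d s a c" and k: "k \<le> s"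
  shows "(\<Sum>t<k. c t * d t) = a mod d k"
proof -
  have less: "(\<Sum>t<k. c t * d t) < d k"
    using k
  proof (induction k)
    case 0
    then show ?case using d by (simp add: d_sequence_def)
  next
    case (Suc k)
    have dv: "d k dvd d (Suc k)" using d Suc by (simp add: d_sequence_def)
    have "c k < d (Suc k) div d k" using c Suc by (simp add: is_decomp_def)
    then have "(c k + 1) * d k \<le> (d (Suc k) div d k) * d k"
      by (intro mult_le_mono1) simp
    then have "c k * d k + d k \<le> d (Suc k)" using dv by (simp add: algebra_simps)
    then show ?case using Suc by simp
  qed
  have "{..s} = {..<k} \<union> {k..s}" using k by auto
  then have a: "a = (\<Sum>t<k. c t * d t) + (\<Sum>t\<in>{k..s}. c t * d t)"
    using c sum.union_disjoint[of "{..<k}" "{k..s}" "\<lambda>t. c t * d t"]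
    by (fastforce simp: is_decomp_def)
  have "d k dvd (\<Sum>t\<in>{k..s}. c t * d t)"
    using d_sequence_dvd[OF d] by (auto intro!: dvd_sum)
  then have "a mod d k = (\<Sum>t<k. c t * d t) mod d k"
    using a by (auto elim!: dvdE)
  then show ?thesis using less by simp
qed

lemma ex1_decomp:
  assumes d: "d_sequence d s"
  shows "\<exists>!c. is_decomp d s a c"
proof (rule ex_ex1I)
  let ?c = "\<lambda>t. if t < s then (a mod d (Suc t)) div d t else if t = s then a div d s else 0"
  have part: "(\<Sum>t<k. ?c t * d t) = a mod d k" if "k \<le> s" for k
    using that
  proof (induction k)
    case 0
    then show ?case using d by (simp add: d_sequence_def)
  next
    case (Suc k)
    have "d k dvd d (Suc k)" using d Suc by (simp add: d_sequence_def)
    then have "a mod d (Suc k) mod d k = a mod d k" by (simp add: mod_mod_cancel)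
    then have "a mod d (Suc k) div d k * d k + a mod d k = a mod d (Suc k)"
      by (metis div_mult_mod_eq)
    then show ?case using Suc by simp
  qed
  have "(\<Sum>t\<le>s. ?c t * d t) = (\<Sum>t<s. ?c t * d t) + ?c s * d s"
    by (simp add: lessThan_Suc_atMost[symmetric])
  then have "a = (\<Sum>t\<le>s. ?c t * d t)"
    using part[of s] by simp
  moreover have "?c t < d (Suc t) div d t" if "t < s" for t
  proof -
    have "a mod d (Suc t) < d (Suc t)" using d_sequence_pos[OF d] that by simp
    moreover have "d t dvd d (Suc t)" using d that by (simp add: d_sequence_def)
    ultimately show ?thesis using that
      by (auto intro!: less_mult_imp_div_less)
  qed
  ultimately show "\<exists>c. is_decomp d s a c"
    unfolding is_decomp_def by (intro exI[of _ ?c]) auto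
next
  fix c c'
  assume c: "is_decomp d s a c" and c': "is_decomp d s a c'"
  show "c = c'"
  proof
    fix t
    have *: "(\<Sum>t<k. c t * d t) = (\<Sum>t<k. c' t * d t)" if "k \<le> Suc s" for k
    proof (cases "k = Suc s")
      case True
      then show ?thesis using c c' by (simp add: is_decomp_def lessThan_Suc_atMost)
    next
      case False
      then show ?thesis using that is_decomp_partial_sum[OF d] c c' by simp
    qed
    show "c t = c' t"
    proof (cases "t \<le> s")
      case True
      then have "c t * d t = c' t * d t" using *[of t] *[of "Suc t"] by simp
      then show ?thesis using d_sequence_pos[OF d True] by simp
    next
      case False
      then show ?thesis using c c' by (simp add: is_decomp_def)
    qed
  qed
qed

section \<open>Ideals fixed with respect to a divisor sequence\<close>

definition monomial_ideal :: "nat \<Rightarrow> ('k::field) mpol set \<Rightarrow> bool" where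
  "monomial_ideal n I \<longleftrightarrow>
     (\<exists>M. (\<forall>m\<in>M. Poly_Mapping.keys m \<subseteq> {1..n}) \<and> I = Idl\<^bsub>poly_ring n\<^esub> (pmonom ` M))"

text \<open>
  The subtraction of exponent vectors below never truncates at zero, since \<open>le_d d s t b\<close>
  implies \<open>t \<le> b\<close> for a divisor sequence.
\<close>

definition d_fixed :: "nat \<Rightarrow> (nat \<Rightarrow> nat) \<Rightarrow> nat \<Rightarrow> ('k::field) mpol set \<Rightarrow> bool" where
  "d_fixed n d s I \<longleftrightarrow> monomial_ideal n I \<and>
     (\<forall>v j i t. pmonom v \<in> I \<longrightarrow> 1 \<le> j \<longrightarrow> j < i \<longrightarrow> i \<le> n \<longrightarrow> le_d d s t (Poly_Mapping.lookup v i) \<longrightarrow>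
        pmonom (v + Poly_Mapping.single j t - Poly_Mapping.single i t) \<in> I)"

definition d_fixed_hull ::
    "nat \<Rightarrow> (nat \<Rightarrow> nat) \<Rightarrow> nat \<Rightarrow> ('k::field) mpol \<Rightarrow> 'k mpol set" where
  "d_fixed_hull n d s u = \<Inter>{I. d_fixed n d s I \<and> u \<in> I}"

lemma le_d_imp_le:
  assumes d: "d_sequence d s" and "le_d d s a b"
  shows "a \<le> b"
proof -
  have "is_decomp d s a (decomp d s a)" "is_decomp d s b (decomp d s b)"
    using theI'[OF ex1_decomp[OF d]] unfolding decomp_def by blast+
  then have "a = (\<Sum>t\<le>s. decomp d s a t * d t)" "b = (\<Sum>t\<le>s. decomp d s b t * d t)"
    by (auto simp: is_decomp_def)
  then show ?thesis
    using assms(2) by (metis (no_types, lifting) atMost_iff le_d_def mult_le_mono1 sum_mono)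
qed

lemma monomial_ideal_iff:
  fixes I :: "('k::field) mpol set"
  shows "monomial_ideal n I \<longleftrightarrow>
    ideal I (poly_ring n) \<and> (\<forall>f\<in>I. \<forall>m\<in>Poly_Mapping.keys f. pmonom m \<in> I)"
    (is "?L \<longleftrightarrow> ?R")
proof
  interpret S: cring "poly_ring n :: 'k mpol ring" by (rule cring_poly_ring)
  assume ?L
  then obtain M where M: "\<And>m. m \<in> M \<Longrightarrow> Poly_Mapping.keys m \<subseteq> {1..n}"
    and I: "I = Idl\<^bsub>poly_ring n\<^esub> (pmonom ` M)"
    unfolding monomial_ideal_def by blast
  have MS: "pmonom ` M \<subseteq> carrier (poly_ring n :: 'k mpol ring)"
    using M by (fastforce simp: poly_ring_def pmonom_def)
  have id: "ideal I (poly_ring n)" unfolding I by (rule S.genideal_ideal[OF MS])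
  interpret I: ideal I "poly_ring n" by (rule id)
  define T :: "'k mpol set" where "T = {f \<in> carrier (poly_ring n). \<forall>m\<in>Poly_Mapping.keys f. pmonom m \<in> I}"
  have add: "f + g \<in> T" if "f \<in> T" "g \<in> T" for f g
    using that keys_add[of f g] carrier_poly_ring_add[of f n g] unfolding T_def by auto
  have mult: "g * f \<in> T" if f: "f \<in> T" and g: "g \<in> carrier (poly_ring n)" for f g
  proof -
    have "pmonom m \<in> I" if m: "m \<in> Poly_Mapping.keys (g * f)" for m
    proof -
      obtain a b where ab: "m = a + b" "a \<in> Poly_Mapping.keys g" "b \<in> Poly_Mapping.keys f"
        using keys_mult[of g f] m by blast
      then have "pmonom b \<in> I" using f by (simp add: T_def)
      moreover have "(pmonom a :: 'k mpol) \<in> carrier (poly_ring n)"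
        using g ab by (simp add: poly_ring_def pmonom_def)
      ultimately have "pmonom a * pmonom b \<in> I"
        using I.I_l_closed[of "pmonom b" "pmonom a"] by (simp add: poly_ring_def)
      then show ?thesis using ab by (simp add: pmonom_def mult_single)
    qed
    then show ?thesis using f g carrier_poly_ring_mult[of g n f] by (simp add: T_def)
  qed
  have one: "-1 \<in> carrier (poly_ring n :: 'k mpol ring)" by (auto simp: poly_ring_def)
  have "ideal T (poly_ring n)"
  proof (rule idealI)
    show "ring (poly_ring n :: 'k mpol ring)" by (rule S.ring_axioms)
    show "subgroup T (add_monoid (poly_ring n))"
    proof (rule S.add.subgroupI)
      show "T \<subseteq> carrier (poly_ring n)" by (auto simp: T_def)
      have "0 \<in> T" by (simp add: T_def poly_ring_def)
      then show "T \<noteq> {}" by auto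
    next
      fix f assume f: "f \<in> T"
      have "- f \<in> T" using mult[OF f one] by simp
      moreover have "\<ominus>\<^bsub>poly_ring n\<^esub> f = - f"
      proof (rule S.minus_equality)
        show "- f \<oplus>\<^bsub>poly_ring n\<^esub> f = \<zero>\<^bsub>poly_ring n\<^esub>" by (simp add: poly_ring_def)
      qed (use f \<open>- f \<in> T\<close> in \<open>auto simp: T_def\<close>)
      ultimately show "\<ominus>\<^bsub>poly_ring n\<^esub> f \<in> T" by simp
    next
      fix f g assume "f \<in> T" "g \<in> T"
      then show "f \<oplus>\<^bsub>poly_ring n\<^esub> g \<in> T" using add by (simp add: poly_ring_def)
    qed
  next
    fix a x :: "'k mpol"
    assume "a \<in> T" "x \<in> carrier (poly_ring n)"
    then show "x \<otimes>\<^bsub>poly_ring n\<^esub> a \<in> T" "a \<otimes>\<^bsub>poly_ring n\<^esub> x \<in> T"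
      using mult[of a x] by (simp_all add: poly_ring_def mult.commute)
  qed
  moreover have "pmonom ` M \<subseteq> T"
    using MS S.genideal_self[OF MS] unfolding T_def I by (auto simp: pmonom_def)
  ultimately have "I \<subseteq> T" unfolding I by (rule S.genideal_minimal)
  then show ?R using id by (auto simp: T_def)
next
  interpret S: cring "poly_ring n :: 'k mpol ring" by (rule cring_poly_ring)
  assume R: ?R
  then interpret I: ideal I "poly_ring n" by simp
  define M where "M = {m. (pmonom m :: 'k mpol) \<in> I}"
  have M: "Poly_Mapping.keys m \<subseteq> {1..n}" if "m \<in> M" for m
    using I.Icarr[of "pmonom m"] that by (auto simp: M_def poly_ring_def pmonom_def)
  have MS: "pmonom ` M \<subseteq> carrier (poly_ring n :: 'k mpol ring)"
    using M by (fastforce simp: poly_ring_def pmonom_def)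
  define G where "G = Idl\<^bsub>poly_ring n\<^esub> (pmonom ` M :: 'k mpol set)"
  interpret G: ideal G "poly_ring n" unfolding G_def by (rule S.genideal_ideal[OF MS])
  have "G \<subseteq> I" unfolding G_def
    by (rule S.genideal_minimal[OF I.ideal_axioms]) (auto simp: M_def)
  moreover have "f \<in> G" if f: "f \<in> I" for f
  proof -
    have zero: "0 \<in> G" using G.zero_closed by (simp add: poly_ring_def)
    have plus: "a + b \<in> G" if "a \<in> G" "b \<in> G" for a b
      using G.a_closed[OF that] by (simp add: poly_ring_def)
    have terms: "Poly_Mapping.single m (Poly_Mapping.lookup f m) \<in> G" if "m \<in> Poly_Mapping.keys f" for m
    proof -
      have "pmonom m \<in> G"
        using R f that S.genideal_self[OF MS] unfolding G_def M_def by auto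
      moreover have "Poly_Mapping.single 0 (Poly_Mapping.lookup f m) \<in> carrier (poly_ring n)"
        by (simp add: poly_ring_def)
      ultimately have "Poly_Mapping.single 0 (Poly_Mapping.lookup f m) \<otimes>\<^bsub>poly_ring n\<^esub> pmonom m \<in> G"
        by (rule G.I_l_closed)
      then show ?thesis by (simp add: poly_ring_def pmonom_def mult_single)
    qed
    have "(\<Sum>m\<in>A. Poly_Mapping.single m (Poly_Mapping.lookup f m)) \<in> G"
      if "finite A" "A \<subseteq> Poly_Mapping.keys f" for A
      using that by (induction A rule: finite_induct) (auto simp: zero plus terms)
    then have "(\<Sum>m\<in>Poly_Mapping.keys f. Poly_Mapping.single m (Poly_Mapping.lookup f m)) \<in> G"
      by simp
    moreover have "(\<Sum>m\<in>Poly_Mapping.keys f. Poly_Mapping.single m (Poly_Mapping.lookup f m)) = f"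
      by (rule poly_mapping_eqI) (simp add: lookup_sum lookup_single when_def in_keys_iff)
    ultimately show ?thesis by simp
  qed
  ultimately show ?L using M unfolding monomial_ideal_def G_def by blast
qed

lemma d_fixed_carrier: "d_fixed n d s (carrier (poly_ring n :: ('k::field) mpol ring))"
proof -
  interpret S: cring "poly_ring n :: 'k mpol ring" by (rule cring_poly_ring)
  have "monomial_ideal n (carrier (poly_ring n :: 'k mpol ring))"
    unfolding monomial_ideal_iff using S.oneideal by (auto simp: poly_ring_def pmonom_def)
  moreover have "Poly_Mapping.keys (v + Poly_Mapping.single j t - Poly_Mapping.single i t) \<subseteq> {1..n}"
    if "Poly_Mapping.keys v \<subseteq> {1..n}" "1 \<le> j" "j \<le> n" for v :: "nat \<Rightarrow>\<^sub>0 nat" and j i t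
  proof
    fix k assume "k \<in> Poly_Mapping.keys (v + Poly_Mapping.single j t - Poly_Mapping.single i t)"
    then have "k \<in> Poly_Mapping.keys v \<or> k = j"
      by (auto simp: in_keys_iff lookup_add lookup_minus lookup_single when_def split: if_splits)
    then show "k \<in> {1..n}" using that by auto
  qed
  ultimately show ?thesis
    unfolding d_fixed_def by (auto simp: poly_ring_def pmonom_def)
qed

lemma d_fixed_hull_least:
  fixes u :: "('k::field) mpol"
  assumes u: "u \<in> carrier (poly_ring n)"
  shows "d_fixed n d s (d_fixed_hull n d s u)" "u \<in> d_fixed_hull n d s u"
    and "\<And>I. d_fixed n d s I \<Longrightarrow> u \<in> I \<Longrightarrow> d_fixed_hull n d s u \<subseteq> I"
proof -
  interpret S: cring "poly_ring n :: 'k mpol ring" by (rule cring_poly_ring)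
  have "ideal (d_fixed_hull n d s u) (poly_ring n)"
    unfolding d_fixed_hull_def
  proof (rule S.i_Intersect)
    show "{I. d_fixed n d s I \<and> u \<in> I} \<noteq> {}" using d_fixed_carrier u by blast
  qed (auto simp: d_fixed_def monomial_ideal_iff)
  moreover have "pmonom m \<in> d_fixed_hull n d s u"
    if f: "f \<in> d_fixed_hull n d s u" and m: "m \<in> Poly_Mapping.keys f" for f m
  proof -
    have "pmonom m \<in> I" if I: "d_fixed n d s I" "u \<in> I" for I
    proof -
      have "f \<in> I" using f I unfolding d_fixed_hull_def by blast
      moreover have "monomial_ideal n I" using I(1) unfolding d_fixed_def by (rule conjunct1)
      ultimately show ?thesis using m unfolding monomial_ideal_iff by blast
    qed
    then show ?thesis unfolding d_fixed_hull_def by blast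
  qed
  ultimately have "monomial_ideal n (d_fixed_hull n d s u)"
    unfolding monomial_ideal_iff by blast
  then show "d_fixed n d s (d_fixed_hull n d s u)"
    unfolding d_fixed_def by (auto simp: d_fixed_hull_def) (simp add: d_fixed_def)
qed (auto simp: d_fixed_hull_def)

section \<open>Socles and the ideals occurring in the description of the socle\<close>

text \<open>
  \<open>socle n I\<close> is the annihilator in the residue class ring modulo \<open>I\<close> of the ideal generated by
  the \<open>n\<close> variables; \<open>quot_image n I L\<close> is the ideal of the residue class ring usually written
  \<open>L / I\<close>, for an ideal \<open>L\<close> containing \<open>I\<close>; \<open>frob_ideal n l e\<close> is generated by the \<open>e\<close>-th powers
  of the first \<open>l\<close> variables.
\<close>

definition socle :: "nat \<Rightarrow> ('k::field) mpol set \<Rightarrow> 'k mpol set set" where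
  "socle n I = {z \<in> carrier (poly_ring n Quot I).
     \<forall>f \<in> Idl\<^bsub>poly_ring n\<^esub> (X ` {1..n}).
       (I +>\<^bsub>poly_ring n\<^esub> f) \<otimes>\<^bsub>poly_ring n Quot I\<^esub> z = \<zero>\<^bsub>poly_ring n Quot I\<^esub>}"

definition quot_image :: "nat \<Rightarrow> ('k::field) mpol set \<Rightarrow> 'k mpol set \<Rightarrow> 'k mpol set set" where
  "quot_image n I L = (\<lambda>f. I +>\<^bsub>poly_ring n\<^esub> f) ` L"

definition frob_ideal :: "nat \<Rightarrow> nat \<Rightarrow> nat \<Rightarrow> ('k::field) mpol set" where
  "frob_ideal n l e = Idl\<^bsub>poly_ring n\<^esub> ((\<lambda>k. X k ^ e) ` {1..l})"

text \<open>
  Products, powers and sums of ideals are taken in the semiring \<^const>\<open>ideals_set\<close> of ideals of the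
  polynomial ring. An \<open>a\<close>-tuple of natural numbers is an extensional function on \<open>{1..a}\<close>.
\<close>

abbreviation ideals :: "nat \<Rightarrow> ('k::field) mpol set ring" where
  "ideals n \<equiv> ideals_set (poly_ring n)"

definition prod_ideal ::
    "nat \<Rightarrow> (nat \<Rightarrow> nat) \<Rightarrow> nat \<Rightarrow> nat \<Rightarrow> (nat \<Rightarrow> nat) \<Rightarrow> (nat \<Rightarrow> nat) \<Rightarrow> ('k::field) mpol set" where
  "prod_ideal n d s r i \<alpha> =
     (\<Otimes>\<^bsub>ideals n\<^esub>q\<in>{1..r}. \<Otimes>\<^bsub>ideals n\<^esub>j\<in>{0..s}.
        frob_ideal n (i q) (d j) [^]\<^bsub>ideals n\<^esub> decomp d s (\<alpha> q) j)"

definition P_set ::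
    "(nat \<Rightarrow> nat) \<Rightarrow> nat \<Rightarrow> nat \<Rightarrow> (nat \<Rightarrow> nat) \<Rightarrow> nat \<Rightarrow> ((nat \<Rightarrow> nat) \<times> (nat \<Rightarrow> nat)) set" where
  "P_set d s r \<alpha> a = {(lam, t). lam \<in> extensional {1..a} \<and> t \<in> extensional {1..a} \<and>
     1 \<le> lam 1 \<and> strict_mono_on {1..a} lam \<and> lam a = r \<and>
     strict_mono_on {1..a} t \<and> t a \<le> s \<and>
     (\<forall>\<nu>\<in>{1..a}. decomp d s (\<alpha> (lam \<nu>)) (t \<nu>) \<noteq> 0)}"

lemma finite_P_set: "finite (P_set d s r \<alpha> a)"
proof (cases "a = 0")
  case True
  then have "P_set d s r \<alpha> a \<subseteq> {\<lambda>_. undefined} \<times> {\<lambda>_. undefined}"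
    by (auto simp: P_set_def)
  then show ?thesis by (rule finite_subset) simp
next
  case False
  have "P_set d s r \<alpha> a \<subseteq> ({1..a} \<rightarrow>\<^sub>E {..r}) \<times> ({1..a} \<rightarrow>\<^sub>E {..s})"
  proof
    fix p assume p: "p \<in> P_set d s r \<alpha> a"
    obtain l t where lt: "p = (l, t)" by (cases p)
    have ext: "l \<in> extensional {1..a}" "t \<in> extensional {1..a}"
      and mono: "strict_mono_on {1..a} l" "strict_mono_on {1..a} t"
      and last: "l a = r" "t a \<le> s"
      using p unfolding lt P_set_def by auto
    have "l \<nu> \<le> l a" "t \<nu> \<le> t a" if "\<nu> \<in> {1..a}" for \<nu>
      using strict_mono_on_leD[OF mono(1), of \<nu> a] strict_mono_on_leD[OF mono(2), of \<nu> a] that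
      by auto
    then have "l \<in> {1..a} \<rightarrow> {..r}" "t \<in> {1..a} \<rightarrow> {..s}"
      using last by fastforce+
    then show "p \<in> ({1..a} \<rightarrow>\<^sub>E {..r}) \<times> ({1..a} \<rightarrow>\<^sub>E {..s})"
      using ext by (simp add: lt PiE_def)
  qed
  then show ?thesis by (rule finite_subset) (intro finite_cartesian_product finite_PiE; simp)
qed

text \<open>
  The updates at \<open>0\<close> implement the conventions that the zeroth entry of the tuple \<open>lam\<close> and of the
  index sequence \<open>i\<close> is \<open>0\<close>.
\<close>

definition J_ideal ::
    "nat \<Rightarrow> (nat \<Rightarrow> nat) \<Rightarrow> nat \<Rightarrow> (nat \<Rightarrow> nat) \<Rightarrow> (nat \<Rightarrow> nat) \<Rightarrow> nat \<Rightarrow>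
     (nat \<Rightarrow> nat) \<Rightarrow> (nat \<Rightarrow> nat) \<Rightarrow> ('k::field) mpol set" where
  "J_ideal n d s i \<alpha> a lam t =
    (let l = lam(0 := 0); i0 = i(0 := 0);
         A = (\<lambda>q j. decomp d s (\<alpha> q) j);
         m = (\<lambda>q e. frob_ideal n (i q) e)
     in Idl\<^bsub>poly_ring n\<^esub> {\<Prod>e=1..a. (\<Prod>k\<in>{i0 (l (e - 1)) + 1..i0 (l e)}. X k) ^ (d (t e) - 1)}
        \<otimes>\<^bsub>ideals n\<^esub>
        (\<Otimes>\<^bsub>ideals n\<^esub>\<nu>\<in>{1..a}.
           (if \<nu> = a then carrier (poly_ring n) else m (l \<nu>) (d (t (\<nu> + 1))))
           \<otimes>\<^bsub>ideals n\<^esub>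
           (\<Otimes>\<^bsub>ideals n\<^esub>j\<in>{t \<nu><..s}. m (l \<nu>) (d j) [^]\<^bsub>ideals n\<^esub> A (l \<nu>) j)
           \<otimes>\<^bsub>ideals n\<^esub>
           (m (l \<nu>) (d (t \<nu>)) [^]\<^bsub>ideals n\<^esub> (A (l \<nu>) (t \<nu>) - 1))
           \<otimes>\<^bsub>ideals n\<^esub>
           (\<Otimes>\<^bsub>ideals n\<^esub>q\<in>{l (\<nu> - 1) + 1..l \<nu> - 1}. \<Otimes>\<^bsub>ideals n\<^esub>j\<in>{t \<nu>..s}.
              m q (d j) [^]\<^bsub>ideals n\<^esub> A q j)))"

definition J_sum ::
    "nat \<Rightarrow> (nat \<Rightarrow> nat) \<Rightarrow> nat \<Rightarrow> nat \<Rightarrow> (nat \<Rightarrow> nat) \<Rightarrow> (nat \<Rightarrow> nat) \<Rightarrow> ('k::field) mpol set" where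
  "J_sum n d s r i \<alpha> =
     (\<Oplus>\<^bsub>ideals n\<^esub>a\<in>{1..r}. \<Oplus>\<^bsub>ideals n\<^esub>p\<in>P_set d s r \<alpha> a. J_ideal n d s i \<alpha> a (fst p) (snd p))"

end

theory Submission
  imports Defs "HOL-Library.Multiset" "HOL-Library.Infinite_Set"
begin

text \<open>
  All ideals in question are monomial, so everything reduces to exponent vectors. A monomial lies in a
  product of ideals \<open>frob_ideal n p (d j)\<close> if and only if pieces of sizes \<open>d j\<close>, one for each factor, can be
  packed into bins whose capacities are the exponents, where the piece of the factor with index \<open>p\<close> is
  confined to the bins \<open>1, \<dots>, p\<close>. The sizes form a divisor chain and the sets of admissible bins are
  nested. Under these two conditions filling bins greedily is optimal, and this yields a min-max criterion
  (\<open>packs_iff\<close>): a packing exists if and only if for every nondecreasing function \<open>\<tau>\<close> from the bins to the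
  levels \<open>0, \<dots>, s + 1\<close>, the pieces \<open>(p, j)\<close> with \<open>\<tau> p \<le> j\<close> have total size at most the sum of the capacities, each
  rounded down to a multiple of \<open>d (\<tau> k)\<close>.

  The product is the principal d-fixed ideal (\<open>d_fixed_hull_eq\<close>): it is d-fixed because a number
  whose digits are bounded by those of an exponent is the size of a subfamily of any family of pieces
  filling that exponent (\<open>subsum_of_digits\<close>), and its generators arise from \<open>u\<close> by moving single pieces
  downwards, blocks with smaller index first.

  For the socle, the pairs of tuples in \<^const>\<open>P_set\<close> are a way to write threshold functions \<open>\<tau>\<close>: the
  second tuple lists the values, the first one the places where the value jumps. A monomial outside \<open>I\<close>
  violates the criterion for some \<open>\<tau>\<close>; among these, one with maximal sum of values is chosen. If all
  variables multiply the monomial into \<open>I\<close>, then its exponents are congruent to \<open>-1\<close> modulo \<open>d (\<tau> k)\<close>, the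
  criterion fails by exactly \<open>d (\<tau> 1)\<close>, and maximality shows both that \<open>\<tau>\<close> comes from an element of
  \<^const>\<open>P_set\<close> (\<open>max_deficient_jump\<close>) and, by an exchange argument, that the quotient by the monomial with
  exponents \<open>d (\<tau> k) - 1\<close> satisfies the criterion for the remaining product in \<^const>\<open>J_ideal\<close>
  (\<open>packs_socle_quotient\<close>). Conversely, multiplying an element of \<^const>\<open>J_ideal\<close> by a variable turns the
  criterion into a telescoping inequality (\<open>packs_socle_mult\<close>).
\<close>

section \<open>Packing pieces of divisible sizes\<close>

text \<open>
  A piece is a pair \<open>(p, j)\<close> with \<open>1 \<le> p \<le> n\<close> and \<open>j \<le> s\<close>. It stands for the factor
  \<^term>\<open>frob_ideal n p (d j)\<close>: choosing a generator of the factor means placing the piece, which has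
  size \<open>d j\<close>, into one of the bins \<open>1, \<dots>, p\<close>. The capacity of bin \<open>k\<close> is the exponent of the
  \<open>k\<close>-th variable.
\<close>

locale packing =
  fixes n :: nat and d :: "nat \<Rightarrow> nat" and s :: nat
  assumes d_seq: "d_sequence d s" and n_pos: "1 \<le> n"
begin

text \<open>
  The largest multiple of \<open>d t\<close> below \<open>x\<close>. The level \<open>t = Suc s\<close> plays the role of an infinite
  \<open>d t\<close>, so that only \<open>0\<close> is a multiple.
\<close>

definition rdown :: "nat \<Rightarrow> nat \<Rightarrow> nat" where
  "rdown x t = (if t \<le> s then x div d t * d t else 0)"

text \<open>
  Threshold functions assign to the bins nondecreasing levels from \<open>0\<close> to \<open>Suc s\<close>.
\<close>

definition threshold :: "(nat \<Rightarrow> nat) \<Rightarrow> bool" where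
  "threshold \<tau> \<longleftrightarrow> mono_on {1..n} \<tau> \<and> (\<forall>k\<in>{1..n}. \<tau> k \<le> Suc s)"

text \<open>
  The total size of the pieces \<open>(k, j)\<close> of \<open>M\<close> that reach the threshold at their position, that is,
  with \<open>\<tau> k \<le> j\<close>.
\<close>

definition weight :: "(nat \<Rightarrow> nat) \<Rightarrow> (nat \<times> nat) multiset \<Rightarrow> nat" where
  "weight \<tau> M = (\<Sum>k=1..n. \<Sum>j=\<tau> k..s. count M (k, j) * d j)"

text \<open>
  \<open>packs M w\<close> says that the pieces of \<open>M\<close> can be placed into bins of capacities \<open>w\<close>. Only the number
  \<open>y k j\<close> of pieces of size \<open>d j\<close> in bin \<open>k\<close> is recorded: pieces of equal size are interchangeable and the
  admissible sets of bins \<open>{1..p}\<close> are nested, so by the marriage theorem a placement with at most these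
  numbers exists as soon as, for each size and each \<open>m\<close>, the first \<open>m\<close> bins offer at least as many
  places as there are pieces with position at most \<open>m\<close>. Elements of \<open>M\<close> that are not pieces in the above
  range are ignored.
\<close>

definition packs :: "(nat \<times> nat) multiset \<Rightarrow> (nat \<Rightarrow> nat) \<Rightarrow> bool" where
  "packs M w \<longleftrightarrow> (\<exists>y. (\<forall>k\<in>{1..n}. (\<Sum>j\<le>s. y k j * d j) \<le> w k) \<and>
     (\<forall>m\<in>{1..n}. \<forall>j\<le>s. (\<Sum>k=1..m. count M (k, j)) \<le> (\<Sum>k=1..m. y k j)))"

lemma d_pos: "t \<le> s \<Longrightarrow> 0 < d t"
  using d_sequence_pos[OF d_seq] .

lemma d_dvd: "k \<le> t \<Longrightarrow> t \<le> s \<Longrightarrow> d k dvd d t"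
  using d_sequence_dvd[OF d_seq] .

lemma d_mono: "k \<le> t \<Longrightarrow> t \<le> s \<Longrightarrow> d k \<le> d t"
  using d_dvd d_pos by (simp add: dvd_imp_le)

lemma rdown_le: "rdown x t \<le> x"
  by (simp add: rdown_def)

lemma rdown_dvd: "t \<le> s \<Longrightarrow> d t dvd rdown x t"
  by (simp add: rdown_def)

lemma rdown_greatest:
  assumes "t \<le> s" "d t dvd z" "z \<le> x" shows "z \<le> rdown x t"
proof -
  obtain c where c: "z = c * d t" using assms(2) by (metis dvd_def mult.commute)
  then have "c \<le> x div d t" using assms d_pos[OF assms(1)] by (simp add: less_eq_div_iff_mult_less_eq)
  then show ?thesis using c assms(1) by (simp add: rdown_def)
qed

lemma rdown_antimono: "t \<le> t' \<Longrightarrow> rdown x t' \<le> rdown x t"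
proof (cases "t' \<le> s")
  case True
  assume "t \<le> t'"
  then show ?thesis
    using True rdown_dvd[OF True, of x] d_dvd[OF \<open>t \<le> t'\<close> True]
    by (intro rdown_greatest rdown_le) (auto intro: dvd_trans)
qed (simp add: rdown_def)

lemma rdown_id: "t \<le> s \<Longrightarrow> d t dvd x \<Longrightarrow> rdown x t = x"
  by (simp add: rdown_def)

lemma rdown_add: "rdown x t + rdown y t \<le> rdown (x + y) t"
proof (cases "t \<le> s")
  case True
  then show ?thesis by (intro rdown_greatest dvd_add rdown_dvd add_mono rdown_le)
qed (simp add: rdown_def)

lemma dvd_tail_sum:
  assumes "t \<le> s"
  shows "d t dvd (\<Sum>j=t..s. c j * d j)"
  using assms by (auto intro!: dvd_sum dvd_mult d_dvd)

section \<open>A min-max criterion for packing\<close>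

lemma sum_le_of_prefix_sum_le:
  fixes b y :: "nat \<Rightarrow> nat"
  assumes mono: "mono_on {1..n} \<tau>"
    and pre: "\<And>m. m \<in> {1..n} \<Longrightarrow> (\<Sum>k=1..m. b k) \<le> (\<Sum>k=1..m. y k)"
  shows "(\<Sum>k | k \<in> {1..n} \<and> \<tau> k \<le> j. b k) \<le> (\<Sum>k | k \<in> {1..n} \<and> \<tau> k \<le> (j::nat). y k)"
proof (cases "{k. k \<in> {1..n} \<and> \<tau> k \<le> j} = {}")
  case False
  define m where "m = Max {k. k \<in> {1..n} \<and> \<tau> k \<le> j}"
  have m: "m \<in> {k. k \<in> {1..n} \<and> \<tau> k \<le> j}" unfolding m_def using False by (intro Max_in) auto
  have m1: "m \<in> {1..n}" using m by blast
  have eq: "{k. k \<in> {1..n} \<and> \<tau> k \<le> j} = {1..m}"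
  proof
    show "{k. k \<in> {1..n} \<and> \<tau> k \<le> j} \<subseteq> {1..m}" unfolding m_def by auto
    show "{1..m} \<subseteq> {k. k \<in> {1..n} \<and> \<tau> k \<le> j}"
    proof
      fix k assume "k \<in> {1..m}"
      then have "\<tau> k \<le> \<tau> m" using m mono by (intro mono_onD[OF mono]) auto
      then show "k \<in> {k. k \<in> {1..n} \<and> \<tau> k \<le> j}" using m \<open>k \<in> {1..m}\<close> by auto
    qed
  qed
  show ?thesis unfolding eq by (rule pre[OF m1])
next
  case True
  show ?thesis unfolding True by simp
qed

lemma swap_tail_sum:
  "(\<Sum>k=1..n. \<Sum>j=\<tau> k..s. c k j * d j) = (\<Sum>j\<le>s. (\<Sum>k | k \<in> {1..n} \<and> \<tau> k \<le> j. c k j) * d j)"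
proof -
  have "(\<Sum>k=1..n. \<Sum>j=\<tau> k..s. c k j * d j) = (\<Sum>k=1..n. \<Sum>j\<le>s. if \<tau> k \<le> j then c k j * d j else 0)"
    by (intro sum.cong refl sum.mono_neutral_cong_left) auto
  also have "\<dots> = (\<Sum>j\<le>s. \<Sum>k=1..n. if \<tau> k \<le> j then c k j * d j else 0)"
    by (rule sum.swap)
  also have "\<dots> = (\<Sum>j\<le>s. (\<Sum>k | k \<in> {1..n} \<and> \<tau> k \<le> j. c k j) * d j)"
    unfolding sum_distrib_right by (intro sum.cong refl sum.mono_neutral_cong_right) auto
  finally show ?thesis .
qed

text \<open>
  A piece reaching the threshold at its position \<open>p\<close> lies in some bin \<open>k \<le> p\<close>, where the threshold is not
  larger; its size is therefore a multiple of \<open>d (\<tau> k)\<close> and it occupies the rounded capacity.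
\<close>

lemma weight_le_of_packs:
  assumes "packs M w" "threshold \<tau>"
  shows "weight \<tau> M \<le> (\<Sum>k=1..n. rdown (w k) (\<tau> k))"
proof -
  obtain y where y: "\<And>k. k\<in>{1..n} \<Longrightarrow> (\<Sum>j\<le>s. y k j * d j) \<le> w k"
     "\<And>m j. m\<in>{1..n} \<Longrightarrow> j\<le>s \<Longrightarrow> (\<Sum>k=1..m. count M (k, j)) \<le> (\<Sum>k=1..m. y k j)"
    using assms(1) unfolding packs_def by blast
  have "weight \<tau> M \<le> (\<Sum>k=1..n. \<Sum>j=\<tau> k..s. y k j * d j)"
    unfolding weight_def swap_tail_sum using assms(2) y(2)
    by (intro sum_mono[where K = "{..s}"] mult_right_mono sum_le_of_prefix_sum_le)
      (auto simp: threshold_def)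
  also have "\<dots> \<le> (\<Sum>k=1..n. rdown (w k) (\<tau> k))"
  proof (rule sum_mono)
    fix k assume k: "k \<in> {1..n}"
    show "(\<Sum>j=\<tau> k..s. y k j * d j) \<le> rdown (w k) (\<tau> k)"
    proof (cases "\<tau> k \<le> s")
      case True
      have "(\<Sum>j=\<tau> k..s. y k j * d j) \<le> (\<Sum>j\<le>s. y k j * d j)"
        by (intro sum_mono2) auto
      then show ?thesis using True y(1)[OF k] dvd_tail_sum[OF True]
        by (intro rdown_greatest) auto
    qed simp
  qed
  finally show ?thesis .
qed

text \<open>
  One bin of capacity \<open>x\<close>, filled with the largest pieces first. Since each size divides the next, this
  minimises the total size of the pieces of level at least \<open>t\<close> left over, for all \<open>t\<close> at once. The minimum
  is the maximum over \<open>t' \<ge> t\<close> of the difference appearing in the conclusion.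
\<close>

lemma greedy:
  "\<exists>y. (\<forall>j\<le>s. y j \<le> b j) \<and> (\<Sum>j\<le>s. y j * d j) \<le> x \<and>
     (\<forall>t\<le>Suc s. \<exists>t'\<in>{t..Suc s}.
        (\<Sum>j=t..s. (b j - y j) * d j) + rdown x t' \<le> (\<Sum>j=t'..s. b j * d j))"
proof -
  have "\<exists>y. (\<forall>j\<le>s. y j \<le> b j) \<and> (\<Sum>j=m..s. y j * d j) \<le> x \<and>
     (\<forall>t\<in>{m..Suc s}. \<exists>t'\<in>{t..Suc s}.
        (\<Sum>j=t..s. (b j - y j) * d j) + rdown x t' \<le> (\<Sum>j=t'..s. b j * d j))"
    if "m \<le> Suc s" for m using that
  proof (induction m rule: inc_induct)
    case base
    show ?case by (intro exI[of _ "\<lambda>_. 0"]) (auto simp: rdown_def)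
  next
    case (step m)
    then have ms: "m \<le> s" by simp
    from step obtain y where y: "\<forall>j\<le>s. y j \<le> b j" "(\<Sum>j=Suc m..s. y j * d j) \<le> x"
      and t': "\<And>t. t\<in>{Suc m..Suc s} \<Longrightarrow> \<exists>t'\<in>{t..Suc s}.
        (\<Sum>j=t..s. (b j - y j) * d j) + rdown x t' \<le> (\<Sum>j=t'..s. b j * d j)" by blast
    \<comment> \<open>The volume used by pieces of level above \<open>m\<close>; the bin then takes as many pieces of level \<open>m\<close> as fit.\<close>
    define P where "P = (\<Sum>j=Suc m..s. y j * d j)"
    have Pdvd: "d m dvd P" unfolding P_def using ms by (auto intro!: dvd_sum dvd_mult d_dvd)
    have Ple: "P \<le> rdown x m" using rdown_greatest[OF ms Pdvd] y(2) P_def by simp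
    define c where "c = (rdown x m - P) div d m"
    have c: "P + c * d m = rdown x m"
      using Ple Pdvd rdown_dvd[OF ms] by (simp add: c_def)
    define y' where "y' = y(m := min (b m) c)"
    have eq: "(\<Sum>j=t..s. (b j - y' j) * d j) = (\<Sum>j=t..s. (b j - y j) * d j)" if "t \<ge> Suc m" for t
      using that by (intro sum.cong) (auto simp: y'_def)
    have P': "(\<Sum>j=m..s. y' j * d j) = min (b m) c * d m + P"
      using ms unfolding sum.atLeast_Suc_atMost[OF ms] P_def
      by (auto simp: y'_def intro!: sum.cong)
    show ?case
    proof (intro exI[of _ y'] conjI ballI)
      show "\<forall>j\<le>s. y' j \<le> b j" using y(1) by (auto simp: y'_def)
      have "min (b m) c * d m \<le> c * d m" by simp
      then show "(\<Sum>j=m..s. y' j * d j) \<le> x" unfolding P' using c rdown_le[of x m] by linarith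
    next
      fix t assume t: "t \<in> {m..Suc s}"
      show "\<exists>t'\<in>{t..Suc s}. (\<Sum>j=t..s. (b j - y' j) * d j) + rdown x t' \<le> (\<Sum>j=t'..s. b j * d j)"
      proof (cases "t = m")
        case False
        then show ?thesis using t t'[of t] eq[of t] by auto
      next
        case tm: True
        show ?thesis
        proof (cases "b m \<le> c")
          case True
          have "(\<Sum>j=m..s. (b j - y' j) * d j) = (\<Sum>j=Suc m..s. (b j - y j) * d j)"
            unfolding sum.atLeast_Suc_atMost[OF ms] eq[OF order_refl] using True by (simp add: y'_def)
          then show ?thesis using t'[of "Suc m"] ms tm by auto
        next
          case False
          have y'b: "y' j \<le> b j" if "j \<in> {m..s}" for j using y(1) that by (auto simp: y'_def)
          have "(\<Sum>j=m..s. (b j - y' j) * d j) + (\<Sum>j=m..s. y' j * d j) = (\<Sum>j=m..s. b j * d j)"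
            unfolding sum.distrib[symmetric] using y'b
            by (intro sum.cong) (auto simp: add_mult_distrib[symmetric])
          moreover have "(\<Sum>j=m..s. y' j * d j) = rdown x m" unfolding P' using False c by simp
          ultimately show ?thesis using tm t by (intro bexI[of _ m]) auto
        qed
      qed
    qed
  qed
  from this[of 0] show ?thesis by (simp add: atMost_atLeast0 Ball_def)
qed

text \<open>
  The last bin accepts only pieces positioned there. It is filled greedily, and the pieces left over are
  handed down to the previous position. The bound on the leftover turns a threshold function on the first
  \<open>m\<close> bins into one on \<open>Suc m\<close> bins, so the hypothesis passes to the smaller problem.
\<close>

lemma packing_exists:
  fixes m :: nat and b :: "nat \<Rightarrow> nat \<Rightarrow> nat"
  assumes "1 \<le> m"
    and "\<And>\<tau>. mono_on {1..m} \<tau> \<Longrightarrow> (\<And>k. k \<in> {1..m} \<Longrightarrow> \<tau> k \<le> Suc s) \<Longrightarrow>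
      (\<Sum>k=1..m. \<Sum>j=\<tau> k..s. b k j * d j) \<le> (\<Sum>k=1..m. rdown (w k) (\<tau> k))"
  shows "\<exists>y. (\<forall>k\<in>{1..m}. (\<Sum>j\<le>s. y k j * d j) \<le> w k) \<and>
     (\<forall>l\<in>{1..m}. \<forall>j\<le>s. (\<Sum>k=1..l. b k j) \<le> (\<Sum>k=1..l. y k j))"
  using assms
proof (induction m arbitrary: b rule: nat_induct_at_least)
  case base
  obtain y where y: "\<forall>j\<le>s. y j \<le> b 1 j" "(\<Sum>j\<le>s. y j * d j) \<le> w 1"
    and t: "\<forall>t\<le>Suc s. \<exists>t'\<in>{t..Suc s}.
        (\<Sum>j=t..s. (b 1 j - y j) * d j) + rdown (w 1) t' \<le> (\<Sum>j=t'..s. b 1 j * d j)"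
    using greedy by blast
  obtain t' where t': "t' \<le> Suc s"
    "(\<Sum>j=0..s. (b 1 j - y j) * d j) + rdown (w 1) t' \<le> (\<Sum>j=t'..s. b 1 j * d j)"
    using t by auto
  have "(\<Sum>j=t'..s. b 1 j * d j) \<le> rdown (w 1) t'"
    using base[of "\<lambda>_. t'"] t'(1) by (simp add: mono_on_def)
  then have "(\<Sum>j=0..s. (b 1 j - y j) * d j) = 0" using t'(2) by linarith
  then have ble: "b 1 j \<le> y j" if "j \<le> s" for j
    using that d_pos[OF that] by fastforce
  show ?case
  proof (intro exI[of _ "\<lambda>_. y"] conjI ballI allI impI)
    fix k :: nat assume "k \<in> {1..1}"
    then have "k = 1" by simp
    then show "(\<Sum>j\<le>s. y j * d j) \<le> w k" using y(2) by simp
  next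
    fix l j :: nat assume "l \<in> {1..1}" "j \<le> s"
    then have "l = 1" "b 1 j \<le> y j" using ble by auto
    then show "(\<Sum>k=1..l. b k j) \<le> (\<Sum>k=1..l. y j)" by simp
  qed
next
  case (Suc m)
  obtain y where y: "\<And>j. j\<le>s \<Longrightarrow> y j \<le> b (Suc m) j" "(\<Sum>j\<le>s. y j * d j) \<le> w (Suc m)"
    and t: "\<And>t. t\<le>Suc s \<Longrightarrow> \<exists>t'\<in>{t..Suc s}.
        (\<Sum>j=t..s. (b (Suc m) j - y j) * d j) + rdown (w (Suc m)) t' \<le> (\<Sum>j=t'..s. b (Suc m) j * d j)"
    using greedy[of "b (Suc m)" "w (Suc m)"] by blast
  define b' where "b' = b(m := \<lambda>j. b m j + (b (Suc m) j - y j))"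
  have split: "(\<Sum>k=1..m. g k) = (\<Sum>k\<in>{1..<m}. g k) + g m" for g :: "nat \<Rightarrow> nat"
    using Suc.hyps by (metis One_nat_def Suc_leD add.commute atLeastLessThanSuc_atLeastAtMost sum.atLeastLessThan_Suc)
  have "\<exists>y. (\<forall>k\<in>{1..m}. (\<Sum>j\<le>s. y k j * d j) \<le> w k) \<and>
     (\<forall>l\<in>{1..m}. \<forall>j\<le>s. (\<Sum>k=1..l. b' k j) \<le> (\<Sum>k=1..l. y k j))"
  proof (rule Suc.IH)
    fix \<tau> :: "nat \<Rightarrow> nat" assume \<tau>: "mono_on {1..m} \<tau>" "\<And>k. k \<in> {1..m} \<Longrightarrow> \<tau> k \<le> Suc s"
    obtain t' where t': "\<tau> m \<le> t'" "t' \<le> Suc s"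
      "(\<Sum>j=\<tau> m..s. (b (Suc m) j - y j) * d j) + rdown (w (Suc m)) t' \<le> (\<Sum>j=t'..s. b (Suc m) j * d j)"
      using t[OF \<tau>(2)[of m]] Suc.hyps by auto
    define \<tau>' where "\<tau>' = \<tau>(Suc m := t')"
    have top: "\<tau> k \<le> t'" if "k \<in> {1..m}" for k
      using \<tau>(1) that t'(1) Suc.hyps by (auto simp: mono_on_def intro: order_trans)
    have m': "mono_on {1..Suc m} \<tau>'"
      unfolding mono_on_def
    proof (intro allI impI; elim conjE)
      fix x z assume xz: "x \<in> {1..Suc m}" "z \<in> {1..Suc m}" "x \<le> z"
      show "\<tau>' x \<le> \<tau>' z"
        using xz top[of x] \<tau>(1) unfolding \<tau>'_def mono_on_def by auto
    qed
    have less: "(\<Sum>k\<in>{1..m}. \<Sum>j=\<tau>' k..s. b k j * d j) = (\<Sum>k\<in>{1..m}. \<Sum>j=\<tau> k..s. b k j * d j)"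
      "(\<Sum>k\<in>{1..m}. rdown (w k) (\<tau>' k)) = (\<Sum>k\<in>{1..m}. rdown (w k) (\<tau> k))"
      by (intro sum.cong refl; simp add: \<tau>'_def)+
    have "(\<Sum>k=1..Suc m. \<Sum>j=\<tau>' k..s. b k j * d j) \<le> (\<Sum>k=1..Suc m. rdown (w k) (\<tau>' k))"
    proof (rule Suc.prems[OF m'])
      fix k assume "k \<in> {1..Suc m}"
      then show "\<tau>' k \<le> Suc s" using \<tau>(2)[of k] t'(2) by (cases "k = Suc m") (auto simp: \<tau>'_def)
    qed
    then have le: "(\<Sum>k=1..m. \<Sum>j=\<tau> k..s. b k j * d j) + (\<Sum>j=t'..s. b (Suc m) j * d j)
        \<le> (\<Sum>k=1..m. rdown (w k) (\<tau> k)) + rdown (w (Suc m)) t'"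
      using less by (simp add: \<tau>'_def)
    have "(\<Sum>k=1..m. \<Sum>j=\<tau> k..s. b' k j * d j) =
      (\<Sum>k=1..m. \<Sum>j=\<tau> k..s. b k j * d j) + (\<Sum>j=\<tau> m..s. (b (Suc m) j - y j) * d j)"
      unfolding split by (simp add: b'_def add_mult_distrib sum.distrib)
    then show "(\<Sum>k=1..m. \<Sum>j=\<tau> k..s. b' k j * d j) \<le> (\<Sum>k=1..m. rdown (w k) (\<tau> k))"
      using le t'(3) by linarith
  qed
  then obtain z where z: "\<And>k. k\<in>{1..m} \<Longrightarrow> (\<Sum>j\<le>s. z k j * d j) \<le> w k"
     "\<And>l j. l\<in>{1..m} \<Longrightarrow> j\<le>s \<Longrightarrow> (\<Sum>k=1..l. b' k j) \<le> (\<Sum>k=1..l. z k j)" by blast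
  define z' where "z' = z(Suc m := y)"
  have pre: "(\<Sum>k=1..l. z' k j) = (\<Sum>k=1..l. z k j)" if "l \<le> m" for l j
    using that by (intro sum.cong refl) (auto simp: z'_def)
  have bb: "(\<Sum>k=1..l. b k j) \<le> (\<Sum>k=1..l. b' k j)" for l j
    by (intro sum_mono) (auto simp: b'_def)
  show ?case
  proof (intro exI[of _ z'] conjI ballI allI impI)
    fix k assume "k \<in> {1..Suc m}"
    then show "(\<Sum>j\<le>s. z' k j * d j) \<le> w k"
      using z(1)[of k] y(2) by (auto simp: z'_def le_Suc_eq)
  next
    fix l j assume l: "l \<in> {1..Suc m}" and j: "j \<le> s"
    show "(\<Sum>k=1..l. b k j) \<le> (\<Sum>k=1..l. z' k j)"
    proof (cases "l \<le> m")
      case True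
      then show ?thesis using l z(2)[of l j] bb[of j l] pre[OF True] j by simp
    next
      case False
      then have lm: "l = Suc m" using l by simp
      have "(\<Sum>k=1..m. b k j) + (b (Suc m) j - y j) = (\<Sum>k=1..m. b' k j)"
        unfolding split by (simp add: b'_def)
      also have "\<dots> \<le> (\<Sum>k=1..m. z k j)" using z(2)[of m j] Suc.hyps j by simp
      finally show ?thesis using pre[of m] lm y(1)[OF j] by (simp add: z'_def)
    qed
  qed
qed

theorem packs_iff:
  "packs M w \<longleftrightarrow> (\<forall>\<tau>. threshold \<tau> \<longrightarrow> weight \<tau> M \<le> (\<Sum>k=1..n. rdown (w k) (\<tau> k)))"
proof
  assume "\<forall>\<tau>. threshold \<tau> \<longrightarrow> weight \<tau> M \<le> (\<Sum>k=1..n. rdown (w k) (\<tau> k))"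
  then show "packs M w"
    unfolding packs_def using n_pos
    by (intro packing_exists) (auto simp: threshold_def weight_def)
qed (blast intro: weight_le_of_packs)


section \<open>Unions of families of pieces\<close>

lemma packs_mono:
  assumes "packs M v" "\<And>k. k \<in> {1..n} \<Longrightarrow> v k \<le> w k"
  shows "packs M w"
  using assms unfolding packs_def by (meson order_trans)

lemma packs_empty [simp]: "packs {#} w"
  unfolding packs_def by (auto intro!: exI[of _ "\<lambda>_ _. 0"])

lemma packs_union:
  assumes "packs M v" "packs N w"
  shows "packs (M + N) (\<lambda>k. v k + w k)"
proof -
  obtain y where y: "\<And>k. k\<in>{1..n} \<Longrightarrow> (\<Sum>j\<le>s. y k j * d j) \<le> v k"
     "\<And>m j. m\<in>{1..n} \<Longrightarrow> j\<le>s \<Longrightarrow> (\<Sum>k=1..m. count M (k, j)) \<le> (\<Sum>k=1..m. y k j)"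
    using assms(1) unfolding packs_def by blast
  obtain z where z: "\<And>k. k\<in>{1..n} \<Longrightarrow> (\<Sum>j\<le>s. z k j * d j) \<le> w k"
     "\<And>m j. m\<in>{1..n} \<Longrightarrow> j\<le>s \<Longrightarrow> (\<Sum>k=1..m. count N (k, j)) \<le> (\<Sum>k=1..m. z k j)"
    using assms(2) unfolding packs_def by blast
  show ?thesis unfolding packs_def
    using add_mono[OF y(1) z(1)] add_mono[OF y(2) z(2)]
    by (intro exI[of _ "\<lambda>k j. y k j + z k j"]) (auto simp: sum.distrib add_mult_distrib)
qed

lemma packs_add_mset:
  assumes "packs M (w(k := w k - d j))" "k \<in> {1..p}" "p \<le> n" "d j \<le> w k" "j \<le> s"
  shows "packs (add_mset (p, j) M) w"
proof -
  have "packs {#(p, j)#} (\<lambda>l. if l = k then d j else 0)"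
    unfolding packs_def
  proof (intro exI[of _ "\<lambda>l j'. if l = k \<and> j' = j then 1 else 0"] conjI ballI allI impI)
    fix l assume "l \<in> {1..n}"
    have "(\<Sum>j'\<le>s. (if l = k \<and> j' = j then 1 else 0) * d j') = (\<Sum>j'\<le>s. if j' = j then (if l = k then d j else 0) else 0)"
      by (intro sum.cong) auto
    also have "\<dots> \<le> (if l = k then d j else 0)" using assms(5) by (subst sum.delta) auto
    finally show "(\<Sum>j'\<le>s. (if l = k \<and> j' = j then 1 else 0) * d j') \<le> (if l = k then d j else 0)" .
  next
    fix m j' assume m: "m \<in> {1..n}" and "j' \<le> s"
    have "(\<Sum>l=1..m. count {#(p, j)#} (l, j')) = (\<Sum>l=1..m. if l = p then (if j' = j then 1 else 0) else 0)"
      by (intro sum.cong) auto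
    also have "\<dots> \<le> (\<Sum>l=1..m. if l = k then (if j' = j then 1 else 0) else 0)"
      using assms(2,3) m by (subst (1 2) sum.delta) auto
    also have "\<dots> = (\<Sum>l=1..m. if l = k \<and> j' = j then 1 else 0)"
      by (intro sum.cong) auto
    finally show "(\<Sum>l=1..m. count {#(p, j)#} (l, j')) \<le> (\<Sum>l=1..m. if l = k \<and> j' = j then 1 else 0)" .
  qed
  from packs_union[OF assms(1) this] show ?thesis
    using assms(4) by (simp add: if_distrib cong: if_cong) (erule packs_mono, auto)
qed

text \<open>
  A piece at position \<open>p\<close> can be removed from the last bin up to \<open>p\<close> that holds a piece of the same size:
  between that bin and \<open>p\<close> the prefix sums do not change, so the bound at \<open>p\<close> carries over to them.
\<close>

lemma packs_add_msetE:
  assumes "packs (add_mset (p, j) M) w" "p \<in> {1..n}" "j \<le> s"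
  obtains k where "k \<in> {1..p}" "d j \<le> w k" "packs M (w(k := w k - d j))"
proof -
  obtain y where y: "\<And>k. k\<in>{1..n} \<Longrightarrow> (\<Sum>j\<le>s. y k j * d j) \<le> w k"
     and ge: "\<And>m j'. m\<in>{1..n} \<Longrightarrow> j'\<le>s \<Longrightarrow> (\<Sum>k=1..m. count (add_mset (p, j) M) (k, j')) \<le> (\<Sum>k=1..m. y k j')"
    using assms(1) unfolding packs_def by blast
  have cnt: "(\<Sum>k=1..m. count (add_mset (p, j) M) (k, j')) =
      (\<Sum>k=1..m. count M (k, j')) + (if p \<le> m \<and> j' = j then 1 else 0)" for m j'
  proof -
    have "(\<Sum>k=1..m. count (add_mset (p, j) M) (k, j')) =
        (\<Sum>k=1..m. count M (k, j') + (if k = p then (if j' = j then 1 else 0) else 0))"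
      by (intro sum.cong) auto
    then show ?thesis using assms(2) by (auto simp: sum.distrib sum.delta)
  qed
  define K where "K = {k \<in> {1..p}. 0 < y k j}"
  have "0 < (\<Sum>k=1..p. y k j)" using ge[OF assms(2,3)] unfolding cnt by simp
  then have "\<exists>k\<in>{1..p}. y k j \<noteq> 0" by (metis less_irrefl sum.neutral)
  then have "K \<noteq> {}" unfolding K_def by auto
  define k where "k = Max K"
  have k: "k \<in> K" unfolding k_def using \<open>K \<noteq> {}\<close> by (intro Max_in) (auto simp: K_def)
  have top: "y l j = 0" if "k < l" "l \<le> p" for l
  proof (rule ccontr)
    assume "y l j \<noteq> 0"
    then have "l \<in> K" using that k unfolding K_def by auto
    then have "l \<le> k" unfolding k_def by (intro Max_ge) (auto simp: K_def)
    then show False using that by simp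
  qed
  have kp: "k \<in> {1..p}" "0 < y k j" using k by (auto simp: K_def)
  define y' where "y' = y(k := (y k)(j := y k j - 1))"
  have sumk: "(\<Sum>j'\<le>s. y' k j' * d j') + d j = (\<Sum>j'\<le>s. y k j' * d j')"
  proof -
    have "(\<Sum>j'\<le>s. y k j' * d j') = (\<Sum>j'\<le>s. y' k j' * d j' + (if j' = j then d j else 0))"
      using kp(2) by (intro sum.cong refl) (auto simp: y'_def algebra_simps)
    then show ?thesis using assms(3) by (simp add: sum.distrib sum.delta)
  qed
  have pre: "(\<Sum>l=1..m. y l j') = (\<Sum>l=1..m. y' l j') + (if k \<le> m \<and> j' = j then 1 else 0)" for m j'
  proof -
    have "(\<Sum>l=1..m. y l j') = (\<Sum>l=1..m. y' l j' + (if l = k then (if j' = j then 1 else 0) else 0))"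
      using kp(2) by (intro sum.cong refl) (auto simp: y'_def)
    then show ?thesis using kp(1) by (auto simp: sum.distrib sum.delta)
  qed
  have kn: "k \<in> {1..n}" using kp assms(2) by auto
  have "packs M (w(k := w k - d j))"
    unfolding packs_def
  proof (intro exI[of _ y'] conjI ballI allI impI)
    fix l assume l: "l \<in> {1..n}"
    show "(\<Sum>j'\<le>s. y' l j' * d j') \<le> (w(k := w k - d j)) l"
      using sumk y[OF l] y[OF kn] by (cases "l = k") (auto simp: y'_def)
  next
    fix m j' assume m: "m \<in> {1..n}" and j': "j' \<le> s"
    show "(\<Sum>l=1..m. count M (l, j')) \<le> (\<Sum>l=1..m. y' l j')"
    proof (cases "j' = j \<and> k \<le> m \<and> m < p")
      case False
      then show ?thesis using ge[OF m j'] unfolding pre cnt using kp(1) by (auto split: if_splits)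
    next
      case True
      have "(\<Sum>l=1..p. y l j) = (\<Sum>l=1..m. y l j)"
        using True top by (intro sum.mono_neutral_right) auto
      moreover have "(\<Sum>l=1..m. count M (l, j)) \<le> (\<Sum>l=1..p. count M (l, j))"
        using True by (intro sum_mono2) auto
      moreover note ge[OF assms(2,3)] pre[of j m]
      ultimately show ?thesis using True unfolding cnt by simp
    qed
  qed
  moreover have "d j \<le> w k" using sumk y[OF kn] by linarith
  ultimately show ?thesis using that kp by blast
qed

lemma packs_split:
  assumes "set_mset N \<subseteq> {1..n} \<times> {..s}" "packs (M + N) x"
  shows "\<exists>v. (\<forall>k. v k \<le> x k) \<and> packs M v \<and> packs N (\<lambda>k. x k - v k)"
  using assms
proof (induction N arbitrary: x)
  case empty
  then show ?case by (intro exI[of _ x]) auto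
next
  case (add a N)
  obtain p j where a: "a = (p, j)" by (cases a)
  have pj: "p \<in> {1..n}" "j \<le> s" using add.prems(1) a by auto
  have "packs (add_mset (p, j) (M + N)) x" using add.prems(2) a by simp
  then obtain k where k: "k \<in> {1..p}" "d j \<le> x k" "packs (M + N) (x(k := x k - d j))"
    using pj by (rule packs_add_msetE)
  obtain v where v: "\<forall>l. v l \<le> (x(k := x k - d j)) l" "packs M v" "packs N (\<lambda>l. (x(k := x k - d j)) l - v l)"
    using add.IH[OF _ k(3)] add.prems(1) by auto
  have vk: "v k \<le> x k - d j" using v(1) by (metis fun_upd_same)
  show ?case
  proof (intro exI[of _ v] conjI)
    show "\<forall>l. v l \<le> x l"
      using v(1) vk by (metis diff_le_self fun_upd_apply order_trans)
    show "packs M v" by (rule v(2))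
    have "packs (add_mset (p, j) N) (\<lambda>l. x l - v l)"
    proof (rule packs_add_mset[OF _ k(1)])
      show "packs N ((\<lambda>l. x l - v l)(k := x k - v k - d j))"
        using v(3) by (rule packs_mono) (use vk in auto)
    qed (use pj vk k(2) in auto)
    then show "packs (add_mset a N) (\<lambda>l. x l - v l)" using a by simp
  qed
qed

lemma packs_single:
  assumes "p \<in> {1..n}" "j \<le> s"
  shows "packs {#(p, j)#} w \<longleftrightarrow> (\<exists>k\<in>{1..p}. d j \<le> w k)"
  using assms packs_add_mset[of "{#}" w _ j p] by (auto elim!: packs_add_msetE)

section \<open>Multiplying a socle exponent by a variable\<close>

text \<open>
  The size \<open>d j\<close> of the piece \<open>(k, j)\<close> if it reaches the threshold, and \<open>0\<close> otherwise.
\<close>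

definition thr_size :: "(nat \<Rightarrow> nat) \<Rightarrow> nat \<Rightarrow> nat \<Rightarrow> nat" where
  "thr_size \<tau> k j = (if \<tau> k \<le> j then d j else 0)"

lemma weight_union: "weight \<sigma> (M + N) = weight \<sigma> M + weight \<sigma> N"
  by (simp add: weight_def sum.distrib add_mult_distrib)

lemma weight_empty [simp]: "weight \<sigma> {#} = 0"
  by (simp add: weight_def)

lemma weight_sum: "weight \<sigma> (\<Sum>x\<in>A. g x) = (\<Sum>x\<in>A. weight \<sigma> (g x))"
  by (induction A rule: infinite_finite_induct) (auto simp: weight_union)

lemma weight_replicate:
  assumes "p \<in> {1..n}" "j \<le> s"
  shows "weight \<sigma> (replicate_mset c (p, j)) = c * thr_size \<sigma> p j"
proof -
  have "weight \<sigma> (replicate_mset c (p, j)) = (\<Sum>k=1..n. if k = p then c * thr_size \<sigma> p j else 0)"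
    unfolding weight_def
  proof (rule sum.cong[OF refl])
    fix k
    have "(\<Sum>j'=\<sigma> k..s. count (replicate_mset c (p, j)) (k, j') * d j') =
       (\<Sum>j'=\<sigma> k..s. if j' = j then (if k = p then c * d j else 0) else 0)"
      by (intro sum.cong) auto
    then show "(\<Sum>j'=\<sigma> k..s. count (replicate_mset c (p, j)) (k, j') * d j') =
       (if k = p then c * thr_size \<sigma> p j else 0)"
      using assms(2) by (simp add: thr_size_def)
  qed
  then show ?thesis using assms(1) by simp
qed

text \<open>
  \<open>U\<close> is the family of pieces of the ideal under consideration, and \<open>B\<close> the family of pieces by which the
  generators of a summand of the socle are described. Intended is that \<open>B\<close> arises from \<open>U\<close> by dropping
  all pieces below the threshold \<open>\<tau>\<close>, dropping for each jump \<open>\<tau> k < \<tau> (Suc k)\<close>, and for \<open>k = n\<close>, one piece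
  \<open>(k, \<tau> k)\<close>, and adding for each jump a piece \<open>(k, \<tau> (Suc k))\<close>. Only the effect on weights matters. It
  is stated with sums over all \<open>k\<close>, because the terms at places without a jump cancel.
\<close>

definition socle_pieces :: "(nat \<times> nat) multiset \<Rightarrow> (nat \<Rightarrow> nat) \<Rightarrow> (nat \<times> nat) multiset \<Rightarrow> bool" where
  "socle_pieces U \<tau> B \<longleftrightarrow> (\<forall>\<sigma>. threshold \<sigma> \<longrightarrow>
     weight \<sigma> B + (\<Sum>k=1..n. thr_size \<sigma> k (\<tau> k)) =
     weight (\<lambda>k. max (\<tau> k) (\<sigma> k)) U + (\<Sum>k\<in>{1..<n}. thr_size \<sigma> k (\<tau> (Suc k))))"

lemma socle_pieces_cong:
  assumes "\<And>k. k \<in> {1..n} \<Longrightarrow> \<tau> k = \<tau>' k"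
  shows "socle_pieces U \<tau> B = socle_pieces U \<tau>' B"
proof -
  have "weight (\<lambda>k. max (\<tau> k) (\<sigma> k)) U = weight (\<lambda>k. max (\<tau>' k) (\<sigma> k)) U"
    "(\<Sum>k=1..n. thr_size \<sigma> k (\<tau> k)) = (\<Sum>k=1..n. thr_size \<sigma> k (\<tau>' k))"
    "(\<Sum>k\<in>{1..<n}. thr_size \<sigma> k (\<tau> (Suc k))) = (\<Sum>k\<in>{1..<n}. thr_size \<sigma> k (\<tau>' (Suc k)))" for \<sigma>
    unfolding weight_def using assms by (auto intro!: sum.cong)
  then show ?thesis by (simp only: socle_pieces_def)
qed

text \<open>
  By this formula the remainder \<open>d t - 1\<close> of a bin offers exactly the space which digits of levels from
  \<open>x\<close> to \<open>t - 1\<close> may need.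
\<close>

lemma rdown_pred:
  assumes "t \<le> s"
  shows "int (rdown (d t - 1) x) = (if x \<le> t then int (d t) - int (d x) else 0)"
proof (cases "x \<le> t")
  case True
  obtain c where c: "d t = c * d x" using d_dvd[OF True assms] by (metis dvd_def mult.commute)
  have dx: "0 < d x" using d_pos True assms by simp
  have c1: "1 \<le> c" using c d_pos[OF assms] by (cases c) auto
  have "(d t - 1) div d x = c - 1"
  proof (rule div_nat_eqI)
    show "d x * (c - 1) \<le> d t - 1" using c1 dx c by (simp add: diff_mult_distrib2 mult.commute)
    show "d t - 1 < d x * Suc (c - 1)" using c1 dx c by (simp add: mult.commute)
  qed
  then show ?thesis using True assms c c1 dx
    by (simp add: rdown_def of_nat_diff algebra_simps)
next
  case False
  show ?thesis
  proof (cases "x \<le> s")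
    case True
    have "d t \<le> d x" using False True d_mono by simp
    then have "d t - 1 < d x" using d_pos[OF assms] by linarith
    then show ?thesis using False by (simp add: rdown_def)
  qed (use False in \<open>auto simp: rdown_def\<close>)
qed

lemma telescope_le:
  fixes f g :: "nat \<Rightarrow> int"
  assumes "a \<le> b" "\<And>k. k \<in> {a..<b} \<Longrightarrow> g (Suc k) - g k \<le> f k"
  shows "g b - g a \<le> (\<Sum>k\<in>{a..<b}. f k)"
proof -
  have "g b - g a = (\<Sum>k\<in>{a..<b}. g (Suc k) - g k)" using sum_Suc_diff'[OF assms(1), of g] by simp
  also have "\<dots> \<le> (\<Sum>k\<in>{a..<b}. f k)" using assms(2) by (rule sum_mono)
  finally show ?thesis .
qed

text \<open>
  For each threshold function \<open>\<sigma>\<close> the criterion has to be verified. The weights of \<open>U\<close> and \<open>B\<close> differ by the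
  pieces below \<open>\<tau>\<close>, bounded by the rounded remainders \<open>h\<close>, and by the exchanged pieces. Multiplication by
  the variable \<open>k0\<close> completes the remainder there to \<open>d (\<tau> k0)\<close>. What is left is an inequality that
  telescopes, up to \<open>k0\<close> against \<open>h\<close> and from \<open>k0\<close> on against the sizes \<open>thr_size \<sigma> k (\<tau> k)\<close>. No piece of \<open>U\<close> is
  positioned at \<open>1\<close>, which leaves the remainder of bin \<open>1\<close> free.
\<close>

lemma packs_socle_mult:
  assumes thr: "threshold \<tau>" "\<And>k. k \<in> {1..n} \<Longrightarrow> \<tau> k \<le> s"
    and digits: "\<And>k x y. k \<in> {1..n} \<Longrightarrow> x \<le> y \<Longrightarrow> y \<le> s \<Longrightarrow>
        (\<Sum>j=x..<y. count U (k, j) * d j) + d x \<le> d y"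
    and one: "\<And>j. count U (1, j) = 0"
    and B: "socle_pieces U \<tau> B" and v: "packs B v" and k0: "k0 \<in> {1..n}"
  shows "packs U (\<lambda>k. v k + (d (\<tau> k) - 1) + (if k = k0 then 1 else 0))"
  unfolding packs_iff
proof (intro allI impI)
  fix \<sigma> assume \<sigma>: "threshold \<sigma>"
  define W where "W = (\<lambda>k j. int (thr_size \<sigma> k j))"
  define h where "h = (\<lambda>k. int (rdown (d (\<tau> k) - 1) (\<sigma> k)))"
  have h: "h k = (if \<sigma> k \<le> \<tau> k then int (d (\<tau> k)) - int (d (\<sigma> k)) else 0)" if "k \<in> {1..n}" for k
    unfolding h_def using rdown_pred thr(2) that by simp
  have mono: "\<tau> k \<le> \<tau> (Suc k)" "\<sigma> k \<le> \<sigma> (Suc k)" if "k \<in> {1..<n}" for k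
    using that thr(1) \<sigma> unfolding threshold_def by (auto intro: mono_onD)
  have dd: "int (d x) \<le> int (d y)" if "x \<le> y" "y \<le> s" for x y
    using d_mono[OF that] by simp
  have U: "int (weight \<sigma> U) \<le> int (weight (\<lambda>k. max (\<tau> k) (\<sigma> k)) U) + ((\<Sum>k=1..n. h k) - h 1)"
  proof -
    have "int (\<Sum>j=\<sigma> k..s. count U (k, j) * d j) \<le>
        int (\<Sum>j=max (\<tau> k) (\<sigma> k)..s. count U (k, j) * d j) + (if k = 1 then 0 else h k)"
      if k: "k \<in> {1..n}" for k
    proof (cases "k = 1")
      case True
      then show ?thesis using one by simp
    next
      case False
      show ?thesis
      proof (cases "\<sigma> k \<le> \<tau> k")
        case True
        have "{\<sigma> k..s} = {\<sigma> k..<\<tau> k} \<union> {\<tau> k..s}" using True thr(2)[OF k] by auto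
        then have "(\<Sum>j=\<sigma> k..s. count U (k, j) * d j) =
          (\<Sum>j=\<sigma> k..<\<tau> k. count U (k, j) * d j) + (\<Sum>j=\<tau> k..s. count U (k, j) * d j)"
          by (simp add: sum.union_disjoint ivl_disj_int)
        moreover have "max (\<tau> k) (\<sigma> k) = \<tau> k" using True by simp
        ultimately show ?thesis using digits[OF k True thr(2)[OF k]] h[OF k] True False
          by (simp only: if_False if_True of_nat_add)
      next
        case f: False
        then show ?thesis using h[OF k] by (simp add: max_def)
      qed
    qed
    then have "int (weight \<sigma> U) \<le> (\<Sum>k=1..n. int (\<Sum>j=max (\<tau> k) (\<sigma> k)..s. count U (k, j) * d j) + (if k = 1 then 0 else h k))"
      unfolding weight_def of_nat_sum[of _ "{1..n}"] by (intro sum_mono) auto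
    also have "\<dots> = int (weight (\<lambda>k. max (\<tau> k) (\<sigma> k)) U) + (\<Sum>k=1..n. if k = 1 then 0 else h k)"
      by (simp add: weight_def sum.distrib)
    also have "(\<Sum>k=1..n. if k = 1 then 0 else h k) = (\<Sum>k=1..n. h k - (if k = 1 then h 1 else 0))"
      by (intro sum.cong) auto
    also have "\<dots> = (\<Sum>k=1..n. h k) - h 1"
      unfolding sum_subtractf using n_pos by (simp add: sum.delta)
    finally show ?thesis .
  qed
  have b: "int (rdown (d (\<tau> k) - 1 + (if k = k0 then 1 else 0)) (\<sigma> k)) = h k + (if k = k0 then W k0 (\<tau> k0) - h k0 else 0)"
    if k: "k \<in> {1..n}" for k
  proof (cases "k = k0")
    case True
    have p: "d (\<tau> k0) - 1 + 1 = d (\<tau> k0)" using d_pos thr(2)[OF k0] by simp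
    have "rdown (d (\<tau> k0)) (\<sigma> k0) = thr_size \<sigma> k0 (\<tau> k0)"
    proof (cases "\<sigma> k0 \<le> \<tau> k0")
      case True
      then show ?thesis using thr(2)[OF k0] d_dvd by (simp add: rdown_id thr_size_def)
    next
      case False
      show ?thesis
      proof (cases "\<sigma> k0 \<le> s")
        case True
        have "d (\<tau> k0) \<noteq> d (\<sigma> k0)"
        proof -
          have "d (\<tau> k0) < d (Suc (\<tau> k0))" using d_seq False True unfolding d_sequence_def by simp
          also have "\<dots> \<le> d (\<sigma> k0)" using False True by (intro d_mono) auto
          finally show ?thesis by simp
        qed
        then have "d (\<tau> k0) < d (\<sigma> k0)" using d_mono[of "\<tau> k0" "\<sigma> k0"] True False by simp
        then show ?thesis using False by (simp add: rdown_def thr_size_def)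
      qed (use False in \<open>auto simp: rdown_def thr_size_def\<close>)
    qed
    then show ?thesis using True p by (simp add: W_def)
  qed (simp add: h_def)
  have R: "int (weight \<sigma> B) + (\<Sum>k=1..n. h k) - h k0 + W k0 (\<tau> k0)
      \<le> int (\<Sum>k=1..n. rdown (v k + (d (\<tau> k) - 1) + (if k = k0 then 1 else 0)) (\<sigma> k))"
  proof -
    have "int (weight \<sigma> B) + (\<Sum>k=1..n. h k) - h k0 + W k0 (\<tau> k0)
       \<le> (\<Sum>k=1..n. int (rdown (v k) (\<sigma> k))) + (\<Sum>k=1..n. h k + (if k = k0 then W k0 (\<tau> k0) - h k0 else 0))"
      using weight_le_of_packs[OF v \<sigma>] k0
      by (simp add: sum.distrib sum.delta flip: of_nat_sum)
    also have "\<dots> = (\<Sum>k=1..n. int (rdown (v k) (\<sigma> k)) + int (rdown (d (\<tau> k) - 1 + (if k = k0 then 1 else 0)) (\<sigma> k)))"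
      using b by (simp add: sum.distrib)
    also have "\<dots> \<le> (\<Sum>k=1..n. int (rdown (v k + (d (\<tau> k) - 1) + (if k = k0 then 1 else 0)) (\<sigma> k)))"
      unfolding of_nat_add[symmetric] add.assoc by (intro sum_mono of_nat_mono rdown_add)
    finally show ?thesis by simp
  qed
  have T1: "h k0 - h 1 \<le> (\<Sum>k\<in>{1..<k0}. W k (\<tau> (Suc k)) - W k (\<tau> k))"
  proof (rule telescope_le)
    fix k assume k: "k \<in> {1..<k0}"
    then have kn: "k \<in> {1..<n}" "k \<in> {1..n}" "Suc k \<in> {1..n}" using k0 by auto
    note m = mono[OF kn(1)] and t = thr(2)[OF kn(2)] thr(2)[OF kn(3)]
    show "h (Suc k) - h k \<le> W k (\<tau> (Suc k)) - W k (\<tau> k)"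
      unfolding h[OF kn(2)] h[OF kn(3)] W_def thr_size_def
      using m t dd[of "\<sigma> k" "\<sigma> (Suc k)"] dd[of "\<tau> k" "\<tau> (Suc k)"]
        dd[of "\<sigma> k" "\<tau> (Suc k)"] by auto
  qed (use k0 in auto)
  have T2: "W n (\<tau> n) - W k0 (\<tau> k0) \<le> (\<Sum>k\<in>{k0..<n}. W k (\<tau> (Suc k)) - W k (\<tau> k))"
  proof (rule telescope_le)
    fix k assume k: "k \<in> {k0..<n}"
    then have kn: "k \<in> {1..<n}" using k0 by auto
    show "W (Suc k) (\<tau> (Suc k)) - W k (\<tau> k) \<le> W k (\<tau> (Suc k)) - W k (\<tau> k)"
      using mono[OF kn] by (simp add: W_def thr_size_def)
  qed (use k0 in auto)
  have "(\<Sum>k\<in>{1..<k0}. W k (\<tau> (Suc k)) - W k (\<tau> k)) + (\<Sum>k\<in>{k0..<n}. W k (\<tau> (Suc k)) - W k (\<tau> k))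
    = (\<Sum>k\<in>{1..<n}. W k (\<tau> (Suc k))) - (\<Sum>k\<in>{1..<n}. W k (\<tau> k))"
    unfolding sum_subtractf[symmetric] using k0 by (intro sum.atLeastLessThan_concat) auto
  moreover have "(\<Sum>k=1..n. W k (\<tau> k)) = (\<Sum>k\<in>{1..<n}. W k (\<tau> k)) + W n (\<tau> n)"
    using n_pos by (metis add.commute sum.last_plus)
  moreover have "int (weight \<sigma> B) + (\<Sum>k=1..n. W k (\<tau> k)) =
     int (weight (\<lambda>k. max (\<tau> k) (\<sigma> k)) U) + (\<Sum>k\<in>{1..<n}. W k (\<tau> (Suc k)))"
    unfolding W_def of_nat_sum[symmetric] of_nat_add[symmetric] of_nat_eq_iff
    using B \<sigma> unfolding socle_pieces_def by blast
  ultimately have "int (weight \<sigma> U) \<le> int (\<Sum>k=1..n. rdown (v k + (d (\<tau> k) - 1) + (if k = k0 then 1 else 0)) (\<sigma> k))"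
    using U R T1 T2 by linarith
  then show "weight \<sigma> U \<le> (\<Sum>k=1..n. rdown (v k + (d (\<tau> k) - 1) + (if k = k0 then 1 else 0)) (\<sigma> k))"
    by linarith
qed


section \<open>Exponents that every variable makes packable\<close>

text \<open>
  The contribution of bin \<open>k\<close> to the difference of the two sides of the packing criterion. The difference
  is a sum of terms depending on one value of the threshold function each, so thresholds may be
  changed bin by bin.
\<close>

definition excess :: "(nat \<times> nat) multiset \<Rightarrow> (nat \<Rightarrow> nat) \<Rightarrow> nat \<Rightarrow> nat \<Rightarrow> int" where
  "excess U w k t = int (rdown (w k) t) - int (\<Sum>j=t..s. count U (k, j) * d j)"

lemma sum_excess:
  "(\<Sum>k=1..n. excess U w k (\<tau> k)) = int (\<Sum>k=1..n. rdown (w k) (\<tau> k)) - int (weight \<tau> U)"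
  by (simp add: excess_def weight_def sum_subtractf)

lemma excess_dvd:
  assumes "t \<le> s" "t \<le> t'"
  shows "int (d t) dvd excess U w k t'"
proof (cases "t' \<le> s")
  case True
  have "d t dvd d t'" using d_dvd assms(2) True by simp
  then have "d t dvd rdown (w k) t'" "d t dvd (\<Sum>j=t'..s. count U (k, j) * d j)"
    using rdown_dvd[OF True, of "w k"] dvd_tail_sum[OF True, of "\<lambda>j. count U (k, j)"]
    by (auto intro: dvd_trans)
  then show ?thesis unfolding excess_def by (intro dvd_diff) (simp_all only: of_nat_dvd_iff)
qed (simp add: excess_def rdown_def)

text \<open>
  A threshold function is deficient if it violates the packing criterion.
\<close>

definition deficient :: "(nat \<times> nat) multiset \<Rightarrow> (nat \<Rightarrow> nat) \<Rightarrow> (nat \<Rightarrow> nat) \<Rightarrow> bool" where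
  "deficient U w \<tau> \<longleftrightarrow> threshold \<tau> \<and> (\<Sum>k=1..n. excess U w k (\<tau> k)) < 0"

lemma packs_iff_not_deficient: "packs U w \<longleftrightarrow> (\<forall>\<tau>. \<not> deficient U w \<tau>)"
  unfolding packs_iff deficient_def sum_excess diff_less_0_iff_less of_nat_less_iff
  by (meson not_le)

lemma rdown_Suc:
  assumes "t \<le> s" "rdown x t < rdown (Suc x) t"
  shows "d t dvd Suc x" "rdown (Suc x) t = rdown x t + d t"
proof -
  have "x div d t < Suc x div d t" using assms by (simp add: rdown_def)
  then have "Suc x div d t = Suc (x div d t)" "Suc x mod d t = 0"
    by (auto simp: div_Suc split: if_splits)
  then show "d t dvd Suc x" "rdown (Suc x) t = rdown x t + d t"
    using assms(1) by (auto simp: rdown_def)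
qed

text \<open>
  If every variable makes \<open>w\<close> packable, a deficient threshold function must respond to each unit of
  capacity. This forces the remainder of \<open>w k\<close> modulo \<open>d (\<tau> k)\<close> to be maximal. Moreover all terms are
  divisible by the smallest size \<open>d (\<tau> 1)\<close>, which determines the deficit.
\<close>

lemma deficient_socle:
  assumes def: "deficient U w \<tau>" and soc: "\<And>k0. k0 \<in> {1..n} \<Longrightarrow> packs U (\<lambda>k. w k + (if k = k0 then 1 else 0))"
  shows "\<And>k. k \<in> {1..n} \<Longrightarrow> \<tau> k \<le> s" "\<And>k. k \<in> {1..n} \<Longrightarrow> d (\<tau> k) dvd Suc (w k)"
    "(\<Sum>k=1..n. excess U w k (\<tau> k)) = - int (d (\<tau> 1))"
proof -
  have thr: "threshold \<tau>" and neg: "(\<Sum>k=1..n. excess U w k (\<tau> k)) < 0"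
    using def by (auto simp: deficient_def)
  have *: "- int (rdown (Suc (w k0)) (\<tau> k0)) + int (rdown (w k0) (\<tau> k0)) \<le> (\<Sum>k=1..n. excess U w k (\<tau> k))"
    if k0: "k0 \<in> {1..n}" for k0
  proof -
    have "0 \<le> (\<Sum>k=1..n. excess U (\<lambda>k. w k + (if k = k0 then 1 else 0)) k (\<tau> k))"
      using soc[OF k0] thr unfolding packs_iff_not_deficient deficient_def by (meson not_le)
    also have "\<dots> = (\<Sum>k=1..n. excess U w k (\<tau> k) + (if k = k0 then int (rdown (Suc (w k0)) (\<tau> k0)) - int (rdown (w k0) (\<tau> k0)) else 0))"
      by (intro sum.cong refl) (auto simp: excess_def)
    also have "\<dots> = (\<Sum>k=1..n. excess U w k (\<tau> k)) + (int (rdown (Suc (w k0)) (\<tau> k0)) - int (rdown (w k0) (\<tau> k0)))"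
      using k0 by (simp add: sum.distrib sum.delta)
    finally show ?thesis by linarith
  qed
  have lt: "rdown (w k) (\<tau> k) < rdown (Suc (w k)) (\<tau> k)" if "k \<in> {1..n}" for k
    using *[OF that] neg by linarith
  show s: "\<tau> k \<le> s" if "k \<in> {1..n}" for k
    using lt[OF that] by (cases "\<tau> k \<le> s") (auto simp: rdown_def)
  show "d (\<tau> k) dvd Suc (w k)" if "k \<in> {1..n}" for k
    using rdown_Suc(1)[OF s[OF that] lt[OF that]] .
  have one: "1 \<in> {1..n}" using n_pos by simp
  have ge: "- int (d (\<tau> 1)) \<le> (\<Sum>k=1..n. excess U w k (\<tau> k))"
    using *[OF one] rdown_Suc(2)[OF s[OF one] lt[OF one]] by simp
  have "int (d (\<tau> 1)) dvd (\<Sum>k=1..n. excess U w k (\<tau> k))"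
    using thr one by (intro dvd_sum excess_dvd s) (auto simp: threshold_def mono_on_def)
  then obtain c where c: "(\<Sum>k=1..n. excess U w k (\<tau> k)) = int (d (\<tau> 1)) * c" by (auto elim: dvdE)
  have dp: "0 < int (d (\<tau> 1))" using d_pos[OF s[OF one]] by simp
  have "c < 0" using neg dp unfolding c by (simp add: mult_less_0_iff)
  moreover have "-1 \<le> c"
  proof -
    have "int (d (\<tau> 1)) * (-1) \<le> int (d (\<tau> 1)) * c" using ge unfolding c by simp
    then show ?thesis using dp by (simp only: mult_le_cancel_left_pos)
  qed
  ultimately have "c = -1" by simp
  then show "(\<Sum>k=1..n. excess U w k (\<tau> k)) = - int (d (\<tau> 1))" using c by simp
qed

text \<open>
  A deficient threshold function of maximal sum of values.
\<close>

definition max_deficient :: "(nat \<times> nat) multiset \<Rightarrow> (nat \<Rightarrow> nat) \<Rightarrow> (nat \<Rightarrow> nat) \<Rightarrow> bool" where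
  "max_deficient U w \<tau> \<longleftrightarrow> deficient U w \<tau> \<and>
     (\<forall>\<sigma>. deficient U w \<sigma> \<longrightarrow> (\<Sum>k=1..n. \<sigma> k) \<le> (\<Sum>k=1..n. \<tau> k))"

lemma ex_max_deficient:
  assumes "\<not> packs U w"
  obtains \<tau> where "max_deficient U w \<tau>"
proof -
  obtain \<tau>0 where "deficient U w \<tau>0" using assms packs_iff_not_deficient by blast
  moreover have "(\<Sum>k=1..n. \<sigma> k) < Suc (n * Suc s)" if "deficient U w \<sigma>" for \<sigma>
  proof -
    have "(\<Sum>k=1..n. \<sigma> k) \<le> (\<Sum>k=1..n. Suc s)"
      using that unfolding deficient_def threshold_def by (intro sum_mono) auto
    then show ?thesis by simp
  qed
  ultimately show ?thesis
    using that ex_has_greatest_nat[of "deficient U w" \<tau>0 "\<lambda>\<sigma>. \<Sum>k=1..n. \<sigma> k" "Suc (n * Suc s)"]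
    unfolding max_deficient_def by blast
qed

lemma max_deficient_above:
  assumes "max_deficient U w \<tau>" "threshold \<sigma>" "\<And>k. k \<in> {1..n} \<Longrightarrow> \<tau> k \<le> \<sigma> k"
    and "l \<in> {1..n}" "\<tau> l \<noteq> \<sigma> l"
  shows "0 \<le> (\<Sum>k=1..n. excess U w k (\<sigma> k))"
proof (rule ccontr)
  assume "\<not> ?thesis"
  then have "deficient U w \<sigma>" using assms(2) by (simp add: deficient_def)
  then have "(\<Sum>k=1..n. \<sigma> k) \<le> (\<Sum>k=1..n. \<tau> k)" using assms(1) by (simp add: max_deficient_def)
  moreover have "(\<Sum>k=1..n. \<tau> k) < (\<Sum>k=1..n. \<sigma> k)"
  proof (rule sum_strict_mono_ex1)
    show "\<exists>k\<in>{1..n}. \<tau> k < \<sigma> k" using assms(3)[OF assms(4)] assms(4,5) le_neq_implies_less by blast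
  qed (use assms(3) in auto)
  ultimately show False by simp
qed

text \<open>
  Otherwise the threshold at \<open>k\<close> could be raised by one: no piece is lost and the rounded capacity does
  not grow.
\<close>

lemma max_deficient_jump:
  assumes mx: "max_deficient U w \<tau>" and k: "k \<in> {1..n}" and t: "\<tau> k \<le> s"
    and jump: "k < n \<Longrightarrow> \<tau> k < \<tau> (Suc k)"
  shows "0 < count U (k, \<tau> k)"
proof (rule ccontr)
  assume "\<not> ?thesis"
  then have c0: "count U (k, \<tau> k) = 0" by (simp only: neq0_conv[symmetric] not_not)
  define \<sigma> where "\<sigma> = \<tau>(k := Suc (\<tau> k))"
  have thr: "threshold \<tau>" and neg: "(\<Sum>k=1..n. excess U w k (\<tau> k)) < 0"
    using mx by (auto simp: max_deficient_def deficient_def)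
  have up: "Suc (\<tau> k) \<le> \<tau> y" if "k < y" "y \<le> n" for y
  proof -
    have "\<tau> (Suc k) \<le> \<tau> y" using thr that k unfolding threshold_def by (auto intro: mono_onD)
    then show ?thesis using jump that by simp
  qed
  have "threshold \<sigma>"
    unfolding threshold_def mono_on_def
  proof (intro conjI allI impI ballI; (elim conjE)?)
    fix x y assume xy: "x \<in> {1..n}" "y \<in> {1..n}" "x \<le> y"
    have "\<tau> x \<le> \<tau> y" using thr xy unfolding threshold_def by (auto intro: mono_onD)
    then show "\<sigma> x \<le> \<sigma> y" using up[of y] xy by (auto simp: \<sigma>_def)
  next
    fix x assume "x \<in> {1..n}"
    then show "\<sigma> x \<le> Suc s" using thr t by (auto simp: \<sigma>_def threshold_def)
  qed
  then have "0 \<le> (\<Sum>k=1..n. excess U w k (\<sigma> k))"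
    using max_deficient_above[OF mx, of \<sigma> k] k by (simp add: \<sigma>_def)
  moreover have "(\<Sum>k=1..n. excess U w k (\<sigma> k)) \<le> (\<Sum>k=1..n. excess U w k (\<tau> k))"
  proof (rule sum_mono)
    fix x assume "x \<in> {1..n}"
    show "excess U w x (\<sigma> x) \<le> excess U w x (\<tau> x)"
    proof (cases "x = k")
      case True
      have "(\<Sum>j=\<tau> k..s. count U (k, j) * d j) = (\<Sum>j=Suc (\<tau> k)..s. count U (k, j) * d j)"
        using t c0 by (simp add: sum.atLeast_Suc_atMost)
      then show ?thesis using True rdown_antimono[of "\<tau> k" "Suc (\<tau> k)" "w k"]
        by (simp add: \<sigma>_def excess_def)
    qed (simp add: \<sigma>_def)
  qed
  ultimately show False using neg by simp
qed

text \<open>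
  This is the packing criterion for the family \<open>B\<close> in disguise. The terms of the sum on the left are
  \<open>d (\<tau> (Suc k))\<close> at the places \<open>k\<close> with \<open>\<sigma> k \<le> \<tau> (Suc k) < \<sigma> (Suc k)\<close>, and \<open>0\<close> elsewhere. At the last such
  place \<open>m\<close> the functions \<open>\<sigma>\<close> and \<open>\<tau>\<close> can exchange their tails. The function \<open>\<eta>\<close> that agrees with \<open>\<sigma>\<close> only behind
  \<open>m\<close> has nonnegative excess by maximality of \<open>\<tau>\<close>, whereas \<open>\<tau>\<close> has negative excess, and the difference is
  divisible by \<open>d (\<tau> (Suc m))\<close>. So it accounts for the term at \<open>m\<close>, and induction applies to the
  function \<open>\<rho>\<close> that agrees with \<open>\<sigma>\<close> only up to \<open>m\<close>.
\<close>

lemma excess_above_max_deficient: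
  assumes mx: "max_deficient U w \<tau>" and t: "\<And>k. k \<in> {1..n} \<Longrightarrow> \<tau> k \<le> s"
    and F: "(\<Sum>k=1..n. excess U w k (\<tau> k)) = - int (d (\<tau> 1))"
    and \<sigma>: "threshold \<sigma>" "\<And>k. k \<in> {1..n} \<Longrightarrow> \<tau> k \<le> \<sigma> k"
  shows "- int (thr_size \<sigma> 1 (\<tau> 1))
     + (\<Sum>k\<in>{1..<n}. int (thr_size \<sigma> k (\<tau> (Suc k))) - int (thr_size \<sigma> (Suc k) (\<tau> (Suc k))))
     \<le> (\<Sum>k=1..n. excess U w k (\<sigma> k))"
proof -
  have thr: "threshold \<tau>"
    using mx by (auto simp: max_deficient_def deficient_def)
  have tmono: "\<tau> x \<le> \<tau> y" if "x \<in> {1..n}" "y \<in> {1..n}" "x \<le> y" for x y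
    using thr that unfolding threshold_def by (auto intro: mono_onD)
  have main: "- int (thr_size \<sigma> 1 (\<tau> 1))
     + (\<Sum>k\<in>{1..<n}. int (thr_size \<sigma> k (\<tau> (Suc k))) - int (thr_size \<sigma> (Suc k) (\<tau> (Suc k))))
     \<le> (\<Sum>k=1..n. excess U w k (\<sigma> k))"
    if "threshold \<sigma>" "\<And>k. k \<in> {1..n} \<Longrightarrow> \<tau> k \<le> \<sigma> k"
      "\<And>k. k \<in> {1..<n} \<Longrightarrow> m \<le> k \<Longrightarrow> \<not> (\<sigma> k \<le> \<tau> (Suc k) \<and> \<tau> (Suc k) < \<sigma> (Suc k))"
    for m \<sigma> using that
  proof (induction m arbitrary: \<sigma>)
    case 0
    have "thr_size \<sigma> k (\<tau> (Suc k)) = thr_size \<sigma> (Suc k) (\<tau> (Suc k))" if k: "k \<in> {1..<n}" for k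
    proof -
      have "\<sigma> k \<le> \<sigma> (Suc k)" using "0.prems"(1) k unfolding threshold_def by (auto intro: mono_onD)
      then show ?thesis using "0.prems"(3)[OF k] by (auto simp: thr_size_def)
    qed
    then have z: "(\<Sum>k\<in>{1..<n}. int (thr_size \<sigma> k (\<tau> (Suc k))) - int (thr_size \<sigma> (Suc k) (\<tau> (Suc k)))) = 0"
      by (intro sum.neutral) simp
    show ?case
    proof (cases "\<forall>k\<in>{1..n}. \<tau> k = \<sigma> k")
      case True
      then have "(\<Sum>k=1..n. excess U w k (\<sigma> k)) = - int (d (\<tau> 1))" using F by simp
      moreover have "\<sigma> 1 = \<tau> 1" using True n_pos by simp
      ultimately show ?thesis using z by (simp add: thr_size_def)
    next
      case False
      then have "0 \<le> (\<Sum>k=1..n. excess U w k (\<sigma> k))"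
        using max_deficient_above[OF mx "0.prems"(1,2)] by blast
      then show ?thesis unfolding z by linarith
    qed
  next
    case (Suc m)
    have smono: "\<sigma> x \<le> \<sigma> y" if "x \<in> {1..n}" "y \<in> {1..n}" "x \<le> y" for x y
      using Suc.prems(1) that unfolding threshold_def by (auto intro: mono_onD)
    show ?case
    proof (cases "m \<in> {1..<n} \<and> \<sigma> m \<le> \<tau> (Suc m) \<and> \<tau> (Suc m) < \<sigma> (Suc m)")
      case False
      have "\<not> (\<sigma> k \<le> \<tau> (Suc k) \<and> \<tau> (Suc k) < \<sigma> (Suc k))" if "k \<in> {1..<n}" "m \<le> k" for k
        using False Suc.prems(3)[of k] that by (cases "k = m") auto
      then show ?thesis using Suc.IH[of \<sigma>] Suc.prems(1,2) by blast
    next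
      case True
      then have m: "m \<in> {1..<n}" and le: "\<sigma> m \<le> \<tau> (Suc m)" and less: "\<tau> (Suc m) < \<sigma> (Suc m)" by auto
      define \<rho> where "\<rho> = (\<lambda>k. if k \<le> m then \<sigma> k else \<tau> k)"
      define \<eta> where "\<eta> = (\<lambda>k. if k \<le> m then \<tau> k else \<sigma> k)"
      have Sm: "m \<in> {1..n}" "Suc m \<in> {1..n}" using m by auto
      have \<rho>: "threshold \<rho>"
        unfolding threshold_def mono_on_def
      proof (intro conjI allI impI ballI; (elim conjE)?)
        fix x y assume xy: "x \<in> {1..n}" "y \<in> {1..n}" "x \<le> y"
        show "\<rho> x \<le> \<rho> y"
          using tmono[OF xy] smono[OF xy] smono[of x m] tmono[of "Suc m" y] le xy Sm
          by (auto simp: \<rho>_def)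
      next
        fix x assume "x \<in> {1..n}"
        then show "\<rho> x \<le> Suc s" using thr Suc.prems(1) by (auto simp: \<rho>_def threshold_def)
      qed
      have \<eta>: "threshold \<eta>"
        unfolding threshold_def mono_on_def
      proof (intro conjI allI impI ballI; (elim conjE)?)
        fix x y assume xy: "x \<in> {1..n}" "y \<in> {1..n}" "x \<le> y"
        show "\<eta> x \<le> \<eta> y"
          using tmono[OF xy] smono[OF xy] Suc.prems(2)[of y] xy
          by (auto simp: \<eta>_def)
      next
        fix x assume "x \<in> {1..n}"
        then show "\<eta> x \<le> Suc s" using thr Suc.prems(1) by (auto simp: \<eta>_def threshold_def)
      qed
      define \<phi> where "\<phi> = (\<lambda>\<zeta>. \<lambda>k. int (thr_size \<zeta> k (\<tau> (Suc k))) - int (thr_size \<zeta> (Suc k) (\<tau> (Suc k))))"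
      have IH: "- int (thr_size \<rho> 1 (\<tau> 1)) + (\<Sum>k\<in>{1..<n}. \<phi> \<rho> k) \<le> (\<Sum>k=1..n. excess U w k (\<rho> k))"
        unfolding \<phi>_def
      proof (rule Suc.IH[OF \<rho>])
        show "\<tau> k \<le> \<rho> k" if "k \<in> {1..n}" for k using Suc.prems(2)[OF that] by (auto simp: \<rho>_def)
      qed (auto simp: \<rho>_def)
      have "0 \<le> (\<Sum>k=1..n. excess U w k (\<eta> k))"
        by (rule max_deficient_above[OF mx \<eta> _ Sm(2)])
          (use Suc.prems(2) less in \<open>auto simp: \<eta>_def\<close>)
      then have pos: "0 < (\<Sum>k=1..n. excess U w k (\<eta> k) - excess U w k (\<tau> k))"
        using F d_pos[of "\<tau> 1"] t[of 1] n_pos by (simp add: sum_subtractf)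
      have dv: "int (d (\<tau> (Suc m))) dvd (\<Sum>k=1..n. excess U w k (\<eta> k) - excess U w k (\<tau> k))"
      proof (rule dvd_sum)
        fix k assume k: "k \<in> {1..n}"
        show "int (d (\<tau> (Suc m))) dvd excess U w k (\<eta> k) - excess U w k (\<tau> k)"
        proof (cases "k \<le> m")
          case False
          then have "\<tau> (Suc m) \<le> \<tau> k" "\<tau> (Suc m) \<le> \<sigma> k"
            using tmono[OF Sm(2) k] Suc.prems(2)[OF k] by auto
          then show ?thesis using False t[OF Sm(2)] by (simp add: \<eta>_def) (intro dvd_diff excess_dvd)
        qed (simp add: \<eta>_def)
      qed
      have "int (d (\<tau> (Suc m))) \<le> (\<Sum>k=1..n. excess U w k (\<eta> k) - excess U w k (\<tau> k))"
        using zdvd_imp_le[OF dv pos] .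
      moreover have "(\<Sum>k=1..n. excess U w k (\<sigma> k)) =
          (\<Sum>k=1..n. excess U w k (\<rho> k)) + (\<Sum>k=1..n. excess U w k (\<eta> k) - excess U w k (\<tau> k))"
        unfolding sum.distrib[symmetric] by (intro sum.cong) (auto simp: \<rho>_def \<eta>_def)
      moreover have "(\<Sum>k\<in>{1..<n}. \<phi> \<sigma> k) = (\<Sum>k\<in>{1..<n}. \<phi> \<rho> k) + int (d (\<tau> (Suc m)))"
      proof -
        have "(\<Sum>k\<in>{1..<n}. \<phi> \<sigma> k) = (\<Sum>k\<in>{1..<n}. \<phi> \<rho> k + (if k = m then int (d (\<tau> (Suc m))) else 0))"
        proof (rule sum.cong[OF refl])
          fix k assume k: "k \<in> {1..<n}"
          consider "k < m" | "k = m" | "m < k" by linarith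
          then show "\<phi> \<sigma> k = \<phi> \<rho> k + (if k = m then int (d (\<tau> (Suc m))) else 0)"
          proof cases
            case 3
            have "\<sigma> k \<le> \<sigma> (Suc k)" "\<tau> k \<le> \<tau> (Suc k)" using smono tmono k by auto
            then show ?thesis using 3 Suc.prems(3)[OF k] by (auto simp: \<phi>_def \<rho>_def thr_size_def)
          qed (use le less in \<open>auto simp: \<phi>_def \<rho>_def thr_size_def\<close>)
        qed
        then show ?thesis using m by (simp add: sum.distrib sum.delta)
      qed
      moreover have "thr_size \<rho> 1 (\<tau> 1) = thr_size \<sigma> 1 (\<tau> 1)" using m by (simp add: thr_size_def \<rho>_def)
      ultimately show ?thesis using IH unfolding \<phi>_def by linarith
    qed
  qed
  show ?thesis by (rule main[OF \<sigma>, of n]) auto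
qed

text \<open>
  Replacing \<open>\<sigma>\<close> by its maximum \<open>\<rho>\<close> with \<open>\<tau>\<close> changes neither side of the criterion: \<open>B\<close> contributes no weight
  below \<open>\<tau>\<close>, and the capacities \<open>v k\<close> are multiples of \<open>d (\<tau> k)\<close>.
\<close>

lemma packs_socle_quotient:
  assumes mx: "max_deficient U w \<tau>"
    and soc: "\<And>k0. k0 \<in> {1..n} \<Longrightarrow> packs U (\<lambda>k. w k + (if k = k0 then 1 else 0))"
    and B: "socle_pieces U \<tau> B"
  shows "packs B (\<lambda>k. w k - (d (\<tau> k) - 1))"
  unfolding packs_iff
proof (intro allI impI)
  fix \<sigma> assume \<sigma>: "threshold \<sigma>"
  have def: "deficient U w \<tau>" and thr: "threshold \<tau>"
    using mx by (auto simp: max_deficient_def deficient_def)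
  have t: "\<tau> k \<le> s" if "k \<in> {1..n}" for k
    by (rule deficient_socle(1)[OF def]) (use soc that in blast)+
  have dv: "d (\<tau> k) dvd Suc (w k)" if "k \<in> {1..n}" for k
    by (rule deficient_socle(2)[OF def]) (use soc that in blast)+
  have F: "(\<Sum>k=1..n. excess U w k (\<tau> k)) = - int (d (\<tau> 1))"
    by (rule deficient_socle(3)[OF def]) (use soc in blast)
  define \<rho> where "\<rho> = (\<lambda>k. max (\<tau> k) (\<sigma> k))"
  have mono: "\<tau> k \<le> \<tau> (Suc k)" if "k \<in> {1..<n}" for k
    using that thr unfolding threshold_def by (auto intro: mono_onD)
  have \<rho>: "threshold \<rho>" using thr \<sigma> unfolding threshold_def \<rho>_def mono_on_def
    by (auto simp: max.coboundedI1 max.coboundedI2)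
  define v where "v = (\<lambda>k. w k - (d (\<tau> k) - 1))"
  have v: "w k = v k + (d (\<tau> k) - 1)" "d (\<tau> k) dvd v k" if "k \<in> {1..n}" for k
  proof -
    obtain c where c: "Suc (w k) = d (\<tau> k) * c" using dv[OF \<open>k \<in> {1..n}\<close>] by (auto elim: dvdE)
    then have "0 < c" by (cases c) auto
    then obtain c' where c': "c = Suc c'" by (cases c) auto
    show "w k = v k + (d (\<tau> k) - 1)" using c c' d_pos[OF t[OF that]] by (simp add: v_def)
    have "v k = d (\<tau> k) * c'" using c c' d_pos[OF t[OF that]] by (simp add: v_def)
    then show "d (\<tau> k) dvd v k" by simp
  qed
  have R1: "rdown (v k) (\<sigma> k) = rdown (v k) (\<rho> k)" if k: "k \<in> {1..n}" for k
  proof (cases "\<sigma> k \<le> \<tau> k")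
    case True
    have "d (\<sigma> k) dvd v k" using v(2)[OF k] d_dvd[OF True t[OF k]] by (rule dvd_trans[rotated])
    then show ?thesis using True t[OF k] v(2)[OF k] by (simp add: \<rho>_def max_def rdown_id)
  qed (simp add: \<rho>_def max_def)
  have R2: "rdown (w k) (\<rho> k) \<le> rdown (v k) (\<rho> k)" if k: "k \<in> {1..n}" for k
  proof (cases "\<rho> k \<le> s")
    case True
    have dd: "d (\<tau> k) dvd d (\<rho> k)" using True by (intro d_dvd) (auto simp: \<rho>_def)
    have "rdown (w k) (\<rho> k) \<le> v k"
    proof -
      obtain a where a: "rdown (w k) (\<rho> k) = d (\<tau> k) * a"
        using rdown_dvd[OF True, of "w k"] dd by (metis dvd_def dvd_trans)
      obtain b where b: "v k = d (\<tau> k) * b" using v(2)[OF k] by (auto elim: dvdE)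
      have "d (\<tau> k) * a < d (\<tau> k) * Suc b"
        using rdown_le[of "w k" "\<rho> k"] v(1)[OF k] d_pos[OF t[OF k]] unfolding a b by simp
      then have "a < Suc b" by (simp only: mult_less_cancel1)
      then have "a \<le> b" by simp
      then show ?thesis unfolding a b by simp
    qed
    then show ?thesis using rdown_dvd[OF True] True by (intro rdown_greatest)
  qed (simp add: rdown_def)
  have "int (weight \<rho> U) + (\<Sum>k\<in>{1..<n}. int (thr_size \<rho> k (\<tau> (Suc k)))) - (\<Sum>k=1..n. int (thr_size \<rho> k (\<tau> k)))
      \<le> (\<Sum>k=1..n. int (rdown (w k) (\<rho> k)))"
  proof -
    have "(\<Sum>k=1..n. int (thr_size \<rho> k (\<tau> k))) = int (thr_size \<rho> 1 (\<tau> 1)) + (\<Sum>k\<in>{1..<n}. int (thr_size \<rho> (Suc k) (\<tau> (Suc k))))"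
    proof -
      have "(\<Sum>k=1..n. int (thr_size \<rho> k (\<tau> k))) = int (thr_size \<rho> 1 (\<tau> 1)) + (\<Sum>k=Suc 1..n. int (thr_size \<rho> k (\<tau> k)))"
        using n_pos by (simp add: sum.atLeast_Suc_atMost)
      also have "(\<Sum>k=Suc 1..n. int (thr_size \<rho> k (\<tau> k))) = (\<Sum>k\<in>{1..<n}. int (thr_size \<rho> (Suc k) (\<tau> (Suc k))))"
        unfolding atLeastLessThanSuc_atLeastAtMost[symmetric] sum.atLeast_Suc_lessThan_Suc_shift
        by (simp only: comp_def)
      finally show ?thesis .
    qed
    moreover have "\<tau> k \<le> \<rho> k" for k by (simp add: \<rho>_def)
    ultimately show ?thesis
      using excess_above_max_deficient[OF mx t F \<rho>] unfolding sum_excess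
      by (simp add: sum_subtractf)
  qed
  moreover have "int (weight \<sigma> B) + (\<Sum>k=1..n. int (thr_size \<sigma> k (\<tau> k))) =
     int (weight \<rho> U) + (\<Sum>k\<in>{1..<n}. int (thr_size \<sigma> k (\<tau> (Suc k))))"
    unfolding \<rho>_def of_nat_sum[symmetric] of_nat_add[symmetric] of_nat_eq_iff
    using B \<sigma> unfolding socle_pieces_def by blast
  moreover have "thr_size \<sigma> k (\<tau> k) = thr_size \<rho> k (\<tau> k)" for k
    by (simp add: thr_size_def \<rho>_def)
  moreover have "(\<Sum>k\<in>{1..<n}. int (thr_size \<sigma> k (\<tau> (Suc k)))) = (\<Sum>k\<in>{1..<n}. int (thr_size \<rho> k (\<tau> (Suc k))))"
    using mono by (intro sum.cong) (auto simp: thr_size_def \<rho>_def)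
  moreover have "(\<Sum>k=1..n. int (rdown (w k) (\<rho> k))) \<le> (\<Sum>k=1..n. int (rdown (v k) (\<sigma> k)))"
    using R1 R2 by (intro sum_mono) simp
  ultimately show "weight \<sigma> B \<le> (\<Sum>k=1..n. rdown (w k - (d (\<tau> k) - 1)) (\<sigma> k))"
    unfolding v_def by (simp flip: of_nat_sum)
qed

end

section \<open>Monomial ideals\<close>

lemma poly_ring_simps [simp]:
  "monoid.mult (poly_ring n) = (*)" "monoid.one (poly_ring n) = 1"
  "ring.zero (poly_ring n) = 0" "ring.add (poly_ring n) = (+)"
  by (simp_all add: poly_ring_def)

lemma pmonom_carrier [simp]:
  "(pmonom m :: ('k::field) mpol) \<in> carrier (poly_ring n) \<longleftrightarrow> Poly_Mapping.keys m \<subseteq> {1..n}"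
  by (simp add: poly_ring_def pmonom_def)

lemma keys_pmonom [simp]: "Poly_Mapping.keys (pmonom m :: ('k::field) mpol) = {m}"
  by (simp add: pmonom_def)

lemma pmonom_mult: "pmonom a * pmonom b = (pmonom (a + b) :: ('k::field) mpol)"
  by (simp add: pmonom_def mult_single)

lemma carrier_keys: "p \<in> carrier (poly_ring n) \<Longrightarrow> m \<in> Poly_Mapping.keys p \<Longrightarrow> Poly_Mapping.keys m \<subseteq> {1..n}"
  by (simp add: poly_ring_def)

lemma keys_add_nat: "Poly_Mapping.keys (a + b) = Poly_Mapping.keys a \<union> Poly_Mapping.keys (b :: nat \<Rightarrow>\<^sub>0 nat)"
  by (auto simp: in_keys_iff lookup_add)

lemma sum_monomials:
  "(\<Sum>m\<in>Poly_Mapping.keys f. Poly_Mapping.single m (Poly_Mapping.lookup f m)) = f"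
  by (rule poly_mapping_eqI) (simp add: lookup_sum lookup_single when_def in_keys_iff)

lemma ideal_memI:
  fixes p :: "('k::field) mpol"
  assumes "ideal I (poly_ring n)" "\<And>m. m \<in> Poly_Mapping.keys p \<Longrightarrow> pmonom m \<in> I"
  shows "p \<in> I"
proof -
  interpret I: ideal I "poly_ring n" by (rule assms(1))
  have zero: "0 \<in> I" using additive_subgroup.zero_closed[OF ideal.axioms(1)[OF assms(1)]] by simp
  have plus: "a + b \<in> I" if "a \<in> I" "b \<in> I" for a b
    using additive_subgroup.a_closed[OF ideal.axioms(1)[OF assms(1)] that] by simp
  have terms: "Poly_Mapping.single m (Poly_Mapping.lookup p m) \<in> I" if "m \<in> Poly_Mapping.keys p" for m
  proof -
    have "Poly_Mapping.single 0 (Poly_Mapping.lookup p m) \<in> carrier (poly_ring n)"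
      by (simp add: poly_ring_def)
    from I.I_l_closed[OF assms(2)[OF that] this]
    show ?thesis by (simp add: pmonom_def mult_single)
  qed
  have "(\<Sum>m\<in>A. Poly_Mapping.single m (Poly_Mapping.lookup p m)) \<in> I"
    if "finite A" "A \<subseteq> Poly_Mapping.keys p" for A
    using that by (induction A rule: finite_induct) (auto simp: zero plus terms)
  from this[of "Poly_Mapping.keys p"] show ?thesis by (simp add: sum_monomials)
qed

text \<open>
  The polynomials all of whose exponent vectors lie in \<open>E\<close>. Membership of exponent vectors that involve
  variables outside \<open>{1..n}\<close> is irrelevant, which permits sets \<open>E\<close> closed under addition of arbitrary
  exponent vectors.
\<close>

definition mspan :: "nat \<Rightarrow> (nat \<Rightarrow>\<^sub>0 nat) set \<Rightarrow> ('k::field) mpol set" where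
  "mspan n E = {p \<in> carrier (poly_ring n). Poly_Mapping.keys p \<subseteq> E}"

text \<open>
  The sets of exponent vectors for which \<open>mspan n E\<close> is an ideal.
\<close>

definition up_closed :: "(nat \<Rightarrow>\<^sub>0 nat) set \<Rightarrow> bool" where
  "up_closed E \<longleftrightarrow> (\<forall>m\<in>E. \<forall>a. a + m \<in> E)"

lemma pmonom_mspan:
  "(pmonom m :: ('k::field) mpol) \<in> mspan n E \<longleftrightarrow> Poly_Mapping.keys m \<subseteq> {1..n} \<and> m \<in> E"
  by (simp add: mspan_def)

lemma ideal_mspan:
  assumes "up_closed E"
  shows "ideal (mspan n E :: ('k::field) mpol set) (poly_ring n)"
proof -
  interpret S: cring "poly_ring n :: 'k mpol ring" by (rule cring_poly_ring)
  have mult: "g * f \<in> mspan n E" if f: "f \<in> mspan n E" and g: "g \<in> carrier (poly_ring n)" for f g :: "'k mpol"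
  proof -
    have "m \<in> E" if m: "m \<in> Poly_Mapping.keys (g * f)" for m
    proof -
      obtain a b where "m = a + b" "b \<in> Poly_Mapping.keys f" using keys_mult[of g f] m by blast
      then show ?thesis using f assms unfolding mspan_def up_closed_def by blast
    qed
    then show ?thesis using f g carrier_poly_ring_mult[of g n f] by (auto simp: mspan_def)
  qed
  have one: "-1 \<in> carrier (poly_ring n :: 'k mpol ring)" by (auto simp: poly_ring_def)
  show ?thesis
  proof (rule idealI)
    show "ring (poly_ring n :: 'k mpol ring)" by (rule S.ring_axioms)
    show "subgroup (mspan n E) (add_monoid (poly_ring n :: 'k mpol ring))"
    proof (rule S.add.subgroupI)
      show "mspan n E \<subseteq> carrier (poly_ring n)" by (auto simp: mspan_def)
      have "0 \<in> mspan n E" by (simp add: mspan_def poly_ring_def)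
      then show "mspan n E \<noteq> {}" by blast
    next
      fix f :: "'k mpol" assume f: "f \<in> mspan n E"
      have m: "- f \<in> mspan n E" using mult[OF f one] by simp
      have "\<ominus>\<^bsub>poly_ring n\<^esub> f = - f"
        by (rule S.minus_equality) (use f m in \<open>auto simp: mspan_def\<close>)
      then show "\<ominus>\<^bsub>poly_ring n\<^esub> f \<in> mspan n E" using m by simp
    next
      fix f g :: "'k mpol" assume "f \<in> mspan n E" "g \<in> mspan n E"
      then show "f \<oplus>\<^bsub>poly_ring n\<^esub> g \<in> mspan n E"
        using keys_add[of f g] carrier_poly_ring_add[of f n g] by (auto simp: mspan_def)
    qed
  next
    fix a x :: "'k mpol"
    assume "a \<in> mspan n E" "x \<in> carrier (poly_ring n)"
    then show "x \<otimes>\<^bsub>poly_ring n\<^esub> a \<in> mspan n E" "a \<otimes>\<^bsub>poly_ring n\<^esub> x \<in> mspan n E"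
      using mult[of a x] by (simp_all add: mult.commute)
  qed
qed

lemma genideal_pmonom:
  assumes "\<And>m. m \<in> M \<Longrightarrow> Poly_Mapping.keys m \<subseteq> {1..n}"
  shows "Idl\<^bsub>poly_ring n\<^esub> (pmonom ` M :: ('k::field) mpol set) = mspan n {c + a |a c. a \<in> M}"
proof
  interpret S: cring "poly_ring n :: 'k mpol ring" by (rule cring_poly_ring)
  have MS: "pmonom ` M \<subseteq> carrier (poly_ring n :: 'k mpol ring)" using assms by auto
  have up: "up_closed {c + a |a c. a \<in> M}"
    unfolding up_closed_def by clarsimp (metis add.assoc)
  show "Idl\<^bsub>poly_ring n\<^esub> (pmonom ` M :: 'k mpol set) \<subseteq> mspan n {c + a |a c. a \<in> M}"
  proof (rule S.genideal_minimal[OF ideal_mspan[OF up]])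
    have "m \<in> {c + a |a c. a \<in> M}" if "m \<in> M" for m
      using that by (metis (mono_tags, lifting) add_0 mem_Collect_eq)
    then show "pmonom ` M \<subseteq> (mspan n {c + a |a c. a \<in> M} :: 'k mpol set)"
      using assms by (auto simp only: pmonom_mspan)
  qed
  interpret G: ideal "Idl\<^bsub>poly_ring n\<^esub> (pmonom ` M :: 'k mpol set)" "poly_ring n"
    by (rule S.genideal_ideal[OF MS])
  show "mspan n {c + a |a c. a \<in> M} \<subseteq> Idl\<^bsub>poly_ring n\<^esub> (pmonom ` M :: 'k mpol set)"
  proof
    fix p :: "'k mpol" assume p: "p \<in> mspan n {c + a |a c. a \<in> M}"
    show "p \<in> Idl\<^bsub>poly_ring n\<^esub> (pmonom ` M)"
    proof (rule ideal_memI[OF G.ideal_axioms])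
      fix m assume m: "m \<in> Poly_Mapping.keys p"
      then obtain a c where ac: "m = c + a" "a \<in> M" using p unfolding mspan_def by blast
      have "Poly_Mapping.keys m \<subseteq> {1..n}" using p m carrier_keys unfolding mspan_def by blast
      then have "(pmonom c :: 'k mpol) \<in> carrier (poly_ring n)" using ac by (auto simp: keys_add_nat)
      moreover have "pmonom a \<in> Idl\<^bsub>poly_ring n\<^esub> (pmonom ` M :: 'k mpol set)"
        using S.genideal_self[OF MS] ac by auto
      ultimately have "pmonom c \<otimes>\<^bsub>poly_ring n\<^esub> pmonom a \<in> Idl\<^bsub>poly_ring n\<^esub> (pmonom ` M :: 'k mpol set)"
        by (intro G.I_l_closed)
      then show "pmonom m \<in> Idl\<^bsub>poly_ring n\<^esub> (pmonom ` M :: 'k mpol set)"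
        using ac by (simp add: pmonom_mult)
    qed
  qed
qed

lemma ideal_prod_mspan:
  assumes "up_closed E" "up_closed F"
  shows "ideal_prod (poly_ring n) (mspan n E) (mspan n F) = (mspan n {a + b |a b. a \<in> E \<and> b \<in> F} :: ('k::field) mpol set)"
proof
  interpret S: cring "poly_ring n :: 'k mpol ring" by (rule cring_poly_ring)
  note id = S.ideal_prod_is_ideal[OF ideal_mspan[OF assms(1)] ideal_mspan[OF assms(2)]]
  show "ideal_prod (poly_ring n) (mspan n E) (mspan n F) \<subseteq> (mspan n {a + b |a b. a \<in> E \<and> b \<in> F} :: 'k mpol set)"
  proof
    fix p :: "'k mpol" assume "p \<in> ideal_prod (poly_ring n) (mspan n E) (mspan n F)"
    then show "p \<in> mspan n {a + b |a b. a \<in> E \<and> b \<in> F}"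
    proof (induction p rule: ideal_prod.induct)
      case (prod i j)
      then show ?case
        using keys_mult[of i j] carrier_poly_ring_mult[of i n j] unfolding mspan_def by fastforce
    next
      case (sum s1 s2)
      then show ?case
        using keys_add[of s1 s2] carrier_poly_ring_add[of s1 n s2] unfolding mspan_def
        by (simp add: subset_iff) blast
    qed
  qed
  show "mspan n {a + b |a b. a \<in> E \<and> b \<in> F} \<subseteq> ideal_prod (poly_ring n) (mspan n E) (mspan n F :: 'k mpol set)"
  proof
    fix p :: "'k mpol" assume p: "p \<in> mspan n {a + b |a b. a \<in> E \<and> b \<in> F}"
    show "p \<in> ideal_prod (poly_ring n) (mspan n E) (mspan n F)"
    proof (rule ideal_memI[OF id])
      fix m assume m: "m \<in> Poly_Mapping.keys p"
      then obtain a b where ab: "m = a + b" "a \<in> E" "b \<in> F" using p unfolding mspan_def by blast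
      have "Poly_Mapping.keys m \<subseteq> {1..n}" using p m carrier_keys unfolding mspan_def by blast
      then have "(pmonom a :: 'k mpol) \<in> mspan n E" "(pmonom b :: 'k mpol) \<in> mspan n F"
        using ab by (auto simp: keys_add_nat pmonom_mspan)
      from ideal_prod.prod[OF this, of "poly_ring n"]
      show "(pmonom m :: 'k mpol) \<in> ideal_prod (poly_ring n) (mspan n E) (mspan n F)"
        using ab by (simp add: pmonom_mult)
    qed
  qed
qed

lemma X_power: "X l ^ e = (pmonom (Poly_Mapping.single l e) :: ('k::field) mpol)"
proof (induction e)
  case 0
  then show ?case by (simp add: pmonom_def)
next
  case (Suc e)
  have "Poly_Mapping.single l (1::nat) + Poly_Mapping.single l e = Poly_Mapping.single l (Suc e)"
    by (simp add: single_add[symmetric])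
  then show ?case using Suc by (simp add: X_def pmonom_mult)
qed

lemma frob_ideal_eq:
  assumes "l \<le> n"
  shows "frob_ideal n l e = (mspan n {m. \<exists>k\<in>{1..l}. e \<le> Poly_Mapping.lookup m k} :: ('k::field) mpol set)"
proof -
  have "frob_ideal n l e = Idl\<^bsub>poly_ring n\<^esub> (pmonom ` (\<lambda>k. Poly_Mapping.single k e) ` {1..l} :: 'k mpol set)"
    by (simp add: frob_ideal_def X_power image_image)
  also have "\<dots> = mspan n {c + a |a c. a \<in> (\<lambda>k. Poly_Mapping.single k e) ` {1..l}}"
    using assms by (intro genideal_pmonom) (auto split: if_splits)
  also have "{c + a |a c. a \<in> (\<lambda>k. Poly_Mapping.single k e) ` {1..l}} = {m. \<exists>k\<in>{1..l}. e \<le> Poly_Mapping.lookup m k}"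
  proof (intro equalityI subsetI)
    fix m assume "m \<in> {m. \<exists>k\<in>{1..l}. e \<le> Poly_Mapping.lookup m k}"
    then obtain k where k: "k \<in> {1..l}" "e \<le> Poly_Mapping.lookup m k" by auto
    have "m = (m - Poly_Mapping.single k e) + Poly_Mapping.single k e"
      using k(2) by (intro poly_mapping_eqI) (auto simp: lookup_add lookup_minus lookup_single when_def)
    then show "m \<in> {c + a |a c. a \<in> (\<lambda>k. Poly_Mapping.single k e) ` {1..l}}" using k(1) by blast
  qed (force simp: lookup_add)
  finally show ?thesis .
qed

lemma finsum_ideals:
  fixes f :: "'a \<Rightarrow> ('k::field) mpol set"
  assumes "finite A" "\<And>x. x \<in> A \<Longrightarrow> ideal (f x) (poly_ring n)"
  shows "ideal (finsum (ideals n) f A) (poly_ring n)"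
    and "\<And>x. x \<in> A \<Longrightarrow> f x \<subseteq> finsum (ideals n) f A"
    and "\<And>C. ideal C (poly_ring n) \<Longrightarrow> (\<And>x. x \<in> A \<Longrightarrow> f x \<subseteq> C) \<Longrightarrow> finsum (ideals n) f A \<subseteq> C"
proof -
  interpret S: cring "poly_ring n :: 'k mpol ring" by (rule cring_poly_ring)
  interpret M: semiring "ideals n :: 'k mpol set ring" by (rule S.ideals_set_is_semiring)
  have "ideal (finsum (ideals n) f A) (poly_ring n) \<and> (\<forall>x\<in>A. f x \<subseteq> finsum (ideals n) f A) \<and>
    (\<forall>C. ideal C (poly_ring n) \<longrightarrow> (\<forall>x\<in>A. f x \<subseteq> C) \<longrightarrow> finsum (ideals n) f A \<subseteq> C)"
    using assms
  proof (induction A rule: finite_induct)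
    case empty
    have z: "finsum (ideals n) f {} = {0}" by (simp add: ideals_set_def[of "poly_ring n :: 'k mpol ring"] M.finsum_empty[unfolded ideals_set_def, simplified])
    show ?case unfolding z using S.zeroideal additive_subgroup.zero_closed[OF ideal.axioms(1)] by fastforce
  next
    case (insert x F)
    define g where "g = finsum (ideals n) f F"
    have g: "ideal g (poly_ring n)" "\<And>y. y \<in> F \<Longrightarrow> f y \<subseteq> g"
      "\<And>C. ideal C (poly_ring n) \<Longrightarrow> (\<And>x. x \<in> F \<Longrightarrow> f x \<subseteq> C) \<Longrightarrow> g \<subseteq> C"
      using insert unfolding g_def by auto
    have fx: "ideal (f x) (poly_ring n)" using insert by simp
    have "finsum (ideals n) f (insert x F) = f x \<oplus>\<^bsub>ideals n\<^esub> g"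
      unfolding g_def using insert by (intro M.finsum_insert) (auto simp: ideals_set_def)
    also have "\<dots> = f x <+>\<^bsub>poly_ring n\<^esub> g" by (simp add: ideals_set_def)
    finally have eq: "finsum (ideals n) f (insert x F) = f x <+>\<^bsub>poly_ring n\<^esub> g" .
    have mem: "p \<in> f x <+>\<^bsub>poly_ring n\<^esub> g \<longleftrightarrow> (\<exists>a\<in>f x. \<exists>b\<in>g. p = a + b)" for p
      by (auto simp: set_add_def')
    have z: "0 \<in> f x" "0 \<in> g"
      using additive_subgroup.zero_closed[OF ideal.axioms(1)[OF fx]] additive_subgroup.zero_closed[OF ideal.axioms(1)[OF g(1)]]
      by auto
    show ?case unfolding eq
    proof (intro conjI ballI allI impI)
      show "ideal (f x <+>\<^bsub>poly_ring n\<^esub> g) (poly_ring n)" by (rule S.add_ideals[OF fx g(1)])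
      fix y assume "y \<in> insert x F"
      then have "f y \<subseteq> f x \<or> f y \<subseteq> g" using g(2) by auto
      moreover have "p = p + 0" "p = 0 + p" for p :: "'k mpol" by auto
      ultimately show "f y \<subseteq> f x <+>\<^bsub>poly_ring n\<^esub> g" using z unfolding subset_iff mem by metis
    next
      fix C assume C: "ideal C (poly_ring n)" "\<forall>y\<in>insert x F. f y \<subseteq> C"
      have "g \<subseteq> C" using g(3)[OF C(1)] C(2) by simp
      then show "f x <+>\<^bsub>poly_ring n\<^esub> g \<subseteq> C"
        using C additive_subgroup.a_closed[OF ideal.axioms(1)[OF C(1)]] unfolding subset_iff mem by fastforce
    qed
  qed
  then show "ideal (finsum (ideals n) f A) (poly_ring n)" "\<And>x. x \<in> A \<Longrightarrow> f x \<subseteq> finsum (ideals n) f A"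
    "\<And>C. ideal C (poly_ring n) \<Longrightarrow> (\<And>x. x \<in> A \<Longrightarrow> f x \<subseteq> C) \<Longrightarrow> finsum (ideals n) f A \<subseteq> C"
    by blast+
qed

lemma lookup_pmonom_mult:
  "Poly_Mapping.lookup (pmonom a * f) (a + m) = Poly_Mapping.lookup (f :: ('k::field) mpol) m"
proof -
  have "pmonom a * f = (\<Sum>x\<in>Poly_Mapping.keys f. Poly_Mapping.single (a + x) (Poly_Mapping.lookup f x))"
    by (subst sum_monomials[of f, symmetric]) (simp add: sum_distrib_left pmonom_def mult_single)
  then show ?thesis by (simp add: lookup_sum lookup_single when_def in_keys_iff)
qed

section \<open>Ideals of packable exponents\<close>

context packing begin

text \<open>
  The product of the ideals \<open>frob_ideal n p (d j)\<close> over the pieces \<open>(p, j)\<close> of \<open>M\<close>; see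
  \<open>frob_ideal_pack\<close> and \<open>pack_ideal_union\<close>.
\<close>

definition pack_ideal :: "(nat \<times> nat) multiset \<Rightarrow> ('k::field) mpol set" where
  "pack_ideal M = mspan n {m. packs M (Poly_Mapping.lookup m)}"

text \<open>
  The range of the pieces.
\<close>

definition pieces :: "(nat \<times> nat) set" where
  "pieces = {1..n} \<times> {..s}"

lemma up_closed_packs: "up_closed {m. packs M (Poly_Mapping.lookup m)}"
  unfolding up_closed_def by (auto simp: lookup_add intro: packs_mono)

lemma ideal_pack_ideal: "ideal (pack_ideal M) (poly_ring n)"
  unfolding pack_ideal_def by (rule ideal_mspan[OF up_closed_packs])

lemma pack_ideal_empty: "pack_ideal {#} = carrier (poly_ring n)"
  by (simp add: pack_ideal_def mspan_def)

lemma packs_split_exponent: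
  assumes "set_mset N \<subseteq> pieces" "packs (M + N) (Poly_Mapping.lookup m)"
  shows "\<exists>a b. m = a + b \<and> packs M (Poly_Mapping.lookup a) \<and> packs N (Poly_Mapping.lookup b)"
proof -
  obtain v where v: "\<forall>k. v k \<le> Poly_Mapping.lookup m k" "packs M v" "packs N (\<lambda>k. Poly_Mapping.lookup m k - v k)"
    using packs_split assms unfolding pieces_def by blast
  define a where "a = Abs_poly_mapping v"
  have "{k. v k \<noteq> 0} \<subseteq> {k. Poly_Mapping.lookup m k \<noteq> 0}" using v(1) by (auto intro: less_le_trans)
  then have "finite {k. v k \<noteq> 0}" by (rule finite_subset) simp
  then have a: "Poly_Mapping.lookup a = v" by (simp add: a_def)
  show ?thesis
  proof (intro exI conjI)
    show "m = a + (m - a)" using v(1) by (intro poly_mapping_eqI) (simp add: lookup_add lookup_minus a)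
    have "Poly_Mapping.lookup (m - a) = (\<lambda>k. Poly_Mapping.lookup m k - v k)"
      by (auto simp: lookup_minus a)
    then show "packs N (Poly_Mapping.lookup (m - a))" using v(3) by simp
  qed (simp add: a v)
qed

lemma pack_ideal_union:
  assumes "set_mset N \<subseteq> pieces"
  shows "pack_ideal (M + N) = pack_ideal M \<otimes>\<^bsub>ideals n\<^esub> (pack_ideal N :: ('k::field) mpol set)"
proof -
  have "{a + b |a b. a \<in> {m. packs M (Poly_Mapping.lookup m)} \<and> b \<in> {m. packs N (Poly_Mapping.lookup m)}}
     = {m. packs (M + N) (Poly_Mapping.lookup m)}"
  proof (intro equalityI subsetI)
    fix m assume "m \<in> {m. packs (M + N) (Poly_Mapping.lookup m)}"
    then show "m \<in> {a + b |a b. a \<in> {m. packs M (Poly_Mapping.lookup m)} \<and> b \<in> {m. packs N (Poly_Mapping.lookup m)}}"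
      using packs_split_exponent[OF assms] by auto
  next
    fix m assume "m \<in> {a + b |a b. a \<in> {m. packs M (Poly_Mapping.lookup m)} \<and> b \<in> {m. packs N (Poly_Mapping.lookup m)}}"
    then obtain a b where ab: "m = a + b" "packs M (Poly_Mapping.lookup a)" "packs N (Poly_Mapping.lookup b)" by auto
    have "Poly_Mapping.lookup m = (\<lambda>k. Poly_Mapping.lookup a k + Poly_Mapping.lookup b k)"
      using ab(1) by (auto simp: lookup_add)
    then show "m \<in> {m. packs (M + N) (Poly_Mapping.lookup m)}"
      using packs_union[OF ab(2,3)] by simp
  qed
  then show ?thesis
    unfolding pack_ideal_def
    by (simp add: ideals_set_def ideal_prod_mspan[OF up_closed_packs[of M] up_closed_packs[of N], of n])
qed

lemma frob_ideal_pack: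
  assumes "p \<in> {1..n}" "j \<le> s"
  shows "frob_ideal n p (d j) = pack_ideal {#(p, j)#}"
  unfolding pack_ideal_def using assms by (simp add: frob_ideal_eq packs_single)

lemma ideals_comm_monoid: "Group.comm_monoid (ideals n :: ('k::field) mpol set ring)"
  using cring.ideals_set_is_comm_monoid[OF cring_poly_ring] .

lemma finprod_pack_ideal:
  assumes "finite A" "\<And>x. x \<in> A \<Longrightarrow> set_mset (g x) \<subseteq> pieces"
    "\<And>x. x \<in> A \<Longrightarrow> f x = (pack_ideal (g x) :: ('k::field) mpol set)"
  shows "finprod (ideals n) f A = pack_ideal (\<Sum>x\<in>A. g x)"
proof -
  interpret C: Group.comm_monoid "ideals n :: 'k mpol set ring" by (rule ideals_comm_monoid)
  have ca: "pack_ideal M \<in> carrier (ideals n :: 'k mpol set ring)" for M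
    using ideal_pack_ideal by (simp add: ideals_set_def)
  have "finprod (ideals n) f A = finprod (ideals n) (\<lambda>x. pack_ideal (g x)) A"
    using assms(3) ca by (intro C.finprod_cong') auto
  also have "\<dots> = pack_ideal (\<Sum>x\<in>A. g x)"
    using assms(1,2)
  proof (induction A rule: finite_induct)
    case empty
    have "\<one>\<^bsub>ideals n :: 'k mpol set ring\<^esub> = carrier (poly_ring n)" by (simp add: ideals_set_def)
    then show ?case by (simp add: pack_ideal_empty)
  next
    case (insert x F)
    have "set_mset (\<Sum>x\<in>F. g x) \<subseteq> pieces"
      using insert.prems insert.hyps(1) by (auto simp: set_mset_sum)
    then have "pack_ideal (\<Sum>x\<in>insert x F. g x) = pack_ideal (g x) \<otimes>\<^bsub>ideals n\<^esub> (pack_ideal (\<Sum>x\<in>F. g x) :: 'k mpol set)"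
      using insert.hyps by (simp add: pack_ideal_union)
    then show ?case using insert ca by simp
  qed
  finally show ?thesis .
qed

lemma frob_ideal_pow_pack:
  assumes "p \<in> {1..n}" "j \<le> s"
  shows "frob_ideal n p (d j) [^]\<^bsub>ideals n\<^esub> (c::nat) = (pack_ideal (replicate_mset c (p, j)) :: ('k::field) mpol set)"
proof (induction c)
  case 0
  then show ?case by (simp add: pack_ideal_empty ideals_set_def nat_pow_def)
next
  case (Suc c)
  have "{#(p, j)#} + replicate_mset c (p, j) = replicate_mset (Suc c) (p, j)" by simp
  moreover have "set_mset {#(p, j)#} \<subseteq> pieces" using assms by (auto simp: pieces_def)
  ultimately show ?case
    using Suc pack_ideal_union[of "{#(p, j)#}" "replicate_mset c (p, j)", where 'k = 'k]
    by (simp add: nat_pow_def frob_ideal_pack[OF assms])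
qed


section \<open>The principal d-fixed ideal as a product\<close>

lemma is_decomp_decomp: "is_decomp d s a (decomp d s a)"
  unfolding decomp_def by (rule theI'[OF ex1_decomp[OF d_seq]])

lemma decomp_eqI: "is_decomp d s a c \<Longrightarrow> decomp d s a = c"
  using ex1_decomp[OF d_seq, of a] is_decomp_decomp by blast

lemma sum_decomp: "(\<Sum>j\<le>s. decomp d s a j * d j) = a"
  using is_decomp_decomp[of a] by (simp add: is_decomp_def)

lemma digit_sum_le:
  assumes "x \<le> y" "y \<le> s"
  shows "(\<Sum>j=x..<y. decomp d s a j * d j) + d x \<le> d y"
  using assms
proof (induction y rule: dec_induct)
  case (step y)
  have y: "y < s" using step by simp
  have "decomp d s a y < d (Suc y) div d y" using is_decomp_decomp[of a] y by (simp add: is_decomp_def)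
  then have "(decomp d s a y + 1) * d y \<le> d (Suc y) div d y * d y" by (intro mult_le_mono1) simp
  moreover have "d (Suc y) div d y * d y = d (Suc y)" using d_dvd[of y "Suc y"] y by simp
  ultimately show ?case using step by simp
qed simp

lemma decomp_d:
  assumes "j \<le> s"
  shows "decomp d s (d j) = (\<lambda>l. if l = j then 1 else 0)"
proof (rule decomp_eqI)
  have "1 < d (Suc t) div d t" if "t < s" for t
  proof -
    have "d t < d (Suc t)" "d t dvd d (Suc t)" using d_seq that by (auto simp: d_sequence_def)
    then show ?thesis by (auto elim!: dvdE)
  qed
  moreover have "0 < d (Suc t) div d t" if "t < s" for t
    using d_mono[of t "Suc t"] d_pos[of t] that by (simp add: div_greater_zero_iff)
  moreover have "(\<Sum>t\<le>s. (if t = j then 1 else 0) * d t) = d j"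
    using assms by (simp add: if_distrib[of "\<lambda>x. x * _"] cong: if_cong)
  ultimately show "is_decomp d s (d j) (\<lambda>l. if l = j then 1 else 0)"
    unfolding is_decomp_def using assms by simp
qed

lemma sum_fun_upd:
  fixes f g :: "'a \<Rightarrow> nat"
  assumes "finite A" "j \<in> A"
  shows "(\<Sum>l\<in>A. (f(j := x)) l * g l) + f j * g j = (\<Sum>l\<in>A. f l * g l) + x * g j"
proof -
  have "(\<Sum>l\<in>A - {j}. (f(j := x)) l * g l) = (\<Sum>l\<in>A - {j}. f l * g l)"
    by (intro sum.cong) auto
  then show ?thesis using assms by (simp add: sum.remove)
qed

text \<open>
  Let \<open>b = (\<Sum>j\<le>s. c j * d j)\<close> with arbitrary multiplicities \<open>c\<close>. A number given by digits bounded by the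
  digits of \<open>b\<close> is the total size of a subfamily. If \<open>c\<close> itself is not the decomposition of \<open>b\<close>, then
  \<open>R = d (Suc j) div d j\<close> pieces of level \<open>j\<close> can be glued to one of level \<open>Suc j\<close>; a subfamily using the
  glued piece is taken apart again.
\<close>

lemma subsum_of_digits:
  assumes "\<And>j. j \<le> s \<Longrightarrow> e j \<le> decomp d s (\<Sum>j\<le>s. c j * d j) j"
  shows "\<exists>c'. (\<forall>j\<le>s. c' j \<le> c j) \<and> (\<Sum>j\<le>s. c' j * d j) = (\<Sum>j\<le>s. e j * d j)"
  using assms
proof (induction "\<Sum>j\<le>s. c j" arbitrary: c rule: less_induct)
  case less
  show ?case
  proof (cases "\<forall>j<s. c j < d (Suc j) div d j")
    case True
    have "is_decomp d s (\<Sum>j\<le>s. c j * d j) (\<lambda>j. if j \<le> s then c j else 0)"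
      using True by (auto simp: is_decomp_def)
    then have "decomp d s (\<Sum>j\<le>s. c j * d j) = (\<lambda>j. if j \<le> s then c j else 0)" by (rule decomp_eqI)
    then show ?thesis using less.prems by (intro exI[of _ e]) simp
  next
    case False
    then obtain j where j: "j < s" "d (Suc j) div d j \<le> c j" by (auto simp: not_less)
    define R where "R = d (Suc j) div d j"
    have dj: "d j < d (Suc j)" "d j dvd d (Suc j)" using d_seq j by (auto simp: d_sequence_def)
    then have Rd: "R * d j = d (Suc j)" by (simp add: R_def)
    have "R \<noteq> 0" "R \<noteq> 1" using Rd dj(1) by (intro notI; simp)+
    then have R: "1 < R" by simp
    define c1 where "c1 = c(j := c j - R, Suc j := c (Suc j) + 1)"
    have in_s: "j \<in> {..s}" "Suc j \<in> {..s}" using j by auto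
    have upd2: "(\<Sum>l\<le>s. (f(j := x, Suc j := y)) l * g l) + f j * g j + f (Suc j) * g (Suc j)
        = (\<Sum>l\<le>s. f l * g l) + x * g j + y * g (Suc j)" for f g :: "nat \<Rightarrow> nat" and x y
      using sum_fun_upd[OF _ in_s(1), of f x g] sum_fun_upd[OF _ in_s(2), of "f(j := x)" y g] by simp
    have "(c j - R) * d j + R * d j = c j * d j"
      unfolding add_mult_distrib[symmetric] using j(2) by (simp add: R_def)
    then have s1: "(\<Sum>l\<le>s. c1 l * d l) = (\<Sum>l\<le>s. c l * d l)"
      using upd2[of c "c j - R" "c (Suc j) + 1" d] Rd unfolding c1_def by simp
    have "(\<Sum>l\<le>s. c1 l) < (\<Sum>l\<le>s. c l)"
      using upd2[of c "c j - R" "c (Suc j) + 1" "\<lambda>_. 1"] R j(2) unfolding c1_def R_def by simp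
    from less.hyps[OF this] obtain c' where c': "\<forall>l\<le>s. c' l \<le> c1 l" "(\<Sum>j\<le>s. c' j * d j) = (\<Sum>j\<le>s. e j * d j)"
      using less.prems unfolding s1 by blast
    show ?thesis
    proof (cases "c' (Suc j) \<le> c (Suc j)")
      case True
      have "c' l \<le> c l" if "l \<le> s" for l
        using c'(1)[rule_format, OF that] True by (auto simp: c1_def split: if_splits)
      then show ?thesis using c'(2) by blast
    next
      case False
      then have cS: "c' (Suc j) = c (Suc j) + 1" using c'(1)[rule_format, of "Suc j"] j by (simp add: c1_def)
      have cj: "c' j + R \<le> c j" using c'(1)[rule_format, of j] j by (simp add: c1_def R_def)
      show ?thesis
      proof (intro exI[of _ "c'(j := c' j + R, Suc j := c (Suc j))"] conjI allI impI)
        fix l assume "l \<le> s"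
        then show "(c'(j := c' j + R, Suc j := c (Suc j))) l \<le> c l"
          using c'(1)[rule_format, of l] cj by (auto simp: c1_def)
      next
        show "(\<Sum>l\<le>s. (c'(j := c' j + R, Suc j := c (Suc j))) l * d l) = (\<Sum>j\<le>s. e j * d j)"
          using upd2[of c' "c' j + R" "c (Suc j)" d] c'(2) Rd cS by (simp add: add_mult_distrib)
      qed
    qed
  qed
qed

text \<open>
  The content of bin \<open>i\<close>, including its free space regarded as pieces of size \<open>d 0 = 1\<close>, has a
  subfamily of total size \<open>t\<close>, which moves to bin \<open>j\<close>.
\<close>

lemma packs_move:
  assumes "packs M w" "le_d d s t (w i)" "1 \<le> j" "j < i" "i \<le> n"
  shows "packs M (w(j := w j + t, i := w i - t))"
proof -
  obtain y where y: "\<And>k. k\<in>{1..n} \<Longrightarrow> (\<Sum>j\<le>s. y k j * d j) \<le> w k"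
     "\<And>m j. m\<in>{1..n} \<Longrightarrow> j\<le>s \<Longrightarrow> (\<Sum>k=1..m. count M (k, j)) \<le> (\<Sum>k=1..m. y k j)"
    using assms(1) unfolding packs_def by blast
  have iin: "i \<in> {1..n}" "j \<in> {1..n}" using assms by auto
  define c where "c = (y i)(0 := y i 0 + (w i - (\<Sum>l\<le>s. y i l * d l)))"
  have d0: "d 0 = 1" using d_seq by (simp add: d_sequence_def)
  have sc: "(\<Sum>l\<le>s. c l * d l) = w i"
    using sum_fun_upd[of "{..s}" 0 "y i" "y i 0 + (w i - (\<Sum>l\<le>s. y i l * d l))" d] y(1)[OF iin(1)] d0
    unfolding c_def by simp
  obtain c' where c': "\<forall>l\<le>s. c' l \<le> c l" "(\<Sum>l\<le>s. c' l * d l) = t"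
    using subsum_of_digits[of "decomp d s t" c] assms(2) unfolding sc sum_decomp le_d_def by blast
  define z where "z = (\<lambda>l. min (c' l) (y i l))"
  have zt: "(\<Sum>l\<le>s. z l * d l) \<le> t"
    unfolding c'(2)[symmetric] by (intro sum_mono mult_le_mono1) (simp add: z_def)
  have zr: "(\<Sum>l\<le>s. (y i l - z l) * d l) \<le> w i - t"
  proof -
    have "(\<Sum>l\<le>s. (y i l - z l) * d l) \<le> (\<Sum>l\<le>s. (c l - c' l) * d l)"
      using c'(1) by (intro sum_mono mult_le_mono1) (auto simp: z_def c_def)
    moreover have "(\<Sum>l\<le>s. (c l - c' l) * d l) + (\<Sum>l\<le>s. c' l * d l) = (\<Sum>l\<le>s. c l * d l)"
      unfolding sum.distrib[symmetric] using c'(1) by (intro sum.cong) (auto simp: add_mult_distrib[symmetric])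
    ultimately show ?thesis using sc c'(2) by linarith
  qed
  define y' where "y' = y(j := \<lambda>l. y j l + z l, i := \<lambda>l. y i l - z l)"
  show ?thesis
    unfolding packs_def
  proof (intro exI[of _ y'] conjI ballI allI impI)
    fix k assume k: "k \<in> {1..n}"
    show "(\<Sum>l\<le>s. y' k l * d l) \<le> (w(j := w j + t, i := w i - t)) k"
      using y(1)[OF k] zt zr assms(4) by (auto simp: y'_def add_mult_distrib sum.distrib)
  next
    fix m l assume m: "m \<in> {1..n}" and l: "l \<le> s"
    have "(\<Sum>k=1..m. y' k l + (if k = i then z l else 0)) = (\<Sum>k=1..m. y k l + (if k = j then z l else 0))"
      using assms(4) by (intro sum.cong) (auto simp: y'_def z_def)
    then have "(\<Sum>k=1..m. y k l) \<le> (\<Sum>k=1..m. y' k l)"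
      using iin assms(4) by (auto simp: sum.distrib sum.delta split: if_splits)
    then show "(\<Sum>k=1..m. count M (k, l)) \<le> (\<Sum>k=1..m. y' k l)" using y(2)[OF m l] by linarith
  qed
qed

lemma pmonom_pack_ideal:
  "(pmonom m :: ('k::field) mpol) \<in> pack_ideal M \<longleftrightarrow>
     Poly_Mapping.keys m \<subseteq> {1..n} \<and> packs M (Poly_Mapping.lookup m)"
  by (simp add: pack_ideal_def pmonom_mspan)

lemma d_fixed_pack_ideal: "d_fixed n d s (pack_ideal M :: ('k::field) mpol set)"
  unfolding d_fixed_def
proof (intro conjI allI impI)
  show "monomial_ideal n (pack_ideal M :: 'k mpol set)"
    unfolding monomial_ideal_iff
  proof (intro conjI ballI)
    show "ideal (pack_ideal M :: 'k mpol set) (poly_ring n)" by (rule ideal_pack_ideal)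
    fix f :: "'k mpol" and m assume "f \<in> pack_ideal M" "m \<in> Poly_Mapping.keys f"
    then show "(pmonom m :: 'k mpol) \<in> pack_ideal M"
      using carrier_keys[of f n m] by (auto simp: pmonom_pack_ideal pack_ideal_def mspan_def)
  qed
next
  fix v j i t
  assume v: "(pmonom v :: 'k mpol) \<in> pack_ideal M" and ji: "1 \<le> j" "j < i" "i \<le> n"
    and t: "le_d d s t (Poly_Mapping.lookup v i)"
  define v' where "v' = v + Poly_Mapping.single j t - Poly_Mapping.single i t"
  have l: "Poly_Mapping.lookup v' = (Poly_Mapping.lookup v)(j := Poly_Mapping.lookup v j + t, i := Poly_Mapping.lookup v i - t)"
    using ji by (auto simp: v'_def lookup_add lookup_minus lookup_single when_def fun_eq_iff)
  have "Poly_Mapping.keys v' \<subseteq> {1..n}"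
  proof
    fix k assume "k \<in> Poly_Mapping.keys v'"
    then have "k \<in> Poly_Mapping.keys v \<or> k = j \<or> k = i" by (auto simp: in_keys_iff l split: if_splits)
    then show "k \<in> {1..n}" using v ji by (auto simp: pmonom_pack_ideal)
  qed
  moreover have "packs M (Poly_Mapping.lookup v')"
    unfolding l using v t ji by (intro packs_move) (auto simp: pmonom_pack_ideal)
  ultimately show "(pmonom (v + Poly_Mapping.single j t - Poly_Mapping.single i t) :: 'k mpol) \<in> pack_ideal M"
    by (simp add: pmonom_pack_ideal v'_def)
qed

text \<open>
  The pieces of the product of the ideals \<open>frob_ideal n p (d j)\<close>, each raised to the \<open>j\<close>-th digit of \<open>a\<close>.
\<close>

definition block :: "nat \<Rightarrow> nat \<Rightarrow> (nat \<times> nat) multiset" where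
  "block p a = (\<Sum>j\<in>{0..s}. replicate_mset (decomp d s a j) (p, j))"

lemma count_block: "count (block p a) (k, j) = (if k = p \<and> j \<le> s then decomp d s a j else 0)"
proof -
  have "count (block p a) (k, j) = (\<Sum>j'\<in>{0..s}. if j' = j then (if k = p then decomp d s a j else 0) else 0)"
    unfolding block_def count_sum by (intro sum.cong) auto
  then show ?thesis by simp
qed

lemma set_block: "p \<in> {1..n} \<Longrightarrow> set_mset (block p a) \<subseteq> pieces"
  by (auto simp: block_def pieces_def set_mset_sum split: if_splits)

lemma packs_block: "p \<in> {1..n} \<Longrightarrow> a \<le> w p \<Longrightarrow> packs (block p a) w"
proof -
  assume p: "p \<in> {1..n}" "a \<le> w p"
  show ?thesis unfolding packs_def
  proof (intro exI[of _ "\<lambda>k j. if k = p \<and> j \<le> s then decomp d s a j else 0"] conjI ballI allI impI)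
    fix k assume "k \<in> {1..n}"
    show "(\<Sum>j\<le>s. (if k = p \<and> j \<le> s then decomp d s a j else 0) * d j) \<le> w k"
      using p sum_decomp[of a] by (cases "k = p") auto
  qed (simp add: count_block)
qed

text \<open>
  Pieces of sizes \<open>d j\<close>, for \<open>j\<close> in \<open>M\<close>, are moved out of bin \<open>i\<close> one at a time; \<open>\<rho>\<close> counts those that stay in
  bin \<open>i\<close> for good. As long as the multiplicities are bounded by the digits of \<open>a\<close>, they are the digits
  of the exponent at \<open>i\<close>, hence every single piece may be moved.
\<close>

lemma d_fixed_move_pieces:
  fixes H :: "('k::field) mpol set"
  assumes H: "d_fixed n d s H" and i: "i \<in> {1..n}"
  shows "\<And>base \<rho> v. packs (image_mset (Pair i) M) (Poly_Mapping.lookup v) \<Longrightarrow>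
      (\<And>j. j \<in># M \<Longrightarrow> j \<le> s) \<Longrightarrow> (\<And>j. j \<le> s \<Longrightarrow> count M j + \<rho> j \<le> decomp d s a j) \<Longrightarrow>
      Poly_Mapping.lookup base i = 0 \<Longrightarrow> Poly_Mapping.keys v \<subseteq> {1..n} \<Longrightarrow>
      pmonom (base + Poly_Mapping.single i ((\<Sum>j\<in>#M. d j) + (\<Sum>j\<le>s. \<rho> j * d j))) \<in> H \<Longrightarrow>
      pmonom (base + v + Poly_Mapping.single i (\<Sum>j\<le>s. \<rho> j * d j)) \<in> H"
proof (induction M)
  case empty
  have "ideal H (poly_ring n)" using H unfolding d_fixed_def monomial_ideal_iff by blast
  then have "(pmonom v :: 'k mpol) \<otimes>\<^bsub>poly_ring n\<^esub> pmonom (base + Poly_Mapping.single i (\<Sum>j\<le>s. \<rho> j * d j)) \<in> H"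
    using empty by (intro ideal.I_l_closed) auto
  then show ?case by (simp add: pmonom_mult algebra_simps)
next
  case (add j M)
  have j: "j \<le> s" using add.prems(2) by simp
  have "packs (add_mset (i, j) (image_mset (Pair i) M)) (Poly_Mapping.lookup v)" using add.prems(1) by simp
  then obtain k where k: "k \<in> {1..i}" "d j \<le> Poly_Mapping.lookup v k"
    "packs (image_mset (Pair i) M) ((Poly_Mapping.lookup v)(k := Poly_Mapping.lookup v k - d j))"
    using i j by (rule packs_add_msetE)
  define v' where "v' = v - Poly_Mapping.single k (d j)"
  have lv': "Poly_Mapping.lookup v' = (Poly_Mapping.lookup v)(k := Poly_Mapping.lookup v k - d j)"
    by (auto simp: v'_def lookup_minus lookup_single when_def fun_eq_iff)
  have v: "v = v' + Poly_Mapping.single k (d j)"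
    using k(2) by (intro poly_mapping_eqI) (auto simp: lookup_add lv' lookup_single when_def)
  have kv': "Poly_Mapping.keys v' \<subseteq> {1..n}"
    using add.prems(5) unfolding v by (simp add: keys_add_nat)
  have pv': "packs (image_mset (Pair i) M) (Poly_Mapping.lookup v')" unfolding lv' by (rule k(3))
  have Ms: "\<And>l. l \<in># M \<Longrightarrow> l \<le> s" using add.prems(2) by auto
  define T where "T = (\<Sum>j\<in>#M. d j) + (\<Sum>j\<le>s. \<rho> j * d j)"
  show ?case
  proof (cases "k = i")
    case True
    define \<rho>' where "\<rho>' = \<rho>(j := \<rho> j + 1)"
    have \<rho>': "(\<Sum>j\<le>s. \<rho>' j * d j) = (\<Sum>j\<le>s. \<rho> j * d j) + d j"
      using sum_fun_upd[of "{..s}" j \<rho> "\<rho> j + 1" d] j by (simp add: \<rho>'_def)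
    have "pmonom (base + v' + Poly_Mapping.single i (\<Sum>j\<le>s. \<rho>' j * d j)) \<in> H"
    proof (rule add.IH[OF pv' Ms _ add.prems(4) kv'])
      fix l assume "l \<le> s"
      then show "count M l + \<rho>' l \<le> decomp d s a l" using add.prems(3)[of l] by (auto simp: \<rho>'_def)
    next
      show "pmonom (base + Poly_Mapping.single i ((\<Sum>j\<in>#M. d j) + (\<Sum>j\<le>s. \<rho>' j * d j))) \<in> H"
        using add.prems(6) unfolding \<rho>' by (simp add: algebra_simps)
    qed
    then show ?thesis unfolding \<rho>' v True by (simp add: single_add algebra_simps)
  next
    case False
    then have ki: "1 \<le> k" "k < i" "i \<le> n" using k i by auto
    define base' where "base' = base + Poly_Mapping.single k (d j)"
    have H1: "pmonom (base + Poly_Mapping.single i (d j + T)) \<in> H"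
      using add.prems(6) by (simp add: T_def algebra_simps)
    have "is_decomp d s (d j + T) (\<lambda>l. if l \<le> s then count (add_mset j M) l + \<rho> l else 0)"
      unfolding is_decomp_def
    proof (intro conjI allI impI)
      have "(\<Sum>t\<le>s. count N t * d t) = (\<Sum>j\<in>#N. d j)" if "\<And>j. j \<in># N \<Longrightarrow> j \<le> s" for N
        using that
      proof (induction N)
        case (add x N)
        have "(\<Sum>t\<le>s. count (add_mset x N) t * d t) = (\<Sum>t\<le>s. count N t * d t + (if t = x then d x else 0))"
          by (intro sum.cong) auto
        then show ?case using add by (simp add: sum.distrib sum.delta)
      qed simp
      from this[of "add_mset j M"] add.prems(2)
      show "d j + T = (\<Sum>t\<le>s. (if t \<le> s then count (add_mset j M) t + \<rho> t else 0) * d t)"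
        by (simp add: T_def add_mult_distrib sum.distrib)
    next
      fix t assume t: "t < s"
      have "count (add_mset j M) t + \<rho> t \<le> decomp d s a t" using add.prems(3)[of t] t by simp
      also have "\<dots> < d (Suc t) div d t" using is_decomp_decomp[of a] t by (simp add: is_decomp_def)
      finally show "(if t \<le> s then count (add_mset j M) t + \<rho> t else 0) < d (Suc t) div d t" using t by simp
    qed auto
    then have "decomp d s (d j + T) = (\<lambda>l. if l \<le> s then count (add_mset j M) l + \<rho> l else 0)" by (rule decomp_eqI)
    then have "le_d d s (d j) (d j + T)" using j by (simp add: le_d_def decomp_d)
    then have "le_d d s (d j) (Poly_Mapping.lookup (base + Poly_Mapping.single i (d j + T)) i)"
      using add.prems(4) by (simp add: lookup_add)
    then have "pmonom (base + Poly_Mapping.single i (d j + T) + Poly_Mapping.single k (d j) - Poly_Mapping.single i (d j)) \<in> H"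
      using H H1 ki unfolding d_fixed_def by blast
    also have "base + Poly_Mapping.single i (d j + T) + Poly_Mapping.single k (d j) - Poly_Mapping.single i (d j)
        = base' + Poly_Mapping.single i T"
      by (intro poly_mapping_eqI) (auto simp: base'_def lookup_add lookup_minus lookup_single when_def)
    finally have "pmonom (base' + v' + Poly_Mapping.single i (\<Sum>j\<le>s. \<rho> j * d j)) \<in> H"
    proof (intro add.IH[OF pv' Ms _ _ kv'])
      fix l assume "l \<le> s"
      then show "count M l + \<rho> l \<le> decomp d s a l" using add.prems(3)[of l] by (auto split: if_splits)
    qed (use add.prems(4) False in \<open>auto simp: base'_def T_def lookup_add lookup_single when_def\<close>)
    then show ?thesis unfolding v base'_def by (simp add: algebra_simps)
  qed
qed

lemma packs_truncate:
  assumes "packs M w" "set_mset M \<subseteq> {1..p} \<times> {..s}" "p \<le> n"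
  shows "packs M (\<lambda>k. if k \<le> p then w k else 0)"
proof -
  obtain y where y: "\<And>k. k\<in>{1..n} \<Longrightarrow> (\<Sum>j\<le>s. y k j * d j) \<le> w k"
     "\<And>m j. m\<in>{1..n} \<Longrightarrow> j\<le>s \<Longrightarrow> (\<Sum>k=1..m. count M (k, j)) \<le> (\<Sum>k=1..m. y k j)"
    using assms(1) unfolding packs_def by blast
  show ?thesis
    unfolding packs_def
  proof (intro exI[of _ "\<lambda>k j. if k \<le> p then y k j else 0"] conjI ballI allI impI)
    fix m j assume m: "m \<in> {1..n}" and j: "j \<le> s"
    have "(\<Sum>k=1..m. count M (k, j)) = (\<Sum>k=1..min m p. count M (k, j))"
    proof (rule sum.mono_neutral_right)
      show "\<forall>k\<in>{1..m} - {1..min m p}. count M (k, j) = 0"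
        using assms(2) by (auto simp: count_eq_zero_iff)
    qed auto
    also have "\<dots> \<le> (\<Sum>k=1..min m p. y k j)"
    proof (cases "p = 0")
      case False
      then show ?thesis using y(2)[of "min m p" j] m j by auto
    qed simp
    also have "\<dots> = (\<Sum>k=1..min m p. if k \<le> p then y k j else 0)"
      by (intro sum.cong) auto
    also have "\<dots> \<le> (\<Sum>k=1..m. if k \<le> p then y k j else 0)"
      by (intro sum_mono2) auto
    finally show "(\<Sum>k=1..m. count M (k, j)) \<le> (\<Sum>k=1..m. if k \<le> p then y k j else 0)" .
  qed (use y(1) in auto)
qed

text \<open>
  The product is d-fixed and contains \<open>u\<close>. Conversely the blocks are distributed in increasing order of
  their positions. Pieces only move downwards, so the exponent at \<open>i q\<close> is still \<open>\<alpha> q\<close> when the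
  \<open>q\<close>-th block is treated.
\<close>

theorem d_fixed_hull_eq:
  fixes \<alpha> i :: "nat \<Rightarrow> nat" and u :: "('k::field) mpol"
  assumes mono: "strict_mono_on {1..r} i" and range: "\<And>q. q \<in> {1..r} \<Longrightarrow> i q \<in> {1..n}"
    and u: "u = (\<Prod>q=1..r. X (i q) ^ \<alpha> q)"
  shows "d_fixed_hull n d s u = pack_ideal (\<Sum>q=1..r. block (i q) (\<alpha> q))"
proof -
  define U where "U = (\<lambda>Q. \<Sum>q=1..Q. block (i q) (\<alpha> q))"
  have Upieces: "set_mset (U Q) \<subseteq> {1..i Q} \<times> {..s}" if "Q \<in> {1..r}" for Q
  proof -
    have "i q \<in> {1..i Q}" if "q \<in> {1..Q}" for q
      using range[of q] strict_mono_on_leD[OF mono, of q Q] that \<open>Q \<in> {1..r}\<close> by auto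
    then show ?thesis by (fastforce simp: U_def set_mset_sum block_def split: if_splits)
  qed
  have um: "(\<Prod>q\<in>A. X (i q) ^ \<alpha> q) = (pmonom (\<Sum>q\<in>A. Poly_Mapping.single (i q) (\<alpha> q)) :: 'k mpol)"
    if "finite A" for A
    using that by (induction A rule: finite_induct) (auto simp: X_power pmonom_mult, simp add: pmonom_def)
  define tail where "tail = (\<lambda>Q. \<Sum>q=Suc Q..r. Poly_Mapping.single (i q) (\<alpha> q))"
  have u': "u = pmonom (tail 0)" using um[of "{1..r}"] by (simp add: u tail_def)
  have tail_keys: "Poly_Mapping.keys (\<Sum>q\<in>A. Poly_Mapping.single (i q) (\<alpha> q)) \<subseteq> i ` A" if "finite A" for A
    using that by (induction A rule: finite_induct) (auto simp: keys_add_nat split: if_splits)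
  have uc: "u \<in> carrier (poly_ring n)"
    unfolding u' pmonom_carrier tail_def using tail_keys[of "{Suc 0..r}"] range by force
  note H = d_fixed_hull_least[OF uc, of d s]
  have pre: "packs (U Q) (Poly_Mapping.lookup (\<Sum>q=1..Q. Poly_Mapping.single (i q) (\<alpha> q)))" if "Q \<le> r" for Q
    using that
  proof (induction Q)
    case 0
    then show ?case by (simp add: U_def)
  next
    case (Suc Q)
    have "packs (block (i (Suc Q)) (\<alpha> (Suc Q))) (Poly_Mapping.lookup (Poly_Mapping.single (i (Suc Q)) (\<alpha> (Suc Q))))"
      using Suc range[of "Suc Q"] by (intro packs_block) auto
    from packs_union[OF Suc.IH this] show ?case using Suc by (simp add: U_def lookup_add)
  qed
  have "u \<in> pack_ideal (U r)"
    using pre[of r] uc unfolding u' pmonom_pack_ideal pmonom_carrier tail_def by simp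
  then have le: "d_fixed_hull n d s u \<subseteq> pack_ideal (U r)" by (intro H(3) d_fixed_pack_ideal)
  have main: "pmonom (v + tail Q) \<in> d_fixed_hull n d s u"
    if "Q \<le> r" "packs (U Q) (Poly_Mapping.lookup v)" "Poly_Mapping.keys v \<subseteq> {1..n}" for Q v
    using that
  proof (induction Q arbitrary: v)
    case 0
    have "ideal (d_fixed_hull n d s u) (poly_ring n)"
      using H(1) unfolding d_fixed_def monomial_ideal_iff by blast
    then have "(pmonom v :: 'k mpol) \<otimes>\<^bsub>poly_ring n\<^esub> u \<in> d_fixed_hull n d s u"
      using H(2) 0 by (intro ideal.I_l_closed) auto
    then show ?case unfolding u' by (simp add: pmonom_mult)
  next
    case (Suc Q)
    let ?p = "i (Suc Q)" and ?a = "\<alpha> (Suc Q)"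
    have p: "?p \<in> {1..n}" using range Suc.prems by simp
    have "packs (U Q + block ?p ?a) (Poly_Mapping.lookup v)" using Suc.prems(2) by (simp add: U_def)
    then obtain a b where ab: "v = a + b" "packs (U Q) (Poly_Mapping.lookup a)" "packs (block ?p ?a) (Poly_Mapping.lookup b)"
      using packs_split_exponent[OF set_block[OF p]] by blast
    have kab: "Poly_Mapping.keys a \<subseteq> {1..n}" "Poly_Mapping.keys b \<subseteq> {1..n}"
      using Suc.prems(3) unfolding ab(1) by (auto simp: keys_add_nat)
    \<comment> \<open>Surplus exponents of \<open>a\<close> at \<open>?p\<close> and above would disturb the digits at \<open>?p\<close>; they are cut off here
      and multiplied in again at the end.\<close>
    define a' where "a' = Poly_Mapping.mapp (\<lambda>k e. if k < ?p then e else 0) a"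
    have la': "Poly_Mapping.lookup a' k = (if k < ?p then Poly_Mapping.lookup a k else 0)" for k
      by (auto simp: a'_def lookup_mapp when_def in_keys_iff)
    have ka': "Poly_Mapping.keys a' \<subseteq> {1..n}" using kab(1) by (auto simp: in_keys_iff la' split: if_splits)
    have pa': "packs (U Q) (Poly_Mapping.lookup a')"
    proof (cases "Q = 0")
      case True
      then show ?thesis by (simp add: U_def)
    next
      case False
      then have Q: "Q \<in> {1..r}" using Suc.prems by auto
      have lt: "i Q < ?p" using mono Q Suc.prems(1) unfolding strict_mono_on_def by auto
      show ?thesis
        by (rule packs_mono[OF packs_truncate[OF ab(2) Upieces[OF Q]]]) (use range[OF Q] lt in \<open>auto simp: la'\<close>)
    qed
    have "tail Q = Poly_Mapping.single ?p ?a + tail (Suc Q)"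
      using Suc.prems(1) by (simp add: tail_def sum.atLeast_Suc_atMost)
    then have base: "pmonom (a' + tail (Suc Q) + Poly_Mapping.single ?p ?a) \<in> d_fixed_hull n d s u"
      using Suc.IH[OF _ pa' ka'] Suc.prems(1) by (simp add: algebra_simps)
    define M where "M = (\<Sum>j\<in>{0..s}. replicate_mset (decomp d s ?a j) j)"
    have im: "image_mset f (\<Sum>j\<in>A. replicate_mset (c j) j) = (\<Sum>j\<in>A. replicate_mset (c j) (f j))"
      if "finite A" for A :: "nat set" and f :: "nat \<Rightarrow> 'b" and c
      using that by (induction A rule: finite_induct) auto
    have M1: "image_mset (Pair ?p) M = block ?p ?a"
      unfolding M_def block_def by (simp add: im)
    have M2: "count M j = decomp d s ?a j" if "j \<le> s" for j
      using that by (simp add: M_def count_sum)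
    have M3: "(\<Sum>j\<in>#M. d j) = ?a"
    proof -
      have sm: "sum_mset (\<Sum>j\<in>A. replicate_mset (c j) (g j)) = (\<Sum>j\<in>A. c j * g j)" if "finite A"
        for A :: "nat set" and g c :: "nat \<Rightarrow> nat"
        using that by (induction A rule: finite_induct) auto
      show ?thesis unfolding M_def im[OF finite_atLeastAtMost] sm[OF finite_atLeastAtMost]
        using sum_decomp[of ?a] by (simp add: atMost_atLeast0)
    qed
    have "pmonom (a' + tail (Suc Q) + b + Poly_Mapping.single ?p (\<Sum>j\<le>s. 0 * d j)) \<in> d_fixed_hull n d s u"
    proof (rule d_fixed_move_pieces[OF H(1) p, where M = M and \<rho> = "\<lambda>_. 0" and a = ?a])
      show "packs (image_mset (Pair ?p) M) (Poly_Mapping.lookup b)" unfolding M1 by (rule ab(3))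
      show "j \<le> s" if "j \<in># M" for j using that by (auto simp: M_def set_mset_sum split: if_splits)
      show "count M j + 0 \<le> decomp d s ?a j" if "j \<le> s" for j using M2[OF that] by simp
      have "?p \<notin> i ` {Suc (Suc Q)..r}"
      proof
        assume "?p \<in> i ` {Suc (Suc Q)..r}"
        then obtain q where "?p = i q" "q \<in> {Suc (Suc Q)..r}" by blast
        then show False using strict_mono_onD[OF mono, of "Suc Q" q] by simp
      qed
      then have "?p \<notin> Poly_Mapping.keys (tail (Suc Q))"
        using tail_keys[of "{Suc (Suc Q)..r}"] unfolding tail_def by blast
      then show "Poly_Mapping.lookup (a' + tail (Suc Q)) ?p = 0"
        by (simp add: lookup_add la' in_keys_iff)
      show "pmonom (a' + tail (Suc Q) + Poly_Mapping.single ?p ((\<Sum>j\<in>#M. d j) + (\<Sum>j\<le>s. 0 * d j))) \<in> d_fixed_hull n d s u"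
        unfolding M3 using base by simp
    qed (rule kab(2))
    then have x: "pmonom (a' + tail (Suc Q) + b) \<in> d_fixed_hull n d s u" by simp
    have aa: "a = (a - a') + a'"
      by (intro poly_mapping_eqI) (auto simp: lookup_add lookup_minus la')
    have "Poly_Mapping.keys (a - a') \<subseteq> {1..n}" using kab(1) aa by (metis Un_subset_iff keys_add_nat)
    moreover have "ideal (d_fixed_hull n d s u) (poly_ring n)"
      using H(1) unfolding d_fixed_def monomial_ideal_iff by blast
    ultimately have xx: "(pmonom (a - a') :: 'k mpol) \<otimes>\<^bsub>poly_ring n\<^esub> pmonom (a' + tail (Suc Q) + b) \<in> d_fixed_hull n d s u"
      using x by (intro ideal.I_l_closed) auto
    have "v + tail (Suc Q) = (a - a') + (a' + tail (Suc Q) + b)"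
      unfolding ab(1) by (subst aa) (simp only: ac_simps)
    then show ?case using xx by (simp add: pmonom_mult)
  qed
  have "pack_ideal (U r) \<subseteq> d_fixed_hull n d s u"
  proof
    fix p :: "'k mpol" assume p: "p \<in> pack_ideal (U r)"
    show "p \<in> d_fixed_hull n d s u"
    proof (rule ideal_memI)
      show "ideal (d_fixed_hull n d s u) (poly_ring n)"
        using H(1) unfolding d_fixed_def monomial_ideal_iff by blast
      fix m assume m: "m \<in> Poly_Mapping.keys p"
      then show "pmonom m \<in> d_fixed_hull n d s u"
        using main[of r m] p carrier_keys[of p n m] by (auto simp: tail_def pack_ideal_def mspan_def)
    qed
  qed
  then show ?thesis using le by (simp add: U_def)
qed

lemma prod_ideal_eq:
  assumes range: "\<And>q. q \<in> {1..r} \<Longrightarrow> i q \<in> {1..n}"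
  shows "prod_ideal n d s r i \<alpha> = (pack_ideal (\<Sum>q=1..r. block (i q) (\<alpha> q)) :: ('k::field) mpol set)"
  unfolding prod_ideal_def
proof (rule finprod_pack_ideal)
  fix q assume q: "q \<in> {1..r}"
  show "set_mset (block (i q) (\<alpha> q)) \<subseteq> pieces" using set_block[OF range[OF q]] .
  show "(\<Otimes>\<^bsub>ideals n\<^esub>j\<in>{0..s}. frob_ideal n (i q) (d j) [^]\<^bsub>ideals n\<^esub> decomp d s (\<alpha> q) j)
      = (pack_ideal (block (i q) (\<alpha> q)) :: 'k mpol set)"
    unfolding block_def using range[OF q]
    by (intro finprod_pack_ideal) (auto simp: frob_ideal_pow_pack pieces_def split: if_splits)
qed simp

end

section \<open>The ideals indexed by pairs of increasing tuples\<close>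

lemma sum_consecutive:
  fixes f :: "nat \<Rightarrow> nat" and g :: "nat \<Rightarrow> 'b::comm_monoid_add"
  assumes "\<And>\<nu>. \<nu> \<in> {1..a} \<Longrightarrow> f (\<nu> - 1) \<le> f \<nu>" "f 0 = 0"
  shows "(\<Sum>\<nu>=1..a. \<Sum>k=f (\<nu> - 1) + 1..f \<nu>. g k) = (\<Sum>k=1..f a. g k)"
  using assms
proof (induction a)
  case (Suc a)
  have le: "f a \<le> f (Suc a)" using Suc.prems(1)[of "Suc a"] by simp
  have "{1..f (Suc a)} = {1..f a} \<union> {f a + 1..f (Suc a)}" using le by auto
  then have "(\<Sum>k=1..f (Suc a). g k) = (\<Sum>k=1..f a. g k) + (\<Sum>k=f a + 1..f (Suc a). g k)"
    by (simp only:) (rule sum.union_disjoint; auto)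
  then show ?case using Suc by simp
qed simp

text \<open>
  The data of the monomial \<open>u\<close>, the product of the powers \<open>X (i q) ^ \<alpha> q\<close> for \<open>q\<close> from \<open>1\<close> to \<open>r\<close>. That no
  variable with index \<open>1\<close> occurs in \<open>u\<close> is essential for the description of the socle.
\<close>

locale principal_d_fixed = packing +
  fixes r :: nat and i \<alpha> :: "nat \<Rightarrow> nat"
  assumes r_pos: "1 \<le> r" and i1: "2 \<le> i 1" and i_mono: "strict_mono_on {1..r} i" and i_last: "i r = n"
begin

text \<open>
  The pieces of the principal d-fixed ideal.
\<close>

definition all_pieces :: "(nat \<times> nat) multiset" where
  "all_pieces = (\<Sum>q=1..r. block (i q) (\<alpha> q))"

abbreviation A :: "nat \<Rightarrow> nat \<Rightarrow> nat" where
  "A q j \<equiv> decomp d s (\<alpha> q) j"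

lemma i_range: "q \<in> {1..r} \<Longrightarrow> i q \<in> {1..n}" "q \<in> {1..r} \<Longrightarrow> 2 \<le> i q"
  using strict_mono_on_leD[OF i_mono, of q r] strict_mono_on_leD[OF i_mono, of 1 q] i1 i_last by auto

lemma i_inj: "q \<in> {1..r} \<Longrightarrow> q' \<in> {1..r} \<Longrightarrow> i q = i q' \<Longrightarrow> q = q'"
  using strict_mono_on_imp_inj_on[OF i_mono] by (auto dest: inj_onD)

lemma count_all_pieces:
  assumes "q \<in> {1..r}"
  shows "count all_pieces (i q, j) = (if j \<le> s then A q j else 0)"
proof -
  have "count all_pieces (i q, j) = (\<Sum>q'=1..r. if q' = q then (if j \<le> s then A q j else 0) else 0)"
    unfolding all_pieces_def count_sum
    using i_inj[OF assms] by (intro sum.cong refl) (auto simp: count_block)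
  then show ?thesis using assms by simp
qed

lemma count_all_pieces_pos:
  assumes "0 < count all_pieces (k, j)"
  obtains q where "q \<in> {1..r}" "k = i q" "j \<le> s" "0 < A q j"
proof -
  have "\<exists>q\<in>{1..r}. count (block (i q) (\<alpha> q)) (k, j) \<noteq> 0"
  proof (rule ccontr)
    assume "\<not> ?thesis"
    then have "(\<Sum>q=1..r. count (block (i q) (\<alpha> q)) (k, j)) = 0" by (intro sum.neutral) blast
    then show False using assms by (simp add: all_pieces_def count_sum)
  qed
  then obtain q where q: "q \<in> {1..r}" "count (block (i q) (\<alpha> q)) (k, j) \<noteq> 0" by blast
  then show ?thesis using that[OF q(1)] by (auto simp: count_block split: if_splits)
qed

lemma weight_all_pieces:
  "weight \<sigma> all_pieces = (\<Sum>q=1..r. \<Sum>j=0..s. A q j * thr_size \<sigma> (i q) j)"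
proof -
  have "weight \<sigma> (block (i q) (\<alpha> q)) = (\<Sum>j=0..s. A q j * thr_size \<sigma> (i q) j)" if "q \<in> {1..r}" for q
    unfolding block_def weight_sum using i_range(1)[OF that]
    by (intro sum.cong refl weight_replicate) auto
  then show ?thesis unfolding all_pieces_def weight_sum by simp
qed

text \<open>
  The pieces in the \<open>\<nu>\<close>-th factor of the product defining \<^const>\<open>J_ideal\<close>.
\<close>

definition socle_factor :: "nat \<Rightarrow> (nat \<Rightarrow> nat) \<Rightarrow> (nat \<Rightarrow> nat) \<Rightarrow> nat \<Rightarrow> (nat \<times> nat) multiset" where
  "socle_factor a lam t \<nu> =
     (if \<nu> = a then {#} else {#(i (lam \<nu>), t (\<nu> + 1))#})
     + (\<Sum>j\<in>{t \<nu><..s}. replicate_mset (A (lam \<nu>) j) (i (lam \<nu>), j))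
     + replicate_mset (A (lam \<nu>) (t \<nu>) - 1) (i (lam \<nu>), t \<nu>)
     + (\<Sum>q\<in>{(lam(0 := 0)) (\<nu> - 1) + 1..lam \<nu> - 1}. \<Sum>j\<in>{t \<nu>..s}. replicate_mset (A q j) (i q, j))"

text \<open>
  The exponent vector of the monomial in front of that product, for the threshold function \<open>\<tau>\<close>
  belonging to the two tuples.
\<close>

definition socle_exponent :: "(nat \<Rightarrow> nat) \<Rightarrow> nat \<Rightarrow>\<^sub>0 nat" where
  "socle_exponent \<tau> = (\<Sum>k=1..n. Poly_Mapping.single k (d (\<tau> k) - 1))"

lemma lookup_socle_exponent:
  "Poly_Mapping.lookup (socle_exponent \<tau>) k = (if k \<in> {1..n} then d (\<tau> k) - 1 else 0)"
  by (simp add: socle_exponent_def lookup_sum lookup_single when_def)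

end

text \<open>
  A pair of tuples indexing one summand of \<^const>\<open>J_sum\<close>.
\<close>

locale socle_index = principal_d_fixed +
  fixes a :: nat and lam t :: "nat \<Rightarrow> nat"
  assumes a_pos: "1 \<le> a" and P: "(lam, t) \<in> P_set d s r \<alpha> a"
begin

text \<open>
  The tuple \<open>lam\<close> with \<open>l 0 = 0\<close>, and the end points \<open>c \<nu>\<close> of the consecutive intervals of bins which it
  determines.
\<close>

definition l :: "nat \<Rightarrow> nat" where "l = lam(0 := 0)"
definition c :: "nat \<Rightarrow> nat" where "c = (\<lambda>\<nu>. (i(0 := 0)) (l \<nu>))"

text \<open>
  The threshold function that takes the value \<open>t \<nu>\<close> on the \<open>\<nu>\<close>-th interval of bins.
\<close>

definition tau :: "nat \<Rightarrow> nat" where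
  "tau k = t (LEAST \<nu>. k \<le> c \<nu>)"

lemma lam_mono: "strict_mono_on {1..a} lam" and t_mono: "strict_mono_on {1..a} t"
  and lam_last: "lam a = r" and t_last: "t a \<le> s" and lam_pos: "1 \<le> lam 1"
  and A_pos: "\<nu> \<in> {1..a} \<Longrightarrow> 0 < A (lam \<nu>) (t \<nu>)"
  using P by (auto simp: P_set_def)

lemma lam_range: "\<nu> \<in> {1..a} \<Longrightarrow> lam \<nu> \<in> {1..r}"
  using strict_mono_on_leD[OF lam_mono, of \<nu> a] strict_mono_on_leD[OF lam_mono, of 1 \<nu>]
    lam_pos lam_last a_pos by auto

lemma t_range: "\<nu> \<in> {1..a} \<Longrightarrow> t \<nu> \<le> s"
  using strict_mono_on_leD[OF t_mono, of \<nu> a] t_last a_pos by auto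

lemma l_eq: "\<nu> \<in> {1..a} \<Longrightarrow> l \<nu> = lam \<nu>" and l_0: "l 0 = 0" and l_last: "l a = r"
  using a_pos lam_last by (auto simp: l_def)

lemma l_less: assumes "\<nu> \<in> {1..a}" shows "l (\<nu> - 1) < l \<nu>"
proof (cases "\<nu> = 1")
  case True
  then show ?thesis using lam_range[OF assms] by (simp add: l_def)
next
  case False
  then have "\<nu> - 1 \<in> {1..a}" "\<nu> - 1 < \<nu>" using assms by auto
  then show ?thesis using strict_mono_onD[OF lam_mono _ assms] l_eq assms by simp
qed

lemma c_eq: "\<nu> \<in> {1..a} \<Longrightarrow> c \<nu> = i (lam \<nu>)" and c_0: "c 0 = 0" and c_last: "c a = n"
  using a_pos lam_last lam_range[of \<nu>] r_pos i_last by (auto simp: c_def l_def)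

lemma c_less: assumes "\<nu> \<in> {1..a}" shows "c (\<nu> - 1) < c \<nu>"
proof (cases "\<nu> = 1")
  case True
  then show ?thesis using c_eq[OF assms] i_range[OF lam_range[OF assms]] by (simp add: c_0)
next
  case False
  then have "\<nu> - 1 \<in> {1..a}" using assms by auto
  then show ?thesis using False assms strict_mono_onD[OF lam_mono, of "\<nu> - 1" \<nu>]
      strict_mono_onD[OF i_mono, of "lam (\<nu> - 1)" "lam \<nu>"] lam_range by (auto simp: c_eq)
qed

lemma c_mono: "\<nu> \<le> \<mu> \<Longrightarrow> \<mu> \<le> a \<Longrightarrow> c \<nu> \<le> c \<mu>"
proof (induction \<mu> rule: dec_induct)
  case (step \<mu>)
  then show ?case using c_less[of "Suc \<mu>"] by simp
qed simp

lemma tau_eq: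
  assumes "\<nu> \<in> {1..a}" "c (\<nu> - 1) < k" "k \<le> c \<nu>"
  shows "tau k = t \<nu>"
proof -
  have "(LEAST \<nu>. k \<le> c \<nu>) = \<nu>"
  proof (rule Least_equality)
    fix \<mu> assume "k \<le> c \<mu>"
    show "\<nu> \<le> \<mu>"
    proof (rule ccontr)
      assume "\<not> \<nu> \<le> \<mu>"
      then have "c \<mu> \<le> c (\<nu> - 1)" using assms(1) by (intro c_mono) auto
      then show False using assms(2) \<open>k \<le> c \<mu>\<close> by simp
    qed
  qed (rule assms(3))
  then show ?thesis by (simp add: tau_def)
qed

lemma in_level:
  assumes "k \<in> {1..n}"
  obtains \<nu> where "\<nu> \<in> {1..a}" "c (\<nu> - 1) < k" "k \<le> c \<nu>"
proof -
  define \<nu> where "\<nu> = (LEAST \<nu>. k \<le> c \<nu>)"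
  have ka: "k \<le> c a" using assms c_last by simp
  have 1: "k \<le> c \<nu>" unfolding \<nu>_def by (rule LeastI[of _ a]) (rule ka)
  have 2: "\<nu> \<le> a" unfolding \<nu>_def by (rule Least_le) (rule ka)
  have 3: "\<nu> \<noteq> 0" using 1 assms c_0 by (intro notI) simp
  have "\<not> k \<le> c (\<nu> - 1)" unfolding \<nu>_def by (rule not_less_Least) (use 3 in \<open>simp add: \<nu>_def\<close>)
  then show ?thesis using that[of \<nu>] 1 2 3 by simp
qed

lemma tau_range: "k \<in> {1..n} \<Longrightarrow> tau k \<le> s"
  by (erule in_level) (simp add: tau_eq t_range)

lemma tau_mono: "mono_on {1..n} tau"
proof (rule mono_onI)
  fix x y assume xy: "x \<in> {1..n}" "y \<in> {1..n}" "x \<le> y"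
  obtain \<nu> where \<nu>: "\<nu> \<in> {1..a}" "c (\<nu> - 1) < x" "x \<le> c \<nu>" by (rule in_level[OF xy(1)])
  obtain \<mu> where \<mu>: "\<mu> \<in> {1..a}" "c (\<mu> - 1) < y" "y \<le> c \<mu>" by (rule in_level[OF xy(2)])
  have "\<nu> \<le> \<mu>"
  proof (rule ccontr)
    assume "\<not> \<nu> \<le> \<mu>"
    then have "c \<mu> \<le> c (\<nu> - 1)" using \<nu>(1) by (intro c_mono) auto
    then show False using \<nu> \<mu> xy(3) by simp
  qed
  then show "tau x \<le> tau y"
    using strict_mono_on_leD[OF t_mono \<nu>(1) \<mu>(1)] tau_eq[OF \<nu>] tau_eq[OF \<mu>] by simp
qed

lemma tau_threshold: "threshold tau"
  using tau_mono tau_range by (auto simp: threshold_def le_Suc_eq)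

text \<open>
  All pieces in the product defining \<^const>\<open>J_ideal\<close>.
\<close>

definition remaining :: "(nat \<times> nat) multiset" where
  "remaining = (\<Sum>\<nu>=1..a. socle_factor a lam t \<nu>)"

lemma tau_i:
  assumes "\<nu> \<in> {1..a}" "q \<in> {l (\<nu> - 1) + 1..l \<nu>}"
  shows "q \<in> {1..r}" "tau (i q) = t \<nu>"
proof -
  have lr: "l \<nu> \<in> {1..r}" using lam_range[OF assms(1)] l_eq[OF assms(1)] by simp
  then show q: "q \<in> {1..r}" using assms(2) by auto
  show "tau (i q) = t \<nu>"
  proof (rule tau_eq[OF assms(1)])
    show "i q \<le> c \<nu>" using strict_mono_on_leD[OF i_mono q lr] assms(2) lr by (simp add: c_def)
    show "c (\<nu> - 1) < i q"
    proof (cases "\<nu> = 1")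
      case True
      then show ?thesis using i_range[OF q] c_0 by simp
    next
      case False
      then have m: "\<nu> - 1 \<in> {1..a}" using assms(1) by auto
      have "i (lam (\<nu> - 1)) < i q"
        using assms(2) l_eq[OF m] by (intro strict_mono_onD[OF i_mono lam_range[OF m] q]) auto
      then show ?thesis using c_eq[OF m] by simp
    qed
  qed
qed

lemma weight_socle_factor:
  assumes \<nu>: "\<nu> \<in> {1..a}"
  shows "weight \<sigma> (socle_factor a lam t \<nu>) + thr_size \<sigma> (c \<nu>) (t \<nu>) =
    (if \<nu> = a then 0 else thr_size \<sigma> (c \<nu>) (t (\<nu> + 1)))
    + (\<Sum>q=l (\<nu> - 1) + 1..l \<nu>. \<Sum>j=tau (i q)..s. A q j * thr_size \<sigma> (i q) j)"
proof -
  note lr = lam_range[OF \<nu>] and ts = t_range[OF \<nu>] and ir = i_range(1)[OF lam_range[OF \<nu>]]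
  have 1: "weight \<sigma> (if \<nu> = a then {#} else {#(i (lam \<nu>), t (\<nu> + 1))#}) = (if \<nu> = a then 0 else thr_size \<sigma> (c \<nu>) (t (\<nu> + 1)))"
    using weight_replicate[OF ir, of "t (\<nu> + 1)" \<sigma> 1] t_range[of "\<nu> + 1"] \<nu> c_eq[OF \<nu>] by auto
  have 2: "weight \<sigma> (\<Sum>j\<in>{t \<nu><..s}. replicate_mset (A (lam \<nu>) j) (i (lam \<nu>), j))
     + weight \<sigma> (replicate_mset (A (lam \<nu>) (t \<nu>) - 1) (i (lam \<nu>), t \<nu>)) + thr_size \<sigma> (c \<nu>) (t \<nu>)
     = (\<Sum>j=t \<nu>..s. A (lam \<nu>) j * thr_size \<sigma> (i (lam \<nu>)) j)"
  proof -
    have "weight \<sigma> (\<Sum>j\<in>{t \<nu><..s}. replicate_mset (A (lam \<nu>) j) (i (lam \<nu>), j)) =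
        (\<Sum>j\<in>{t \<nu><..s}. A (lam \<nu>) j * thr_size \<sigma> (i (lam \<nu>)) j)"
      unfolding weight_sum by (intro sum.cong refl weight_replicate[OF ir]) auto
    moreover have "weight \<sigma> (replicate_mset (A (lam \<nu>) (t \<nu>) - 1) (i (lam \<nu>), t \<nu>)) + thr_size \<sigma> (c \<nu>) (t \<nu>)
        = A (lam \<nu>) (t \<nu>) * thr_size \<sigma> (i (lam \<nu>)) (t \<nu>)"
      using weight_replicate[OF ir ts] A_pos[OF \<nu>] c_eq[OF \<nu>]
      by (cases "A (lam \<nu>) (t \<nu>)") auto
    moreover have "(\<Sum>j=t \<nu>..s. A (lam \<nu>) j * thr_size \<sigma> (i (lam \<nu>)) j) =
       A (lam \<nu>) (t \<nu>) * thr_size \<sigma> (i (lam \<nu>)) (t \<nu>) + (\<Sum>j\<in>{t \<nu><..s}. A (lam \<nu>) j * thr_size \<sigma> (i (lam \<nu>)) j)"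
      using ts by (simp add: sum.head)
    ultimately show ?thesis by simp
  qed
  have 3: "weight \<sigma> (\<Sum>q\<in>{l (\<nu> - 1) + 1..lam \<nu> - 1}. \<Sum>j\<in>{t \<nu>..s}. replicate_mset (A q j) (i q, j))
     = (\<Sum>q\<in>{l (\<nu> - 1) + 1..lam \<nu> - 1}. \<Sum>j\<in>{t \<nu>..s}. A q j * thr_size \<sigma> (i q) j)"
    unfolding weight_sum using lr by (intro sum.cong refl weight_replicate i_range(1)) auto
  have 4: "(\<Sum>q=l (\<nu> - 1) + 1..l \<nu>. \<Sum>j=tau (i q)..s. A q j * thr_size \<sigma> (i q) j) =
     (\<Sum>q=l (\<nu> - 1) + 1..l \<nu>. \<Sum>j=t \<nu>..s. A q j * thr_size \<sigma> (i q) j)"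
    using tau_i(2)[OF \<nu>] by (intro sum.cong refl) simp
  have "{l (\<nu> - 1) + 1..l \<nu>} = insert (lam \<nu>) {l (\<nu> - 1) + 1..lam \<nu> - 1}"
    using l_less[OF \<nu>] l_eq[OF \<nu>] by auto
  moreover have "lam \<nu> \<notin> {l (\<nu> - 1) + 1..lam \<nu> - 1}" using lr by auto
  ultimately have 5: "(\<Sum>q=l (\<nu> - 1) + 1..l \<nu>. \<Sum>j=t \<nu>..s. A q j * thr_size \<sigma> (i q) j) =
     (\<Sum>j=t \<nu>..s. A (lam \<nu>) j * thr_size \<sigma> (i (lam \<nu>)) j) +
     (\<Sum>q\<in>{l (\<nu> - 1) + 1..lam \<nu> - 1}. \<Sum>j\<in>{t \<nu>..s}. A q j * thr_size \<sigma> (i q) j)"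
    by (simp only: sum.insert[OF finite_atLeastAtMost] not_False_eq_True)
  show ?thesis
    unfolding socle_factor_def weight_union 1 4 5 3[folded l_def] using 2 3 unfolding l_def by linarith
qed

text \<open>
  The threshold function \<open>tau\<close> jumps exactly at the end points \<open>c \<nu>\<close> with \<open>\<nu> < a\<close>.
\<close>

lemma sum_jumps:
  fixes g :: "nat \<Rightarrow> nat \<Rightarrow> int"
  shows "(\<Sum>k\<in>{1..<n}. g k (tau (Suc k)) - g k (tau k)) = (\<Sum>\<nu>\<in>{1..<a}. g (c \<nu>) (t (\<nu> + 1)) - g (c \<nu>) (t \<nu>))"
proof -
  have c_strict: "c \<nu> < c \<mu>" if "\<nu> < \<mu>" "\<mu> \<le> a" for \<nu> \<mu>
  proof -
    have "c \<nu> \<le> c (\<mu> - 1)" using that by (intro c_mono) auto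
    also have "\<dots> < c \<mu>" using that by (intro c_less) auto
    finally show ?thesis .
  qed
  have inj: "inj_on c {1..<a}"
  proof (rule inj_onI)
    fix x y assume "x \<in> {1..<a}" "y \<in> {1..<a}" "c x = c y"
    then show "x = y" using c_strict[of x y] c_strict[of y x] by (cases x y rule: linorder_cases) auto
  qed
  have sub: "c ` {1..<a} \<subseteq> {1..<n}"
  proof
    fix k assume "k \<in> c ` {1..<a}"
    then obtain \<nu> where "\<nu> \<in> {1..<a}" "k = c \<nu>" by blast
    then show "k \<in> {1..<n}" using c_strict[of 0 \<nu>] c_strict[of \<nu> a] c_0 c_last by simp
  qed
  have "(\<Sum>k\<in>{1..<n}. g k (tau (Suc k)) - g k (tau k)) = (\<Sum>k\<in>c ` {1..<a}. g k (tau (Suc k)) - g k (tau k))"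
  proof (rule sum.mono_neutral_right[OF _ sub], simp, intro ballI)
    fix k assume k: "k \<in> {1..<n} - c ` {1..<a}"
    then have "k \<in> {1..n}" by auto
    then obtain \<nu> where \<nu>: "\<nu> \<in> {1..a}" "c (\<nu> - 1) < k" "k \<le> c \<nu>" by (rule in_level)
    have "k \<noteq> c \<nu>" using k \<nu>(1) c_last by (cases "\<nu> = a") auto
    then show "g k (tau (Suc k)) - g k (tau k) = 0"
      using tau_eq[OF \<nu>] tau_eq[OF \<nu>(1), of "Suc k"] \<nu> by simp
  qed
  also have "\<dots> = (\<Sum>\<nu>\<in>{1..<a}. g (c \<nu>) (tau (Suc (c \<nu>))) - g (c \<nu>) (tau (c \<nu>)))"
    by (simp only: sum.reindex[OF inj] comp_def)
  also have "\<dots> = (\<Sum>\<nu>\<in>{1..<a}. g (c \<nu>) (t (\<nu> + 1)) - g (c \<nu>) (t \<nu>))"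
  proof (rule sum.cong[OF refl])
    fix \<nu> assume \<nu>: "\<nu> \<in> {1..<a}"
    have "tau (Suc (c \<nu>)) = t (\<nu> + 1)" using \<nu> c_less[of "\<nu> + 1"] by (intro tau_eq) auto
    moreover have "tau (c \<nu>) = t \<nu>" using \<nu> c_less[of \<nu>] by (intro tau_eq) auto
    ultimately show "g (c \<nu>) (tau (Suc (c \<nu>))) - g (c \<nu>) (tau (c \<nu>)) = g (c \<nu>) (t (\<nu> + 1)) - g (c \<nu>) (t \<nu>)" by simp
  qed
  finally show ?thesis .
qed

lemma socle_pieces_remaining: "socle_pieces all_pieces tau remaining"
  unfolding socle_pieces_def
proof (intro allI impI)
  fix \<sigma> assume \<sigma>: "threshold \<sigma>"
  define W where "W = (\<lambda>k j. int (thr_size \<sigma> k j))"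
  have last: "(\<Sum>k=1..m. g k) = (\<Sum>k\<in>{1..<m}. g k) + g m" if "1 \<le> m" for m and g :: "nat \<Rightarrow> int"
    using that by (metis add.commute sum.last_plus)
  have U: "weight (\<lambda>k. max (tau k) (\<sigma> k)) all_pieces = (\<Sum>q=1..r. \<Sum>j=tau (i q)..s. A q j * thr_size \<sigma> (i q) j)"
    unfolding weight_all_pieces
    by (intro sum.cong refl sum.mono_neutral_cong_right) (auto simp: thr_size_def)
  have "(\<Sum>\<nu>=1..a. weight \<sigma> (socle_factor a lam t \<nu>) + thr_size \<sigma> (c \<nu>) (t \<nu>)) =
      (\<Sum>\<nu>=1..a. if \<nu> = a then 0 else thr_size \<sigma> (c \<nu>) (t (\<nu> + 1))) +
      (\<Sum>\<nu>=1..a. \<Sum>q=l (\<nu> - 1) + 1..l \<nu>. \<Sum>j=tau (i q)..s. A q j * thr_size \<sigma> (i q) j)"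
    using weight_socle_factor by (simp add: sum.distrib)
  also have "(\<Sum>\<nu>=1..a. \<Sum>q=l (\<nu> - 1) + 1..l \<nu>. \<Sum>j=tau (i q)..s. A q j * thr_size \<sigma> (i q) j)
    = (\<Sum>q=1..r. \<Sum>j=tau (i q)..s. A q j * thr_size \<sigma> (i q) j)"
    using sum_consecutive[of a l] l_less l_0 unfolding l_last by (simp add: less_imp_le)
  also have "(\<Sum>\<nu>=1..a. if \<nu> = a then 0 else thr_size \<sigma> (c \<nu>) (t (\<nu> + 1))) =
      (\<Sum>\<nu>\<in>{1..<a}. thr_size \<sigma> (c \<nu>) (t (\<nu> + 1)))"
    by (intro sum.mono_neutral_cong_right) auto
  finally have "weight \<sigma> remaining + (\<Sum>\<nu>=1..a. thr_size \<sigma> (c \<nu>) (t \<nu>)) =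
      (\<Sum>\<nu>\<in>{1..<a}. thr_size \<sigma> (c \<nu>) (t (\<nu> + 1))) + weight (\<lambda>k. max (tau k) (\<sigma> k)) all_pieces"
    unfolding remaining_def weight_sum U by (simp add: sum.distrib)
  then have e1: "int (weight \<sigma> remaining) + (\<Sum>\<nu>=1..a. W (c \<nu>) (t \<nu>)) =
      (\<Sum>\<nu>\<in>{1..<a}. W (c \<nu>) (t (\<nu> + 1))) + int (weight (\<lambda>k. max (tau k) (\<sigma> k)) all_pieces)"
    unfolding W_def of_nat_sum[symmetric] of_nat_add[symmetric] of_nat_eq_iff .
  have e2: "(\<Sum>k\<in>{1..<n}. W k (tau (Suc k))) - (\<Sum>k\<in>{1..<n}. W k (tau k)) =
      (\<Sum>\<nu>\<in>{1..<a}. W (c \<nu>) (t (\<nu> + 1))) - (\<Sum>\<nu>\<in>{1..<a}. W (c \<nu>) (t \<nu>))"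
    unfolding sum_subtractf[symmetric] by (rule sum_jumps)
  have e3: "W n (tau n) = W (c a) (t a)"
    using tau_eq[of a n] c_less[of a] c_last a_pos by simp
  have "int (weight \<sigma> remaining) + (\<Sum>k=1..n. W k (tau k)) =
     int (weight (\<lambda>k. max (tau k) (\<sigma> k)) all_pieces) + (\<Sum>k\<in>{1..<n}. W k (tau (Suc k)))"
    using e1 e2 e3 last[OF n_pos, of "\<lambda>k. W k (tau k)"] last[OF a_pos, of "\<lambda>\<nu>. W (c \<nu>) (t \<nu>)"] by linarith
  then show "weight \<sigma> remaining + (\<Sum>k=1..n. thr_size \<sigma> k (tau k)) =
     weight (\<lambda>k. max (tau k) (\<sigma> k)) all_pieces + (\<Sum>k\<in>{1..<n}. thr_size \<sigma> k (tau (Suc k)))"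
    unfolding W_def of_nat_sum[symmetric] of_nat_add[symmetric] of_nat_eq_iff .
qed

lemma J_ideal_eq:
  "J_ideal n d s i \<alpha> a lam t =
    (mspan n {socle_exponent tau + m |m. packs remaining (Poly_Mapping.lookup m)} :: ('k::field) mpol set)"
proof -
  interpret C: Group.comm_monoid "ideals n :: 'k mpol set ring" by (rule ideals_comm_monoid)
  have pi: "x \<in> pieces \<longleftrightarrow> fst x \<in> {1..n} \<and> snd x \<le> s" for x
    by (cases x) (auto simp: pieces_def)
  have pm: "(\<Prod>x\<in>B. pmonom (f x)) = (pmonom (\<Sum>x\<in>B. f x) :: 'k mpol)" if "finite B" for B :: "nat set" and f
    using that by (induction B rule: finite_induct) (auto simp: pmonom_mult, simp add: pmonom_def)
  have mon: "(\<Prod>e=1..a. (\<Prod>k\<in>{c (e - 1) + 1..c e}. X k) ^ (d (t e) - 1)) = (pmonom (socle_exponent tau) :: 'k mpol)"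
  proof -
    have "(\<Prod>e=1..a. (\<Prod>k\<in>{c (e - 1) + 1..c e}. X k) ^ (d (t e) - 1)) =
       (pmonom (\<Sum>e=1..a. \<Sum>k=c (e - 1) + 1..c e. Poly_Mapping.single k (d (t e) - 1)) :: 'k mpol)"
      by (simp only: prod_power_distrib X_power pm[OF finite_atLeastAtMost])
    also have "(\<Sum>e=1..a. \<Sum>k=c (e - 1) + 1..c e. Poly_Mapping.single k (d (t e) - 1)) =
       (\<Sum>e=1..a. \<Sum>k=c (e - 1) + 1..c e. Poly_Mapping.single k (d (tau k) - 1))"
      using tau_eq by (intro sum.cong refl) auto
    also have "\<dots> = socle_exponent tau"
      unfolding socle_exponent_def using sum_consecutive[of a c] c_less c_0 c_last by (simp add: less_imp_le)
    finally show ?thesis .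
  qed
  have fac: "(if \<nu> = a then carrier (poly_ring n) else frob_ideal n (i (l \<nu>)) (d (t (\<nu> + 1))))
           \<otimes>\<^bsub>ideals n\<^esub>
           (\<Otimes>\<^bsub>ideals n\<^esub>j\<in>{t \<nu><..s}. frob_ideal n (i (l \<nu>)) (d j) [^]\<^bsub>ideals n\<^esub> A (l \<nu>) j)
           \<otimes>\<^bsub>ideals n\<^esub>
           (frob_ideal n (i (l \<nu>)) (d (t \<nu>)) [^]\<^bsub>ideals n\<^esub> (A (l \<nu>) (t \<nu>) - 1))
           \<otimes>\<^bsub>ideals n\<^esub>
           (\<Otimes>\<^bsub>ideals n\<^esub>q\<in>{l (\<nu> - 1) + 1..l \<nu> - 1}. \<Otimes>\<^bsub>ideals n\<^esub>j\<in>{t \<nu>..s}.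
              frob_ideal n (i q) (d j) [^]\<^bsub>ideals n\<^esub> A q j) = (pack_ideal (socle_factor a lam t \<nu>) :: 'k mpol set)"
    (is "?F1 \<otimes>\<^bsub>_\<^esub> ?F2 \<otimes>\<^bsub>_\<^esub> ?F3 \<otimes>\<^bsub>_\<^esub> ?F4 = _")
    and fac_pieces: "set_mset (socle_factor a lam t \<nu>) \<subseteq> pieces"
    if \<nu>: "\<nu> \<in> {1..a}" for \<nu>
  proof -
    note ir = i_range(1)[OF lam_range[OF \<nu>]]
    have qr: "q \<in> {1..r}" if "q \<in> {l (\<nu> - 1) + 1..lam \<nu> - 1}" for q
      using that lam_range[OF \<nu>] by auto
    define N1 where "N1 = (if \<nu> = a then {#} else {#(i (lam \<nu>), t (\<nu> + 1))#})"
    define N2 where "N2 = (\<Sum>j\<in>{t \<nu><..s}. replicate_mset (A (lam \<nu>) j) (i (lam \<nu>), j))"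
    define N3 where "N3 = replicate_mset (A (lam \<nu>) (t \<nu>) - 1) (i (lam \<nu>), t \<nu>)"
    define N4 where "N4 = (\<Sum>q\<in>{l (\<nu> - 1) + 1..lam \<nu> - 1}. \<Sum>j\<in>{t \<nu>..s}. replicate_mset (A q j) (i q, j))"
    have sf: "socle_factor a lam t \<nu> = N1 + N2 + N3 + N4"
      by (simp add: socle_factor_def N1_def N2_def N3_def N4_def l_def)
    have P1: "set_mset N1 \<subseteq> pieces" using ir t_range[of "\<nu> + 1"] \<nu> by (auto simp: N1_def pi)
    have P2: "set_mset N2 \<subseteq> pieces" using ir by (auto simp: N2_def pi set_mset_sum split: if_splits)
    have P3: "set_mset N3 \<subseteq> pieces" using ir t_range[OF \<nu>] by (auto simp: N3_def pi split: if_splits)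
    have P4': "set_mset (\<Sum>j\<in>{t \<nu>..s}. replicate_mset (A q j) (i q, j)) \<subseteq> pieces" if "q \<in> {l (\<nu> - 1) + 1..lam \<nu> - 1}" for q
      using i_range(1)[OF qr[OF that]] by (auto simp: pi set_mset_sum split: if_splits)
    then have P4: "set_mset N4 \<subseteq> pieces" by (fastforce simp: N4_def set_mset_sum)
    show "set_mset (socle_factor a lam t \<nu>) \<subseteq> pieces" using P1 P2 P3 P4 by (simp add: sf)
    have "?F1 = pack_ideal N1"
      using ir t_range[of "\<nu> + 1"] \<nu> l_eq[OF \<nu>] by (simp add: N1_def pack_ideal_empty frob_ideal_pack)
    moreover have "?F2 = pack_ideal N2"
      unfolding N2_def l_eq[OF \<nu>]
      by (rule finprod_pack_ideal) (use ir in \<open>auto simp: pi frob_ideal_pow_pack split: if_splits\<close>)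
    moreover have "?F3 = pack_ideal N3"
      unfolding N3_def l_eq[OF \<nu>] by (rule frob_ideal_pow_pack[OF ir t_range[OF \<nu>]])
    moreover have "?F4 = pack_ideal N4"
      unfolding N4_def l_eq[OF \<nu>]
    proof (rule finprod_pack_ideal)
      fix q assume q: "q \<in> {l (\<nu> - 1) + 1..lam \<nu> - 1}"
      show "(\<Otimes>\<^bsub>ideals n\<^esub>j\<in>{t \<nu>..s}. frob_ideal n (i q) (d j) [^]\<^bsub>ideals n\<^esub> A q j)
         = (pack_ideal (\<Sum>j\<in>{t \<nu>..s}. replicate_mset (A q j) (i q, j)) :: 'k mpol set)"
        by (rule finprod_pack_ideal)
          (use i_range(1)[OF qr[OF q]] in \<open>auto simp: pi frob_ideal_pow_pack split: if_splits\<close>)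
    qed (use P4' in auto)
    ultimately show "?F1 \<otimes>\<^bsub>ideals n\<^esub> ?F2 \<otimes>\<^bsub>ideals n\<^esub> ?F3 \<otimes>\<^bsub>ideals n\<^esub> ?F4 = (pack_ideal (socle_factor a lam t \<nu>) :: 'k mpol set)"
      by (simp only: sf pack_ideal_union[OF P2] pack_ideal_union[OF P3] pack_ideal_union[OF P4])
  qed
  have "J_ideal n d s i \<alpha> a lam t =
     Idl\<^bsub>poly_ring n\<^esub> {pmonom (socle_exponent tau)} \<otimes>\<^bsub>ideals n\<^esub> (pack_ideal remaining :: 'k mpol set)"
    unfolding J_ideal_def Let_def l_def[symmetric] remaining_def
    using mon[unfolded c_def] finprod_pack_ideal[where A = "{1..a}" and g = "socle_factor a lam t", OF finite_atLeastAtMost fac_pieces fac] by (simp only:)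
  also have "Idl\<^bsub>poly_ring n\<^esub> {pmonom (socle_exponent tau)} = (mspan n {x + socle_exponent tau |x. True} :: 'k mpol set)"
  proof -
    have "Poly_Mapping.keys (socle_exponent tau) \<subseteq> {1..n}"
      by (auto simp: in_keys_iff lookup_socle_exponent split: if_splits)
    then show ?thesis using genideal_pmonom[of "{socle_exponent tau}" n, where 'k = 'k] by simp
  qed
  also have "\<dots> \<otimes>\<^bsub>ideals n\<^esub> (pack_ideal remaining :: 'k mpol set) =
     mspan n {x + y |x y. x \<in> {x + socle_exponent tau |x. True} \<and> y \<in> {m. packs remaining (Poly_Mapping.lookup m)}}"
    unfolding pack_ideal_def
  proof (subst ideal_prod_mspan[symmetric])
    show "up_closed {x + socle_exponent tau |x. True}"
      unfolding up_closed_def by clarsimp (metis add.assoc)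
  qed (simp_all add: up_closed_packs ideals_set_def)
  also have "{x + y |x y. x \<in> {x + socle_exponent tau |x. True} \<and> y \<in> {m. packs remaining (Poly_Mapping.lookup m)}} =
     {socle_exponent tau + m |m. packs remaining (Poly_Mapping.lookup m)}"
  proof (intro equalityI subsetI)
    fix z assume "z \<in> {x + y |x y. x \<in> {x + socle_exponent tau |x. True} \<and> y \<in> {m. packs remaining (Poly_Mapping.lookup m)}}"
    then obtain x y where z: "z = x + socle_exponent tau + y" "packs remaining (Poly_Mapping.lookup y)" by auto
    have "packs remaining (Poly_Mapping.lookup (x + y))" by (rule packs_mono[OF z(2)]) (simp add: lookup_add)
    moreover have "z = socle_exponent tau + (x + y)" using z(1) by (simp add: ac_simps)
    ultimately show "z \<in> {socle_exponent tau + m |m. packs remaining (Poly_Mapping.lookup m)}" by blast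
  next
    fix z assume "z \<in> {socle_exponent tau + m |m. packs remaining (Poly_Mapping.lookup m)}"
    then obtain m where "z = 0 + socle_exponent tau + m" "packs remaining (Poly_Mapping.lookup m)" by auto
    then show "z \<in> {x + y |x y. x \<in> {x + socle_exponent tau |x. True} \<and> y \<in> {m. packs remaining (Poly_Mapping.lookup m)}}" by blast
  qed
  finally show ?thesis .
qed

lemma ideal_J_ideal: "ideal (J_ideal n d s i \<alpha> a lam t :: ('k::field) mpol set) (poly_ring n)"
  unfolding J_ideal_eq
proof (rule ideal_mspan, unfold up_closed_def, intro ballI allI)
  fix x y assume "x \<in> {socle_exponent tau + m |m. packs remaining (Poly_Mapping.lookup m)}"
  then obtain m where m: "x = socle_exponent tau + m" "packs remaining (Poly_Mapping.lookup m)" by auto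
  have "packs remaining (Poly_Mapping.lookup (y + m))" by (rule packs_mono[OF m(2)]) (simp add: lookup_add)
  moreover have "y + x = socle_exponent tau + (y + m)" using m(1) by (simp add: ac_simps)
  ultimately show "y + x \<in> {socle_exponent tau + m |m. packs remaining (Poly_Mapping.lookup m)}" by blast
qed

lemma socle_mult_packs:
  assumes "packs remaining (Poly_Mapping.lookup m)" "k \<in> {1..n}"
  shows "packs all_pieces (Poly_Mapping.lookup (socle_exponent tau + m + Poly_Mapping.single k 1))"
proof -
  have "packs all_pieces (\<lambda>k'. Poly_Mapping.lookup m k' + (d (tau k') - 1) + (if k' = k then 1 else 0))"
  proof (rule packs_socle_mult[OF tau_threshold tau_range _ _ socle_pieces_remaining assms])
    fix k x y assume xy: "x \<le> y" "y \<le> s"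
    show "(\<Sum>j=x..<y. count all_pieces (k, j) * d j) + d x \<le> d y"
    proof (cases "k \<in> i ` {1..r}")
      case True
      then obtain q where q: "q \<in> {1..r}" "k = i q" by auto
      have "(\<Sum>j=x..<y. count all_pieces (k, j) * d j) = (\<Sum>j=x..<y. A q j * d j)"
        using xy q by (intro sum.cong) (auto simp: count_all_pieces)
      then show ?thesis using digit_sum_le[OF xy, of "\<alpha> q"] by simp
    next
      case False
      then have "count all_pieces (k, j) = 0" for j
        using count_all_pieces_pos[of k j] by (metis image_eqI neq0_conv)
      then show ?thesis using d_mono[OF xy] by simp
    qed
  next
    show "count all_pieces (1, j) = 0" for j
    proof (rule ccontr)
      assume "count all_pieces (1, j) \<noteq> 0"
      then have "0 < count all_pieces (1, j)" by blast
      then obtain q where "q \<in> {1..r}" "1 = i q" by (rule count_all_pieces_pos)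
      then show False using i_range(2)[of q] by simp
    qed
  qed
  then show ?thesis
    by (rule packs_mono) (auto simp: lookup_add lookup_socle_exponent lookup_single when_def)
qed

end

section \<open>The socle\<close>

context principal_d_fixed begin

lemma socle_indexI: "a \<in> {1..r} \<Longrightarrow> (lam, t) \<in> P_set d s r \<alpha> a \<Longrightarrow> socle_index n d s r i \<alpha> a lam t"
  by unfold_locales auto

text \<open>
  The tuple \<open>lam\<close> enumerates the indices \<open>q\<close> for which \<open>\<tau>\<close> jumps at \<open>i q\<close>, together with \<open>r\<close>. By hypothesis
  every jump occurs at some \<open>i q\<close>, because only there are pieces positioned, and the digit required to be
  nonzero in \<^const>\<open>P_set\<close> is the multiplicity of the piece \<open>(k, \<tau> k)\<close>.
\<close>

lemma ex_index_of_threshold: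
  assumes thr: "threshold \<tau>" and t: "\<And>k. k \<in> {1..n} \<Longrightarrow> \<tau> k \<le> s"
    and jump: "\<And>k. k \<in> {1..n} \<Longrightarrow> (k < n \<Longrightarrow> \<tau> k < \<tau> (Suc k)) \<Longrightarrow> 0 < count all_pieces (k, \<tau> k)"
  obtains a lam t where "a \<in> {1..r}" "(lam, t) \<in> P_set d s r \<alpha> a"
    "\<And>k. k \<in> {1..n} \<Longrightarrow> socle_index.tau i lam t k = \<tau> k"
proof -
  have tmono: "\<tau> x \<le> \<tau> y" if "x \<in> {1..n}" "y \<in> {1..n}" "x \<le> y" for x y
    using thr that unfolding threshold_def by (auto intro: mono_onD)
  define Q where "Q = {q \<in> {1..r}. i q < n \<longrightarrow> \<tau> (i q) < \<tau> (Suc (i q))}"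
  define a where "a = card Q"
  have finQ: "finite Q" by (simp add: Q_def)
  have rQ: "r \<in> Q" using r_pos i_last by (simp add: Q_def)
  have ar: "a \<in> {1..r}"
  proof -
    have "a \<le> card {1..r}" unfolding a_def by (rule card_mono) (auto simp: Q_def)
    moreover have "0 < a" unfolding a_def using rQ finQ by (auto simp: card_gt_0_iff)
    ultimately show ?thesis by simp
  qed
  obtain h where h: "bij_betw h {..<a} Q" "strict_mono_on {..<a} h"
    using ex_bij_betw_strict_mono_card[OF finQ] unfolding a_def by blast
  define lam where "lam = restrict (\<lambda>\<nu>. h (\<nu> - 1)) {1..a}"
  define t where "t = restrict (\<lambda>\<nu>. \<tau> (i (lam \<nu>))) {1..a}"
  have lamQ: "lam \<nu> \<in> Q" if "\<nu> \<in> {1..a}" for \<nu>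
  proof -
    have "\<nu> - 1 \<in> {..<a}" using that by auto
    then show ?thesis using that bij_betwE[OF h(1)] by (simp add: lam_def)
  qed
  have Qlam: "\<exists>\<nu>\<in>{1..a}. q = lam \<nu>" if "q \<in> Q" for q
  proof -
    have "q \<in> h ` {..<a}" using h(1) that by (simp add: bij_betw_def)
    then obtain x where "x < a" "q = h x" by auto
    then show ?thesis by (intro bexI[of _ "Suc x"]) (auto simp: lam_def)
  qed
  have Q1: "q \<in> {1..r}" if "q \<in> Q" for q using that by (simp add: Q_def)
  have lmono: "strict_mono_on {1..a} lam"
  proof (rule strict_mono_onI)
    fix x y assume "x \<in> {1..a}" "y \<in> {1..a}" "x < y"
    then show "lam x < lam y" using strict_mono_onD[OF h(2), of "x - 1" "y - 1"] by (auto simp: lam_def)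
  qed
  have last: "lam a = r"
  proof -
    obtain \<nu> where \<nu>: "\<nu> \<in> {1..a}" "r = lam \<nu>" using Qlam[OF rQ] by blast
    have aa: "a \<in> {1..a}" using ar by simp
    have "r \<le> lam a" using strict_mono_on_leD[OF lmono \<nu>(1) aa] \<nu> by simp
    then show ?thesis using Q1[OF lamQ[OF aa]] by simp
  qed
  have P: "(lam, t) \<in> P_set d s r \<alpha> a"
    unfolding P_set_def
  proof (simp only: mem_Collect_eq case_prod_conv, intro conjI ballI)
    show "lam \<in> extensional {1..a}" "t \<in> extensional {1..a}" by (auto simp: lam_def t_def)
    show "1 \<le> lam 1" using Q1[OF lamQ[of 1]] ar by simp
    show "strict_mono_on {1..a} lam" by (rule lmono)
    show "lam a = r" by (rule last)
    show "strict_mono_on {1..a} t"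
    proof (rule strict_mono_onI)
      fix x y assume xy: "x \<in> {1..a}" "y \<in> {1..a}" "x < y"
      note q = lamQ[OF xy(1)] lamQ[OF xy(2)]
      note ir = i_range(1)[OF Q1[OF q(1)]] i_range(1)[OF Q1[OF q(2)]]
      have less: "i (lam x) < i (lam y)"
        using strict_mono_onD[OF i_mono Q1[OF q(1)] Q1[OF q(2)]] strict_mono_onD[OF lmono xy] by simp
      then have "\<tau> (i (lam x)) < \<tau> (Suc (i (lam x)))" using q(1) ir by (simp add: Q_def)
      also have "\<dots> \<le> \<tau> (i (lam y))" using less ir by (intro tmono) auto
      finally show "t x < t y" using xy by (simp add: t_def)
    qed
    show "t a \<le> s" using ar i_last last t[of n] n_pos by (simp add: t_def)
    fix \<nu> assume \<nu>: "\<nu> \<in> {1..a}"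
    note q = lamQ[OF \<nu>]
    have "0 < count all_pieces (i (lam \<nu>), \<tau> (i (lam \<nu>)))"
      using q by (intro jump i_range(1) Q1) (auto simp: Q_def)
    then have "A (lam \<nu>) (\<tau> (i (lam \<nu>))) \<noteq> 0" using count_all_pieces[OF Q1[OF q]] by (auto split: if_splits)
    then show "A (lam \<nu>) (t \<nu>) \<noteq> 0" using \<nu> by (simp add: t_def)
  qed
  interpret socle_index n d s r i \<alpha> a lam t by (rule socle_indexI[OF ar P])
  have "tau k = \<tau> k" if k: "k \<in> {1..n}" for k
  proof -
    obtain \<nu> where \<nu>: "\<nu> \<in> {1..a}" "c (\<nu> - 1) < k" "k \<le> c \<nu>" by (rule in_level[OF k])
    have cn: "c \<nu> \<le> n" using c_mono[of \<nu> a] \<nu>(1) c_last by simp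
    have "\<tau> k = \<tau> x" if "k \<le> x" "x \<le> c \<nu>" for x
      using that
    proof (induction x rule: dec_induct)
      case (step x)
      have xn: "x \<in> {1..n}" "x < n" using step k cn by auto
      have "\<tau> x = \<tau> (Suc x)"
      proof (rule ccontr)
        assume "\<tau> x \<noteq> \<tau> (Suc x)"
        then have less: "\<tau> x < \<tau> (Suc x)" using tmono[of x "Suc x"] xn by simp
        then have "0 < count all_pieces (x, \<tau> x)" using jump xn by simp
        then obtain q where q: "q \<in> {1..r}" "x = i q" by (rule count_all_pieces_pos)
        then have "q \<in> Q" using less by (simp add: Q_def)
        then obtain \<mu> where \<mu>: "\<mu> \<in> {1..a}" "q = lam \<mu>" using Qlam by blast
        then have "x = c \<mu>" using q c_eq by simp
        moreover have "c \<mu> \<le> c (\<nu> - 1) \<or> c \<nu> \<le> c \<mu>"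
          using c_mono[of \<mu> "\<nu> - 1"] c_mono[of \<nu> \<mu>] \<mu>(1) \<nu>(1) by (cases "\<mu> < \<nu>") auto
        ultimately show False using step \<nu> by linarith
      qed
      then show ?case using step by simp
    qed simp
    from this[of "c \<nu>"] have "\<tau> k = \<tau> (c \<nu>)" using \<nu>(3) by simp
    then show ?thesis using tau_eq[OF \<nu>] \<nu>(1) c_eq by (simp add: t_def)
  qed
  then show ?thesis using that[OF ar P] by blast
qed

lemma socle_monomial:
  assumes keys: "Poly_Mapping.keys m \<subseteq> {1..n}"
    and notin: "\<not> packs all_pieces (Poly_Mapping.lookup m)"
    and soc: "\<And>k. k \<in> {1..n} \<Longrightarrow> packs all_pieces (Poly_Mapping.lookup (m + Poly_Mapping.single k 1))"
  obtains a lam t where "a \<in> {1..r}" "(lam, t) \<in> P_set d s r \<alpha> a"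
    "pmonom m \<in> (J_ideal n d s i \<alpha> a lam t :: ('k::field) mpol set)"
proof -
  define w where "w = Poly_Mapping.lookup m"
  have soc': "packs all_pieces (\<lambda>k. w k + (if k = k0 then 1 else 0))" if "k0 \<in> {1..n}" for k0
    using soc[OF that] by (rule packs_mono) (auto simp: lookup_add lookup_single when_def w_def)
  obtain \<tau> where mx: "max_deficient all_pieces w \<tau>"
    using ex_max_deficient[OF notin] unfolding w_def by blast
  have def: "deficient all_pieces w \<tau>" and thr: "threshold \<tau>"
    using mx by (auto simp: max_deficient_def deficient_def)
  have ts: "\<tau> k \<le> s" if "k \<in> {1..n}" for k
    by (rule deficient_socle(1)[OF def]) (use soc' that in blast)+
  have dv: "d (\<tau> k) dvd Suc (w k)" if "k \<in> {1..n}" for k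
    by (rule deficient_socle(2)[OF def]) (use soc' that in blast)+
  obtain a lam t where aP: "a \<in> {1..r}" "(lam, t) \<in> P_set d s r \<alpha> a"
    and eq: "\<And>k. k \<in> {1..n} \<Longrightarrow> socle_index.tau i lam t k = \<tau> k"
    by (rule ex_index_of_threshold[OF thr ts max_deficient_jump[OF mx _ ts]]) auto
  interpret socle_index n d s r i \<alpha> a lam t by (rule socle_indexI[OF aP])
  have "socle_pieces all_pieces tau remaining = socle_pieces all_pieces \<tau> remaining"
    by (rule socle_pieces_cong) (rule eq)
  then have B: "socle_pieces all_pieces \<tau> remaining" using socle_pieces_remaining by simp
  have "packs remaining (\<lambda>k. w k - (d (\<tau> k) - 1))"
    by (intro packs_socle_quotient[OF mx] soc' B)
  then have "packs remaining (Poly_Mapping.lookup (m - socle_exponent tau))"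
    by (rule packs_mono) (simp add: lookup_minus lookup_socle_exponent w_def eq)
  moreover have "m = socle_exponent tau + (m - socle_exponent tau)"
  proof (rule poly_mapping_eqI)
    fix k
    show "Poly_Mapping.lookup m k = Poly_Mapping.lookup (socle_exponent tau + (m - socle_exponent tau)) k"
    proof (cases "k \<in> {1..n}")
      case True
      then have "d (tau k) \<le> Suc (Poly_Mapping.lookup m k)"
        using dv[OF True] eq[OF True] by (auto simp: w_def intro!: dvd_imp_le)
      then show ?thesis by (simp add: lookup_add lookup_minus lookup_socle_exponent)
    qed (auto simp: lookup_add lookup_minus lookup_socle_exponent)
  qed
  ultimately have "pmonom m \<in> (J_ideal n d s i \<alpha> a lam t :: 'k mpol set)"
    unfolding J_ideal_eq pmonom_mspan using keys by blast
  then show ?thesis by (rule that[OF aP])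
qed

text \<open>
  The exponent vectors of the monomials which all variables multiply into the principal d-fixed ideal.
\<close>

definition colon_exponents :: "(nat \<Rightarrow>\<^sub>0 nat) set" where
  "colon_exponents = {m. \<forall>k\<in>{1..n}. packs all_pieces (Poly_Mapping.lookup (m + Poly_Mapping.single k 1))}"

lemma up_closed_colon: "up_closed colon_exponents"
  unfolding up_closed_def colon_exponents_def
  by (auto simp: lookup_add intro: packs_mono)

lemma sum_J_eq:
  "J_sum n d s r i \<alpha> <+>\<^bsub>poly_ring n\<^esub> pack_ideal all_pieces = (mspan n colon_exponents :: ('k::field) mpol set)"
proof -
  interpret S: cring "poly_ring n :: 'k mpol ring" by (rule cring_poly_ring)
  have Jid: "ideal (J_ideal n d s i \<alpha> a (fst p) (snd p) :: 'k mpol set) (poly_ring n)"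
    and Jsub: "(J_ideal n d s i \<alpha> a (fst p) (snd p) :: 'k mpol set) \<subseteq> mspan n colon_exponents"
    if ap: "a \<in> {1..r}" "p \<in> P_set d s r \<alpha> a" for a p
  proof -
    interpret socle_index n d s r i \<alpha> a "fst p" "snd p" by (rule socle_indexI) (use ap in auto)
    show "ideal (J_ideal n d s i \<alpha> a (fst p) (snd p) :: 'k mpol set) (poly_ring n)" by (rule ideal_J_ideal)
    show "(J_ideal n d s i \<alpha> a (fst p) (snd p) :: 'k mpol set) \<subseteq> mspan n colon_exponents"
      unfolding J_ideal_eq mspan_def colon_exponents_def using socle_mult_packs by blast
  qed
  define Ja :: "nat \<Rightarrow> 'k mpol set"
    where "Ja = (\<lambda>a. \<Oplus>\<^bsub>ideals n\<^esub>p\<in>P_set d s r \<alpha> a. J_ideal n d s i \<alpha> a (fst p) (snd p))"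
  have Ja: "ideal (Ja a) (poly_ring n)" if a: "a \<in> {1..r}" for a
    unfolding Ja_def by (rule finsum_ideals(1)[OF finite_P_set]) (rule Jid[OF a])
  have Ja_ge: "J_ideal n d s i \<alpha> a (fst p) (snd p) \<subseteq> Ja a"
    if a: "a \<in> {1..r}" and p: "p \<in> P_set d s r \<alpha> a" for a p
    unfolding Ja_def by (rule finsum_ideals(2)[OF finite_P_set _ p]) (rule Jid[OF a])
  have Ja_le: "Ja a \<subseteq> mspan n colon_exponents" if a: "a \<in> {1..r}" for a
    unfolding Ja_def
    by (rule finsum_ideals(3)[OF finite_P_set _ ideal_mspan[OF up_closed_colon]])
      (use Jid[OF a] Jsub[OF a] in auto)
  define J :: "'k mpol set" where "J = J_sum n d s r i \<alpha>"
  have J_Ja: "J = finsum (ideals n) Ja {1..r}" by (simp add: J_def J_sum_def Ja_def)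
  have J: "ideal J (poly_ring n)"
    unfolding J_Ja by (rule finsum_ideals(1)) (auto intro: Ja)
  have Jin: "J_ideal n d s i \<alpha> a lam t \<subseteq> J" if "a \<in> {1..r}" "(lam, t) \<in> P_set d s r \<alpha> a" for a lam t
  proof -
    have "Ja a \<subseteq> J" unfolding J_Ja by (rule finsum_ideals(2)[OF _ _ that(1)]) (auto intro: Ja)
    then show ?thesis using Ja_ge[OF that] by auto
  qed
  have Jle: "J \<subseteq> mspan n colon_exponents"
    unfolding J_Ja
    by (rule finsum_ideals(3)[OF _ _ ideal_mspan[OF up_closed_colon]]) (use Ja Ja_le in auto)
  define I :: "'k mpol set" where "I = pack_ideal all_pieces"
  have I: "ideal I (poly_ring n)" unfolding I_def by (rule ideal_pack_ideal)
  have Ile: "I \<subseteq> mspan n colon_exponents"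
    unfolding I_def pack_ideal_def mspan_def colon_exponents_def
    by (auto simp: lookup_add intro: packs_mono)
  have mem: "p \<in> J <+>\<^bsub>poly_ring n\<^esub> I \<longleftrightarrow> (\<exists>a\<in>J. \<exists>b\<in>I. p = a + b)" for p
    by (auto simp: set_add_def')
  have z: "0 \<in> J" "0 \<in> I"
    using additive_subgroup.zero_closed[OF ideal.axioms(1)[OF J]] additive_subgroup.zero_closed[OF ideal.axioms(1)[OF I]]
    by auto
  have JI: "ideal (J <+>\<^bsub>poly_ring n\<^esub> I) (poly_ring n)" by (rule S.add_ideals[OF J I])
  have sub: "p \<in> J <+>\<^bsub>poly_ring n\<^esub> I" if "p \<in> J \<or> p \<in> I" for p
    using that z unfolding mem by (metis add.left_neutral add.right_neutral)
  show ?thesis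
    unfolding J_def[symmetric] I_def[symmetric]
  proof (intro equalityI subsetI)
    fix p :: "'k mpol" assume "p \<in> J <+>\<^bsub>poly_ring n\<^esub> I"
    then obtain a b where "p = a + b" "a \<in> mspan n colon_exponents" "b \<in> mspan n colon_exponents"
      using Jle Ile unfolding mem by blast
    then show "p \<in> mspan n colon_exponents"
      using additive_subgroup.a_closed[OF ideal.axioms(1)[OF ideal_mspan[OF up_closed_colon, of n, where 'k = 'k]]] by simp
  next
    fix p :: "'k mpol" assume p: "p \<in> mspan n colon_exponents"
    show "p \<in> J <+>\<^bsub>poly_ring n\<^esub> I"
    proof (rule ideal_memI[OF JI], rule sub)
      fix m assume m: "m \<in> Poly_Mapping.keys p"
      then have km: "Poly_Mapping.keys m \<subseteq> {1..n}" "m \<in> colon_exponents"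
        using p carrier_keys[of p n m] by (auto simp: mspan_def)
      show "pmonom m \<in> J \<or> pmonom m \<in> I"
      proof (cases "packs all_pieces (Poly_Mapping.lookup m)")
        case True
        then show ?thesis using km(1) by (simp add: I_def pmonom_pack_ideal)
      next
        case False
        obtain a lam t where "a \<in> {1..r}" "(lam, t) \<in> P_set d s r \<alpha> a"
          "pmonom m \<in> (J_ideal n d s i \<alpha> a lam t :: 'k mpol set)"
          by (rule socle_monomial[OF km(1) False]) (use km(2) in \<open>auto simp: colon_exponents_def\<close>)
        then show ?thesis using Jin by blast
      qed
    qed
  qed
qed

lemma mult_in_pack_ideal_iff:
  fixes f :: "('k::field) mpol"
  assumes f: "f \<in> carrier (poly_ring n)"
  shows "(\<forall>g\<in>Idl\<^bsub>poly_ring n\<^esub> (X ` {1..n}). g * f \<in> pack_ideal all_pieces) \<longleftrightarrow> f \<in> mspan n colon_exponents"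
proof -
  have "Idl\<^bsub>poly_ring n\<^esub> (X ` {1..n}) = (frob_ideal n n 1 :: 'k mpol set)"
    by (simp add: frob_ideal_def)
  then have M: "Idl\<^bsub>poly_ring n\<^esub> (X ` {1..n}) = (mspan n {m. \<exists>k\<in>{1..n}. 1 \<le> Poly_Mapping.lookup m k} :: 'k mpol set)"
    by (simp add: frob_ideal_eq)
  show ?thesis
    unfolding M
  proof
    assume L: "\<forall>g\<in>mspan n {m. \<exists>k\<in>{1..n}. 1 \<le> Poly_Mapping.lookup m k}. g * f \<in> pack_ideal all_pieces"
    have "m \<in> colon_exponents" if m: "m \<in> Poly_Mapping.keys f" for m
      unfolding colon_exponents_def
    proof (intro CollectI ballI)
      fix k assume k: "k \<in> {1..n}"
      have "(pmonom (Poly_Mapping.single k 1) :: 'k mpol) \<in> mspan n {m. \<exists>k\<in>{1..n}. 1 \<le> Poly_Mapping.lookup m k}"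
        using k by (auto simp: pmonom_mspan intro!: bexI[of _ k])
      then have "pmonom (Poly_Mapping.single k 1) * f \<in> pack_ideal all_pieces" using L by blast
      moreover have "Poly_Mapping.single k 1 + m \<in> Poly_Mapping.keys (pmonom (Poly_Mapping.single k 1) * f)"
        using m by (simp add: in_keys_iff lookup_pmonom_mult)
      ultimately show "packs all_pieces (Poly_Mapping.lookup (m + Poly_Mapping.single k 1))"
        unfolding pack_ideal_def mspan_def by (auto simp: add.commute)
    qed
    then show "f \<in> mspan n colon_exponents" using f by (auto simp: mspan_def)
  next
    assume R: "f \<in> mspan n colon_exponents"
    show "\<forall>g\<in>mspan n {m. \<exists>k\<in>{1..n}. 1 \<le> Poly_Mapping.lookup m k}. g * f \<in> pack_ideal all_pieces"
    proof
      fix g :: "'k mpol" assume g: "g \<in> mspan n {m. \<exists>k\<in>{1..n}. 1 \<le> Poly_Mapping.lookup m k}"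
      have "packs all_pieces (Poly_Mapping.lookup x)" if x: "x \<in> Poly_Mapping.keys (g * f)" for x
      proof -
        obtain b m where bm: "x = b + m" "b \<in> Poly_Mapping.keys g" "m \<in> Poly_Mapping.keys f"
          using keys_mult[of g f] x by blast
        then obtain k where k: "k \<in> {1..n}" "1 \<le> Poly_Mapping.lookup b k" using g by (auto simp: mspan_def)
        have "packs all_pieces (Poly_Mapping.lookup (m + Poly_Mapping.single k 1))"
          using R bm(3) k(1) by (auto simp: mspan_def colon_exponents_def)
        then show ?thesis
          by (rule packs_mono) (use bm(1) k(2) in \<open>auto simp: lookup_add lookup_single when_def\<close>)
      qed
      then show "g * f \<in> pack_ideal all_pieces"
        using f g carrier_poly_ring_mult[of g n f] by (auto simp: pack_ideal_def mspan_def)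
    qed
  qed
qed

lemma socle_eq:
  "socle n (pack_ideal all_pieces :: ('k::field) mpol set) = quot_image n (pack_ideal all_pieces) (mspan n colon_exponents)"
proof -
  define I :: "'k mpol set" where "I = pack_ideal all_pieces"
  interpret S: cring "poly_ring n :: 'k mpol ring" by (rule cring_poly_ring)
  interpret I: ideal I "poly_ring n" unfolding I_def by (rule ideal_pack_ideal)
  have gI: "Idl\<^bsub>poly_ring n\<^esub> (X ` {1..n}) \<subseteq> (carrier (poly_ring n) :: 'k mpol set)"
    by (intro S.genideal_minimal S.oneideal) (auto simp: X_def)
  have ann: "(\<forall>g\<in>Idl\<^bsub>poly_ring n\<^esub> (X ` {1..n}). (I +>\<^bsub>poly_ring n\<^esub> g) \<otimes>\<^bsub>poly_ring n Quot I\<^esub> (I +>\<^bsub>poly_ring n\<^esub> f) = \<zero>\<^bsub>poly_ring n Quot I\<^esub>)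
     \<longleftrightarrow> f \<in> mspan n colon_exponents" if f: "f \<in> carrier (poly_ring n)" for f
  proof -
    have "(I +>\<^bsub>poly_ring n\<^esub> g) \<otimes>\<^bsub>poly_ring n Quot I\<^esub> (I +>\<^bsub>poly_ring n\<^esub> f) = \<zero>\<^bsub>poly_ring n Quot I\<^esub> \<longleftrightarrow> g * f \<in> I"
      if "g \<in> Idl\<^bsub>poly_ring n\<^esub> (X ` {1..n})" for g
    proof -
      have g: "g \<in> carrier (poly_ring n)" using that gI by blast
      have gf: "g * f \<in> carrier (poly_ring n)" by (rule carrier_poly_ring_mult[OF g f])
      have "(I +>\<^bsub>poly_ring n\<^esub> g) \<otimes>\<^bsub>poly_ring n Quot I\<^esub> (I +>\<^bsub>poly_ring n\<^esub> f) = I +>\<^bsub>poly_ring n\<^esub> (g * f)"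
        using I.rcoset_mult_add[OF g f] by (simp add: FactRing_def)
      moreover have "I +>\<^bsub>poly_ring n\<^esub> (g * f) = I \<longleftrightarrow> g * f \<in> I"
        using I.a_rcos_self[OF gf] I.a_rcos_const[of "g * f"] by auto
      ultimately show ?thesis by (simp add: FactRing_def)
    qed
    then show ?thesis using mult_in_pack_ideal_iff[OF f] unfolding I_def by simp
  qed
  have carr: "carrier (poly_ring n Quot I) = (\<lambda>f. I +>\<^bsub>poly_ring n\<^esub> f) ` carrier (poly_ring n)"
    by (auto simp: FactRing_def A_RCOSETS_def' )
  show ?thesis
    unfolding socle_def quot_image_def I_def[symmetric] carr
    using ann by (auto simp: mspan_def)
qed

end

theorem theorem1p5p4:
  fixes n r s :: nat and d i \<alpha> :: "nat \<Rightarrow> nat"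
    and u :: "('k::field) mpol" and I J :: "'k mpol set"
  assumes "2 \<le> n"
    and "d_sequence d s"
    and "1 \<le> r" and "2 \<le> i 1" and "strict_mono_on {1..r} i" and "i r = n"
    and "\<And>q. q \<in> {1..r} \<Longrightarrow> 0 < \<alpha> q"
    and "u = (\<Prod>q=1..r. X (i q) ^ \<alpha> q)"
    and "I = d_fixed_hull n d s u"
    and "J = J_sum n d s r i \<alpha>"
  shows "I = prod_ideal n d s r i \<alpha> \<and>
    socle n I = quot_image n I (J <+>\<^bsub>poly_ring n\<^esub> I)"
proof -
  interpret principal_d_fixed n d s r i \<alpha>
    by unfold_locales (use assms in auto)
  have I: "I = pack_ideal all_pieces"
    unfolding assms(9) all_pieces_def by (rule d_fixed_hull_eq[OF i_mono i_range(1) assms(8)])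
  moreover have "prod_ideal n d s r i \<alpha> = (pack_ideal all_pieces :: 'k mpol set)"
    unfolding all_pieces_def by (rule prod_ideal_eq[OF i_range(1)])
  moreover have "socle n I = quot_image n I (J <+>\<^bsub>poly_ring n\<^esub> I)"
    unfolding I assms(10) sum_J_eq by (rule socle_eq)
  ultimately show ?thesis by simp
qed

end
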